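(* Let $F$ be a field of characteristic different from two, and let $(V',b')$ be a non-degenerate $F$-bilinear space of dimension four which has a decomposable asymmetry, but does not have a generic decomposable asymmetry. Then $(V',b')$ is decomposable if and only if $\det(b')$ is trivial in $F^\times/F^{\times 2}$.
   Context: An $F$-bilinear space $(V,b)$ is a finite-dimensional $F$-vector space $V$ with an $F$-bilinear form $b$ (no symmetry assumed). The asymmetry of a non-degenerate $b$ is the unique endomorphism $a_b$ of $V$ with $b(x,y)=b(y,a_b(x))$ for all $x,y\in V$. Asymmetries $a_b$ (on $V$) and $a_{b'}$ (on $V'$) are conjugate if $a_{b'}=fa_bf^{-1}$ for some linear isomorphism $f:V\to V'$. $\det(b)$ is the square class of the determinant of a matrix of $b$. $(V,b)$ is decomposable if $(V,b)\simeq(V_1,\varphi_1)\otimes_F(V_2,\varphi_2)$ for some $F$-bilinear spaces with $\dim_F(V_i)\geq 2$, $i=1,2$. $(V',b')$ has a decomposable asymmetry if $a_{b'}$ is conjugate to $a_b$ for some decomposable (non-degenerate) $F$-bilinear space $(V,b)$. For $a\in F\setminus\{2\}$, $b_a$ is the bilinear form on $F^2$ whose matrix in the canonical basis is $\begin{pmatrix}1&1\\0&\frac{1}{2-a}\end{pmatrix}$. A non-degenerate $F$-bilinear space $(V',b')$ of dimension four has a generic decomposable asymmetry if its asymmetry is conjugate to the asymmetry of $(F^2,b_{a_1})\otimes_F(F^2,b_{a_2})$ for some $a_1,a_2\in F\setminus\{-2,2\}$ such that $a_i^2-4$ is not a square in $F^\times$ for $i=1,2$. *)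

theory Defs
  imports
    "Jordan_Normal_Form.Determinant"
    "HOL-Library.FuncSet"
    "HOL-Library.Function_Algebras"
    "HOL-Computational_Algebra.Computational_Algebra"
    Complex_Main
begin

text \<open>
  The field \<open>F\<close> is a type of class \<^class>\<open>field\<close>. A vector space is a subspace \<open>V\<close> of an arbitrary
  ambient vector space (a type with scalar multiplication \<open>s\<close>). Since one cannot quantify
  existentially over types, existentially quantified spaces range over the finite-dimensional
  subspaces of \<open>F\<^sup>\<nat>\<close>, the type \<open>nat \<Rightarrow> 'a\<close>; every finite-dimensional vector space is isomorphic to
  one of these, and all notions below are invariant under isometry.
\<close>

section \<open>Bilinear spaces\<close>

locale bilinear_space = vector_space s
  for s :: "'a::field \<Rightarrow> 'v::ab_group_add \<Rightarrow> 'v" +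
  fixes V :: "'v set" and b :: "'v \<Rightarrow> 'v \<Rightarrow> 'a"
  assumes subspace_V: "subspace V"
    and finite_dim: "\<exists>B. finite B \<and> span B = V"
    and add_left: "\<lbrakk>x \<in> V; y \<in> V; z \<in> V\<rbrakk> \<Longrightarrow> b (x + y) z = b x z + b y z"
    and add_right: "\<lbrakk>x \<in> V; y \<in> V; z \<in> V\<rbrakk> \<Longrightarrow> b x (y + z) = b x y + b x z"
    and scale_left: "\<lbrakk>x \<in> V; y \<in> V\<rbrakk> \<Longrightarrow> b (s c x) y = c * b x y"
    and scale_right: "\<lbrakk>x \<in> V; y \<in> V\<rbrakk> \<Longrightarrow> b x (s c y) = c * b x y"

text \<open>In finite dimension a trivial left radical is equivalent to a trivial right radical.\<close>

definition nondegenerate :: "'v::zero set \<Rightarrow> ('v \<Rightarrow> 'v \<Rightarrow> 'a::zero) \<Rightarrow> bool" where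
  "nondegenerate V b \<longleftrightarrow> (\<forall>x\<in>V. (\<forall>y\<in>V. b x y = 0) \<longrightarrow> x = 0)"

definition linear_map ::
  "('a \<Rightarrow> 'v \<Rightarrow> 'v) \<Rightarrow> 'v set \<Rightarrow> ('a \<Rightarrow> 'w \<Rightarrow> 'w) \<Rightarrow> 'w set
    \<Rightarrow> ('v::ab_group_add \<Rightarrow> 'w::ab_group_add) \<Rightarrow> bool" where
  "linear_map s V s' V' f \<longleftrightarrow> f \<in> V \<rightarrow> V'
     \<and> (\<forall>x\<in>V. \<forall>y\<in>V. f (x + y) = f x + f y) \<and> (\<forall>c. \<forall>x\<in>V. f (s c x) = s' c (f x))"

definition linear_iso ::
  "('a \<Rightarrow> 'v \<Rightarrow> 'v) \<Rightarrow> 'v set \<Rightarrow> ('a \<Rightarrow> 'w \<Rightarrow> 'w) \<Rightarrow> 'w set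
    \<Rightarrow> ('v::ab_group_add \<Rightarrow> 'w::ab_group_add) \<Rightarrow> bool" where
  "linear_iso s V s' V' f \<longleftrightarrow> linear_map s V s' V' f \<and> bij_betw f V V'"

definition isometric ::
  "('a \<Rightarrow> 'v \<Rightarrow> 'v) \<Rightarrow> 'v::ab_group_add set \<Rightarrow> ('v \<Rightarrow> 'v \<Rightarrow> 'a)
    \<Rightarrow> ('a \<Rightarrow> 'w \<Rightarrow> 'w) \<Rightarrow> 'w::ab_group_add set \<Rightarrow> ('w \<Rightarrow> 'w \<Rightarrow> 'a) \<Rightarrow> bool" where
  "isometric s V b s' V' b' \<longleftrightarrow>
     (\<exists>f. linear_iso s V s' V' f \<and> (\<forall>x\<in>V. \<forall>y\<in>V. b' (f x) (f y) = b x y))"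

section \<open>Asymmetries\<close>

text \<open>Membership in \<^const>\<open>extensional\<close> makes the endomorphism of \<open>V\<close> unique as a HOL function.\<close>

definition asymmetry ::
  "('a \<Rightarrow> 'v \<Rightarrow> 'v) \<Rightarrow> 'v::ab_group_add set \<Rightarrow> ('v \<Rightarrow> 'v \<Rightarrow> 'a) \<Rightarrow> 'v \<Rightarrow> 'v" where
  "asymmetry s V b = (THE a. a \<in> extensional V \<and> linear_map s V s V a
     \<and> (\<forall>x\<in>V. \<forall>y\<in>V. b x y = b y (a x)))"

definition conjugate_endo ::
  "('a \<Rightarrow> 'v \<Rightarrow> 'v) \<Rightarrow> 'v::ab_group_add set \<Rightarrow> ('v \<Rightarrow> 'v)
    \<Rightarrow> ('a \<Rightarrow> 'w \<Rightarrow> 'w) \<Rightarrow> 'w::ab_group_add set \<Rightarrow> ('w \<Rightarrow> 'w) \<Rightarrow> bool" where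
  "conjugate_endo s V a s' V' a' \<longleftrightarrow>
     (\<exists>f. linear_iso s V s' V' f \<and> (\<forall>y\<in>V'. a' y = f (a (inv_into V f y))))"

section \<open>Determinants\<close>

definition ordered_basis ::
  "('a::field \<Rightarrow> 'v::ab_group_add \<Rightarrow> 'v) \<Rightarrow> 'v set \<Rightarrow> 'v list \<Rightarrow> bool" where
  "ordered_basis s V vs \<longleftrightarrow> distinct vs \<and> \<not> module.dependent s (set vs) \<and> module.span s (set vs) = V"

definition gram_matrix :: "('v \<Rightarrow> 'v \<Rightarrow> 'a) \<Rightarrow> 'v list \<Rightarrow> 'a mat" where
  "gram_matrix b vs = mat (length vs) (length vs) (\<lambda>(i, j). b (vs ! i) (vs ! j))"

text \<open>For \<open>d \<noteq> 0\<close> this is the coset of \<open>d\<close> modulo the nonzero squares.\<close>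

definition square_class :: "'a::field \<Rightarrow> 'a set" where
  "square_class d = {d * u\<^sup>2 | u. u \<noteq> 0}"

text \<open>The square class does not depend on the chosen basis.\<close>

definition det_class ::
  "('a::field \<Rightarrow> 'v::ab_group_add \<Rightarrow> 'v) \<Rightarrow> 'v set \<Rightarrow> ('v \<Rightarrow> 'v \<Rightarrow> 'a) \<Rightarrow> 'a set" where
  "det_class s V b = square_class (det (gram_matrix b (SOME vs. ordered_basis s V vs)))"

section \<open>Tensor products\<close>

definition fscale :: "'a::times \<Rightarrow> ('i \<Rightarrow> 'a) \<Rightarrow> 'i \<Rightarrow> 'a" where
  "fscale c x = (\<lambda>i. c * x i)"

definition tensor :: "('i \<Rightarrow> 'a::times) \<Rightarrow> ('j \<Rightarrow> 'a) \<Rightarrow> 'i \<times> 'j \<Rightarrow> 'a" where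
  "tensor x y = (\<lambda>(i, j). x i * y j)"

text \<open>
  For subspaces \<open>V\<^sub>1\<close> of \<open>F\<^sup>I\<close> and \<open>V\<^sub>2\<close> of \<open>F\<^sup>J\<close>, the canonical map from \<open>V\<^sub>1 \<otimes> V\<^sub>2\<close> to the functions on
  \<open>I \<times> J\<close> is injective; its image, the span of the pure tensors, is taken as \<open>V\<^sub>1 \<otimes> V\<^sub>2\<close>.
\<close>

definition tensor_space :: "('i \<Rightarrow> 'a::field) set \<Rightarrow> ('j \<Rightarrow> 'a) set \<Rightarrow> ('i \<times> 'j \<Rightarrow> 'a) set" where
  "tensor_space V1 V2 = module.span fscale {tensor x y | x y. x \<in> V1 \<and> y \<in> V2}"

text \<open>The form is unique on the tensor space; its values elsewhere are irrelevant.\<close>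

definition tensor_form ::
  "('i \<Rightarrow> 'a::field) set \<Rightarrow> (('i \<Rightarrow> 'a) \<Rightarrow> ('i \<Rightarrow> 'a) \<Rightarrow> 'a)
    \<Rightarrow> ('j \<Rightarrow> 'a) set \<Rightarrow> (('j \<Rightarrow> 'a) \<Rightarrow> ('j \<Rightarrow> 'a) \<Rightarrow> 'a)
    \<Rightarrow> ('i \<times> 'j \<Rightarrow> 'a) \<Rightarrow> ('i \<times> 'j \<Rightarrow> 'a) \<Rightarrow> 'a" where
  "tensor_form V1 b1 V2 b2 = (SOME b. bilinear_space fscale (tensor_space V1 V2) b
     \<and> (\<forall>x1\<in>V1. \<forall>y1\<in>V1. \<forall>x2\<in>V2. \<forall>y2\<in>V2.
          b (tensor x1 x2) (tensor y1 y2) = b1 x1 y1 * b2 x2 y2))"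

section \<open>Decomposability\<close>

definition decomposable ::
  "('a::field \<Rightarrow> 'v::ab_group_add \<Rightarrow> 'v) \<Rightarrow> 'v set \<Rightarrow> ('v \<Rightarrow> 'v \<Rightarrow> 'a) \<Rightarrow> bool" where
  "decomposable s V b \<longleftrightarrow>
     (\<exists>(V1 :: (nat \<Rightarrow> 'a) set) b1 (V2 :: (nat \<Rightarrow> 'a) set) b2.
        bilinear_space fscale V1 b1 \<and> bilinear_space fscale V2 b2
        \<and> vector_space.dim fscale V1 \<ge> 2 \<and> vector_space.dim fscale V2 \<ge> 2
        \<and> isometric s V b fscale (tensor_space V1 V2) (tensor_form V1 b1 V2 b2))"

definition has_decomposable_asymmetry ::
  "('a::field \<Rightarrow> 'v::ab_group_add \<Rightarrow> 'v) \<Rightarrow> 'v set \<Rightarrow> ('v \<Rightarrow> 'v \<Rightarrow> 'a) \<Rightarrow> bool" where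
  "has_decomposable_asymmetry s' V' b' \<longleftrightarrow>
     (\<exists>(V :: (nat \<Rightarrow> 'a) set) b.
        bilinear_space fscale V b \<and> nondegenerate V b \<and> decomposable fscale V b
        \<and> conjugate_endo fscale V (asymmetry fscale V b) s' V' (asymmetry s' V' b'))"

section \<open>Generic decomposable asymmetries\<close>

definition coord_space :: "nat \<Rightarrow> (nat \<Rightarrow> 'a::zero) set" where
  "coord_space n = {x. \<forall>i\<ge>n. x i = 0}"

definition matrix_form :: "'a::comm_ring_1 mat \<Rightarrow> (nat \<Rightarrow> 'a) \<Rightarrow> (nat \<Rightarrow> 'a) \<Rightarrow> 'a" where
  "matrix_form M x y = (\<Sum>i<dim_row M. \<Sum>j<dim_col M. x i * M $$ (i, j) * y j)"

definition b_form :: "'a::field \<Rightarrow> (nat \<Rightarrow> 'a) \<Rightarrow> (nat \<Rightarrow> 'a) \<Rightarrow> 'a" where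
  "b_form a = matrix_form (mat_of_rows_list 2 [[1, 1], [0, 1 / (2 - a)]])"

definition has_generic_decomposable_asymmetry ::
  "('a::field \<Rightarrow> 'v::ab_group_add \<Rightarrow> 'v) \<Rightarrow> 'v set \<Rightarrow> ('v \<Rightarrow> 'v \<Rightarrow> 'a) \<Rightarrow> bool" where
  "has_generic_decomposable_asymmetry s' V' b' \<longleftrightarrow>
     (\<exists>a1 a2. a1 \<notin> {-2, 2} \<and> a2 \<notin> {-2, 2}
        \<and> \<not> (\<exists>u. u \<noteq> 0 \<and> a1\<^sup>2 - 4 = u\<^sup>2) \<and> \<not> (\<exists>u. u \<noteq> 0 \<and> a2\<^sup>2 - 4 = u\<^sup>2)
        \<and> (let V = tensor_space (coord_space 2) (coord_space 2);
               b = tensor_form (coord_space 2) (b_form a1) (coord_space 2) (b_form a2)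
           in conjugate_endo fscale V (asymmetry fscale V b) s' V' (asymmetry s' V' b')))"

end

theory Submission
  imports Defs
begin

text \<open>
  The determinant of a tensor product of two planes is a square. For the converse, a decomposable
  asymmetry in dimension four is \<open>a\<^sub>1 \<otimes> a\<^sub>2\<close> for two asymmetries of planes, and the asymmetry of a
  plane is \<open>\<plusminus>1\<close> or cyclic with characteristic polynomial \<open>X\<^sup>2 - t X + 1\<close>, \<open>t \<noteq> 2\<close>. The relation
  \<open>b x y = b y (A x)\<close> determines \<open>b\<close> from \<open>A\<close> up to few parameters, so unless both factors are
  generic a basis with Gram matrix \<open>P \<otimes> Q\<close> can be written down. The determinant matters only if
  \<open>A = 1\<close>, if both factors are cyclic with \<open>t = -2\<close>, or if both are the same split cyclic asymmetry.
\<close>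

section \<open>Ordered bases\<close>

text \<open>The rule \<open>b x y = b y (a x)\<close> gives
  \<open>b x (a x) = b (a x) (a x) = b x x\<close>. So a cyclic plane with \<open>b x x = 1\<close>
  has Gram matrix ((1, 1), (t - 1, 1)), of determinant 2 - t, whence t \<noteq> 2. This matrix,
  sometimes in the basis \<open>x\<close>, \<open>x + a x\<close>, is a factor in most of the
  decompositions. A trace other than 2 that is not generic means that X^2 - t X + 1 has either two
  distinct roots l and k = 1/l in the field or the double root -1. In the first case
  \<open>V\<close> is a sum of two \<open>A\<close>-stable planes on which \<open>A\<close> is l
  times and k times the other factor. Eigenvectors pair to zero unless their eigenvalues multiply to
  1, so these planes are usually isotropic and dual to each other, and a change of basis in one of
  them normalises the pairing. In each of the three cases where the determinant matters,
  \<open>A\<close> has eigenvalue 1 and leaves a parameter of \<open>b\<close> free: a whole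
  symmetric form, a symmetric form on an eigenplane, or the ratio of two scalars. The square class
  decides whether this parameter fits a Kronecker product.\<close>

context vector_space
begin

text \<open>Coefficients indexed by position rather than by vector let one hypothesis give both
  conclusions: a repeated entry already produces a nontrivial relation.\<close>

lemma indep_listI:
  assumes "\<And>c i. (\<Sum>j<length vs. scale (c j) (vs ! j)) = 0 \<Longrightarrow> i < length vs \<Longrightarrow> c i = 0"
  shows "distinct vs \<and> independent (set vs)"
proof
  show d: "distinct vs"
  proof (rule ccontr)
    assume "\<not> distinct vs"
    then obtain i j where ij: "i < length vs" "j < length vs" "i \<noteq> j" "vs ! i = vs ! j"
      by (auto simp: distinct_conv_nth)
    \<comment> \<open>Equal entries at \<open>i\<close> and \<open>j\<close> are cancelled by the
      coefficients 1 at \<open>i\<close> and -1 at \<open>j\<close>.\<close>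
    define c :: "nat \<Rightarrow> 'a" where "c k = (if k = i then 1 else 0) - (if k = j then 1 else 0)" for k
    have "(\<Sum>k<length vs. scale (c k) (vs ! k))
       = (\<Sum>k<length vs. (if k = i then vs ! k else 0) - (if k = j then vs ! k else 0))"
      by (intro sum.cong) (auto simp: c_def)
    also have "\<dots> = 0" using ij by (simp add: sum_subtractf)
    finally have "c i = 0" using assms ij by blast
    then show False using ij by (simp add: c_def)
  qed
  show "independent (set vs)"
  proof (rule independent_if_scalars_zero)
    fix f x assume *: "(\<Sum>x\<in>set vs. scale (f x) x) = 0" "x \<in> set vs"
    have "(\<Sum>j<length vs. scale (f (vs ! j)) (vs ! j)) = (\<Sum>x\<in>set vs. scale (f x) x)"
      by (rule sum.reindex_bij_betw[OF bij_betw_nth[OF d]]) auto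
    moreover obtain i where "i < length vs" "x = vs ! i" using *(2) by (auto simp: in_set_conv_nth)
    ultimately show "f x = 0" using *(1) assms[of "\<lambda>j. f (vs ! j)" i] by simp
  qed simp
qed

lemma ordered_basis_coords:
  assumes "ordered_basis scale V vs" "x \<in> V"
  obtains c where "x = (\<Sum>j<length vs. scale (c j) (vs ! j))"
proof -
  have d: "distinct vs" and x: "x \<in> span (set vs)"
    using assms by (auto simp: ordered_basis_def)
  then obtain f where "x = (\<Sum>v\<in>set vs. scale (f v) v)"
    by (auto simp: span_finite)
  also have "\<dots> = (\<Sum>j<length vs. scale (f (vs ! j)) (vs ! j))"
    by (rule sum.reindex_bij_betw[OF bij_betw_nth[OF d], symmetric]) auto
  finally show ?thesis by (rule that)
qed

lemma ordered_basis_indep: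
  assumes "ordered_basis scale V vs" "(\<Sum>j<length vs. scale (c j) (vs ! j)) = 0" "i < length vs"
  shows "c i = 0"
proof -
  have d: "distinct vs" and ind: "independent (set vs)"
    using assms by (auto simp: ordered_basis_def)
  define g where "g = the_inv_into {..<length vs} ((!) vs)"
  have inj: "inj_on ((!) vs) {..<length vs}"
    using bij_betw_nth[OF d] by (auto simp: bij_betw_def)
  have g: "g (vs ! j) = j" if "j < length vs" for j
    using that the_inv_into_f_f[OF inj] by (auto simp: g_def)
  have "(\<Sum>v\<in>set vs. scale (c (g v)) v) = (\<Sum>j<length vs. scale (c (g (vs ! j))) (vs ! j))"
    by (rule sum.reindex_bij_betw[OF bij_betw_nth[OF d], symmetric]) auto
  also have "\<dots> = 0" using g assms(2) by simp
  finally have "c (g (vs ! i)) = 0"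
    using independentD[OF ind finite_set subset_refl, of "\<lambda>v. c (g v)" "vs ! i"] assms(3) by simp
  then show ?thesis using g assms(3) by simp
qed

lemma ordered_basis_length:
  assumes "ordered_basis scale V vs"
  shows "length vs = dim V"
proof -
  have "V = span (set vs)" "distinct vs" "independent (set vs)"
    using assms by (auto simp: ordered_basis_def)
  then show ?thesis using dim_span_eq_card_independent[of "set vs"] distinct_card[of vs] by simp
qed

lemma ordered_basis_in: "ordered_basis scale V vs \<Longrightarrow> i < length vs \<Longrightarrow> vs ! i \<in> V"
  by (auto simp: ordered_basis_def intro: span_base)

lemma ordered_basis_subset: "ordered_basis scale V vs \<Longrightarrow> set vs \<subseteq> V"
  by (auto simp: ordered_basis_def intro: span_base)

lemma ordered_basis_exists:
  assumes "finite S" "span S = V"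
  obtains vs where "ordered_basis scale V vs"
proof -
  obtain B where B: "B \<subseteq> V" "independent B" "V \<subseteq> span B" using basis_exists[of V] by metis
  have fin: "finite B" using independent_span_bound[OF assms(1) B(2)] B(1) unfolding assms(2) by simp
  have sub: "subspace V" unfolding assms(2)[symmetric] by (rule subspace_span)
  have sp: "span B = V" using span_minimal[OF B(1) sub] B(3) by (rule subset_antisym)
  obtain vs where "set vs = B \<and> distinct vs" using finite_distinct_list[OF fin] by (rule exE)
  then have "ordered_basis scale V vs" using B(2) sp by (simp add: ordered_basis_def)
  then show ?thesis by (rule that)
qed

text \<open>Spanning comes from counting: a vector of \<open>V\<close> outside the span could be
  adjoined, giving an independent set larger than a basis of \<open>V\<close>.\<close>

lemma ordered_basisI:
  assumes "finite S" "span S = V" "set vs \<subseteq> V" "length vs = dim V"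
    "\<And>c i. (\<Sum>j<length vs. scale (c j) (vs ! j)) = 0 \<Longrightarrow> i < length vs \<Longrightarrow> c i = 0"
  shows "ordered_basis scale V vs"
proof -
  have "distinct vs \<and> independent (set vs)" using assms(5) by (rule indep_listI)
  then have d: "distinct vs" and ind: "independent (set vs)" by auto
  have sub: "span (set vs) \<subseteq> V" 
    using assms(2) subspace_span by (intro span_minimal[OF assms(3)]) blast
  moreover have "V \<subseteq> span (set vs)"
  proof
    fix y assume y: "y \<in> V"
    show "y \<in> span (set vs)"
    proof (rule ccontr)
      assume n: "y \<notin> span (set vs)"
      obtain us where us: "ordered_basis scale V us" using ordered_basis_exists[OF assms(1,2)] .
      have "independent (insert y (set vs))" using n ind by (rule independent_insertI)
      moreover have "insert y (set vs) \<subseteq> span (set us)"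
        using us y assms(3) by (simp add: ordered_basis_def)
      ultimately have "card (insert y (set vs)) \<le> card (set us)"
        using independent_span_bound[of "set us"] by simp
      moreover have "y \<notin> set vs" using n span_base by blast
      moreover have "card (set us) = length us" "card (set vs) = length vs"
        using us d distinct_card by (auto simp only: ordered_basis_def)
      ultimately have "length vs < length us" by simp
      then show False using ordered_basis_length[OF us] assms(4) by simp
    qed
  qed
  ultimately have "span (set vs) = V" by (rule subset_antisym)
  then show ?thesis using d ind by (simp add: ordered_basis_def)
qed

end

lemma iso_of_ordered_bases:
  assumes vs: "vector_space s" "ordered_basis s V vs"
    and ws: "vector_space s'" "ordered_basis s' W ws" and len: "length vs = length ws"
  obtains f where "linear_iso s V s' W f" "\<And>i. i < length vs \<Longrightarrow> f (vs ! i) = ws ! i"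
proof -
  interpret P: vector_space_pair s s' by (rule vector_space_pair.intro[OF vs(1) ws(1)])
  have d: "distinct vs" and ind: "P.vs1.independent (set vs)" and spv: "P.vs1.span (set vs) = V"
    using vs by (auto simp: ordered_basis_def)
  have d': "distinct ws" and ind': "P.vs2.independent (set ws)" and spw: "P.vs2.span (set ws) = W"
    using ws by (auto simp: ordered_basis_def)
  define g where "g v = ws ! (the_inv_into {..<length vs} ((!) vs) v)" for v
  define f where "f = P.construct (set vs) g"
  have inj: "inj_on ((!) vs) {..<length vs}"
    using bij_betw_nth[OF d] by (auto simp: bij_betw_def)
  have lin: "Vector_Spaces.linear s s' f" unfolding f_def by (rule P.linear_construct[OF ind])
  interpret f: Vector_Spaces.linear s s' f by (rule lin)
  have fv: "f (vs ! i) = ws ! i" if "i < length vs" for i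
    using that P.construct_basis[OF ind, of "vs ! i" g] the_inv_into_f_f[OF inj, of i]
    by (simp add: f_def g_def)
  have im: "f ` set vs = set ws"
  proof -
    have "map f vs = ws" by (rule nth_equalityI) (use fv len in auto)
    then show ?thesis by (metis set_map)
  qed
  have "inj_on f (set vs)"
    by (rule eq_card_imp_inj_on) (use im d d' len in \<open>auto simp: distinct_card\<close>)
  then have "inj_on f V" using f.inj_on_span_iff_independent_image[of "set vs"] im ind' spv by simp
  moreover have "f ` V = W" using f.span_image[of "set vs"] im spv spw by simp
  ultimately have "bij_betw f V W" by (simp add: bij_betw_def)
  moreover have "linear_map s V s' W f" using \<open>f ` V = W\<close>
    by (auto simp: linear_map_def f.add f.scale)
  ultimately show ?thesis using that fv by (auto simp: linear_iso_def)
qed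

lemma linear_iso_bases:
  assumes "vector_space s" "ordered_basis s V vs" "vector_space s'" "module.subspace s' W"
    and f: "linear_iso s V s' W f"
  shows "ordered_basis s' W (map f vs)"
proof -
  interpret v: vector_space s by fact
  interpret w: vector_space s' by fact
  have bij: "bij_betw f V W" and add: "\<And>x y. x \<in> V \<Longrightarrow> y \<in> V \<Longrightarrow> f (x + y) = f x + f y"
    and sc: "\<And>c x. x \<in> V \<Longrightarrow> f (s c x) = s' c (f x)"
    using f by (auto simp: linear_iso_def linear_map_def)
  have sub: "v.subspace V" using assms(2) by (auto simp: ordered_basis_def)
  have f0: "f 0 = 0" using sc[of 0 0] v.subspace_0[OF sub] by simp
  have vin: "vs ! i \<in> V" if "i < length vs" for i using v.ordered_basis_in[OF assms(2) that] .
  \<comment> \<open>\<open>f\<close> is linear on \<open>V\<close> only, so combinations are pushed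
    through it by induction, with the partial sums kept in \<open>V\<close>.\<close>
  have sm: "f (\<Sum>j\<in>J. s (c j) (vs ! j)) = (\<Sum>j\<in>J. s' (c j) (f (vs ! j)))"
    if "finite J" "J \<subseteq> {..<length vs}" for c J
    using that
  proof (induction J rule: finite_induct)
    case (insert j J)
    have "(\<Sum>j\<in>J. s (c j) (vs ! j)) \<in> V" using insert vin
      by (intro v.subspace_sum[OF sub] v.subspace_scale[OF sub]) auto
    then show ?case using insert vin by (simp add: add sc v.subspace_scale[OF sub])
  qed (simp add: f0)
  have *: "distinct (map f vs) \<and> w.independent (set (map f vs))"
  proof (rule w.indep_listI)
    fix c i assume "(\<Sum>j<length (map f vs). s' (c j) (map f vs ! j)) = 0" and i: "i < length (map f vs)"
    then have "f (\<Sum>j<length vs. s (c j) (vs ! j)) = f 0" by (simp add: sm f0)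
    moreover have "(\<Sum>j<length vs. s (c j) (vs ! j)) \<in> V" using vin
      by (intro v.subspace_sum[OF sub] v.subspace_scale[OF sub]) auto
    ultimately have "(\<Sum>j<length vs. s (c j) (vs ! j)) = 0"
      using bij v.subspace_0[OF sub] by (auto simp: bij_betw_def inj_on_def)
    then show "c i = 0" using v.ordered_basis_indep[OF assms(2)] i by simp
  qed
  have "w.span (set (map f vs)) \<subseteq> W"
    using bij v.ordered_basis_subset[OF assms(2)] assms(4)
    by (intro w.span_minimal) (auto simp: bij_betw_def)
  moreover have "W \<subseteq> w.span (set (map f vs))"
  proof
    fix y assume "y \<in> W"
    then obtain x where x: "x \<in> V" "y = f x" using bij by (auto simp: bij_betw_def)
    obtain c where "x = (\<Sum>j<length vs. s (c j) (vs ! j))"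
      using v.ordered_basis_coords[OF assms(2) x(1)] .
    then have "y = (\<Sum>j<length vs. s' (c j) (f (vs ! j)))" using x sm by simp
    then show "y \<in> w.span (set (map f vs))"
      by (auto intro!: w.span_sum w.span_scale intro: w.span_base)
  qed
  ultimately show ?thesis using * by (auto simp: ordered_basis_def)
qed

section \<open>Bilinear forms and their asymmetries\<close>

unbundle no fps_syntax

lemma mult_mat_vec_eq_0:
  fixes A :: "'a::field mat"
  shows "A \<in> carrier_mat n n \<Longrightarrow> det A \<noteq> 0 \<Longrightarrow> A *\<^sub>v vec n c = 0\<^sub>v n \<Longrightarrow> i < n \<Longrightarrow> c i = 0"
  using det_0_iff_vec_prod_zero_field[of A n] by (metis index_vec index_zero_vec(1) vec_carrier)

context bilinear_space
begin

lemma V_closed [simp]: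
  "0 \<in> V" "x \<in> V \<Longrightarrow> y \<in> V \<Longrightarrow> x + y \<in> V" "x \<in> V \<Longrightarrow> y \<in> V \<Longrightarrow> x - y \<in> V"
  "x \<in> V \<Longrightarrow> - x \<in> V" "x \<in> V \<Longrightarrow> s c x \<in> V"
  using subspace_V by (auto intro: subspace_0 subspace_add subspace_diff subspace_neg subspace_scale)

lemma zero_left [simp]: "y \<in> V \<Longrightarrow> b 0 y = 0"
  using scale_left[of 0 y 0] by simp

lemma zero_right [simp]: "x \<in> V \<Longrightarrow> b x 0 = 0"
  using scale_right[of x 0 0] by simp

lemma neg_left: "x \<in> V \<Longrightarrow> y \<in> V \<Longrightarrow> b (- x) y = - b x y"
  using scale_left[of x y "-1"] by simp

lemma neg_right: "x \<in> V \<Longrightarrow> y \<in> V \<Longrightarrow> b x (- y) = - b x y"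
  using scale_right[of x y "-1"] by simp

lemma diff_left: "x \<in> V \<Longrightarrow> y \<in> V \<Longrightarrow> z \<in> V \<Longrightarrow> b (x - y) z = b x z - b y z"
  using add_left[of x "- y" z] by (simp add: neg_left)

lemma diff_right: "x \<in> V \<Longrightarrow> y \<in> V \<Longrightarrow> z \<in> V \<Longrightarrow> b z (x - y) = b z x - b z y"
  using add_right[of z x "- y"] by (simp add: neg_right)

lemmas bilin = add_left add_right scale_left scale_right neg_left neg_right diff_left diff_right

lemma sum_closed: "(\<And>i. i \<in> I \<Longrightarrow> f i \<in> V) \<Longrightarrow> sum f I \<in> V"
  using subspace_V by (rule subspace_sum)

lemma sum_left: "(\<And>i. i \<in> I \<Longrightarrow> f i \<in> V) \<Longrightarrow> y \<in> V \<Longrightarrow> b (sum f I) y = (\<Sum>i\<in>I. b (f i) y)"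
  by (induction I rule: infinite_finite_induct) (simp_all add: add_left sum_closed)

lemma sum_right: "(\<And>i. i \<in> I \<Longrightarrow> f i \<in> V) \<Longrightarrow> y \<in> V \<Longrightarrow> b y (sum f I) = (\<Sum>i\<in>I. b y (f i))"
  by (induction I rule: infinite_finite_induct) (simp_all add: add_right sum_closed)

lemma comb_closed: "set vs \<subseteq> V \<Longrightarrow> (\<Sum>j<length vs. s (c j) (vs ! j)) \<in> V"
  by (intro sum_closed V_closed) auto

lemma comb_left:
  "set vs \<subseteq> V \<Longrightarrow> y \<in> V \<Longrightarrow> b (\<Sum>j<length vs. s (c j) (vs ! j)) y = (\<Sum>j<length vs. c j * b (vs ! j) y)"
  by (subst sum_left) (auto intro!: sum.cong simp: scale_left subset_iff)

lemma comb_right: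
  "set vs \<subseteq> V \<Longrightarrow> y \<in> V \<Longrightarrow> b y (\<Sum>j<length vs. s (c j) (vs ! j)) = (\<Sum>j<length vs. c j * b y (vs ! j))"
  by (subst sum_right) (auto intro!: sum.cong simp: scale_right subset_iff)

lemma obtain_ordered_basis: obtains vs where "ordered_basis s V vs"
  using finite_dim ordered_basis_exists by metis

lemma gram_carrier [simp]: "gram_matrix f vs \<in> carrier_mat (length vs) (length vs)"
  by (simp add: gram_matrix_def)

lemma gram_mult_vec:
  assumes "set vs \<subseteq> V" "i < length vs"
  shows "(gram_matrix b vs *\<^sub>v vec (length vs) c) $ i = b (vs ! i) (\<Sum>j<length vs. s (c j) (vs ! j))"
  using assms by (subst comb_right) (auto simp: gram_matrix_def scalar_prod_def lessThan_atLeast0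
      intro!: sum.cong)

text \<open>A linear relation among the \<open>ws\<close> is a kernel vector of their Gram matrix.
  Thus values of \<open>b\<close> alone suffice to recognise a basis.\<close>

lemma gram_basis:
  assumes ws: "set ws \<subseteq> V" "length ws = dim V" and det: "det (gram_matrix b ws) \<noteq> 0"
  shows "ordered_basis s V ws"
proof -
  obtain S where S: "finite S" "span S = V" using finite_dim by blast
  show ?thesis
  proof (rule ordered_basisI[OF S ws])
    fix c i assume *: "(\<Sum>j<length ws. s (c j) (ws ! j)) = 0" "i < length ws"
    let ?c = "vec (length ws) c"
    have "gram_matrix b ws *\<^sub>v ?c = 0\<^sub>v (length ws)"
    proof (rule eq_vecI)
      fix i assume "i < dim_vec (0\<^sub>v (length ws) :: 'a vec)"
      then have i: "i < length ws" by simp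
      then have "ws ! i \<in> V" using ws by auto
      then show "(gram_matrix b ws *\<^sub>v ?c) $ i = 0\<^sub>v (length ws) $ i"
        using gram_mult_vec[OF ws(1) i, of c] i * by simp
    qed (simp add: gram_matrix_def)
    then show "c i = 0" using mult_mat_vec_eq_0[OF gram_carrier det] *(2) by blast
  qed
qed

text \<open>A kernel vector of the transposed Gram matrix holds the coordinates of an element of the
  left radical; the transpose appears because \<open>nondegenerate\<close> tests the first
  argument.\<close>

lemma nondegenerate_det:
  assumes nd: "nondegenerate V b" and vs: "ordered_basis s V vs"
  shows "det (gram_matrix b vs) \<noteq> 0"
proof
  assume "det (gram_matrix b vs) = 0"
  then have "det (transpose_mat (gram_matrix b vs)) = 0"
    using det_transpose[OF gram_carrier] by metis
  then obtain v where v: "v \<in> carrier_vec (length vs)" "v \<noteq> 0\<^sub>v (length vs)"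
      "transpose_mat (gram_matrix b vs) *\<^sub>v v = 0\<^sub>v (length vs)"
    using det_0_iff_vec_prod_zero_field[of "transpose_mat (gram_matrix b vs)" "length vs"]
    by auto
  have sub: "set vs \<subseteq> V" using ordered_basis_subset[OF vs] .
  define x where "x = (\<Sum>j<length vs. s (v $ j) (vs ! j))"
  have x: "x \<in> V" unfolding x_def using sub by (rule comb_closed)
  have xk: "b x (vs ! k) = 0" if k: "k < length vs" for k
  proof -
    have "b x (vs ! k) = (\<Sum>j<length vs. v $ j * b (vs ! j) (vs ! k))"
      unfolding x_def using sub k by (intro comb_left) auto
    also have "\<dots> = (transpose_mat (gram_matrix b vs) *\<^sub>v v) $ k"
      using v(1) k by (auto simp: gram_matrix_def scalar_prod_def lessThan_atLeast0 mult.commute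
          intro!: sum.cong)
    finally show ?thesis using v(3) k by simp
  qed
  have "b x y = 0" if "y \<in> V" for y
  proof -
    obtain c where "y = (\<Sum>j<length vs. s (c j) (vs ! j))"
      using ordered_basis_coords[OF vs \<open>y \<in> V\<close>] .
    then show ?thesis using comb_right[OF sub x, of c] xk by simp
  qed
  then have "x = 0" using nd x by (auto simp: nondegenerate_def)
  then have "v $ i = 0" if "i < length vs" for i
    using ordered_basis_indep[OF vs _ that, of "\<lambda>j. v $ j"] by (simp add: x_def)
  then have "v = 0\<^sub>v (length vs)" using v(1) by (intro eq_vecI) auto
  then show False using v(2) by simp
qed

lemma det_nondegenerate:
  assumes vs: "ordered_basis s V vs" and det: "det (gram_matrix b vs) \<noteq> 0"
  shows "nondegenerate V b"
  unfolding nondegenerate_def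
proof (intro ballI impI)
  fix x assume x: "x \<in> V" "\<forall>y\<in>V. b x y = 0"
  have sub: "set vs \<subseteq> V" using ordered_basis_subset[OF vs] .
  obtain c where c: "x = (\<Sum>j<length vs. s (c j) (vs ! j))"
    using ordered_basis_coords[OF vs x(1)] .
  let ?c = "vec (length vs) c"
  have "transpose_mat (gram_matrix b vs) *\<^sub>v ?c = 0\<^sub>v (length vs)"
  proof (rule eq_vecI)
    fix k assume "k < dim_vec (0\<^sub>v (length vs) :: 'a vec)"
    then have k: "k < length vs" by simp
    then have vk: "vs ! k \<in> V" using sub by auto
    have "(transpose_mat (gram_matrix b vs) *\<^sub>v ?c) $ k = (\<Sum>j<length vs. c j * b (vs ! j) (vs ! k))"
      using k by (auto simp: gram_matrix_def scalar_prod_def lessThan_atLeast0 mult.commute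
          intro!: sum.cong)
    also have "\<dots> = b x (vs ! k)" unfolding c using comb_left[OF sub vk] by simp
    finally show "(transpose_mat (gram_matrix b vs) *\<^sub>v ?c) $ k = 0\<^sub>v (length vs) $ k"
      using x(2) vk k by simp
  qed (simp add: gram_matrix_def)
  moreover have "det (transpose_mat (gram_matrix b vs)) \<noteq> 0"
    using det_transpose[OF gram_carrier] det by metis
  ultimately have "c i = 0" if "i < length vs" for i
    using that mult_mat_vec_eq_0[of "transpose_mat (gram_matrix b vs)" "length vs"] by simp
  then show "x = 0" by (simp add: c)
qed

lemma riesz:
  assumes nd: "nondegenerate V b" and vs: "ordered_basis s V vs"
  obtains z where "z \<in> V" "\<And>i. i < length vs \<Longrightarrow> b (vs ! i) z = \<phi> i"
proof -
  let ?G = "gram_matrix b vs" and ?n = "length vs"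
  have sub: "set vs \<subseteq> V" using ordered_basis_subset[OF vs] .
  have d: "det ?G \<noteq> 0" using nondegenerate_det[OF nd vs] .
  have adj: "adj_mat ?G \<in> carrier_mat ?n ?n" "?G * adj_mat ?G = det ?G \<cdot>\<^sub>m 1\<^sub>m ?n"
    using adj_mat[OF gram_carrier] by blast+
  \<comment> \<open>The coordinates of \<open>z\<close> are the inverse Gram matrix applied to
    \<phi>, the inverse being the adjugate divided by the determinant.\<close>
  define v where "v = adj_mat ?G *\<^sub>v vec ?n (\<lambda>i. \<phi> i / det ?G)"
  have v: "v \<in> carrier_vec ?n" using adj(1) by (simp add: v_def)
  define z where "z = (\<Sum>j<?n. s (v $ j) (vs ! j))"
  have z: "z \<in> V" unfolding z_def using sub by (rule comb_closed)
  have "?G *\<^sub>v v = (det ?G \<cdot>\<^sub>m 1\<^sub>m ?n) *\<^sub>v vec ?n (\<lambda>i. \<phi> i / det ?G)"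
    unfolding v_def
    using assoc_mult_mat_vec[OF gram_carrier[of b vs] adj(1), of "vec ?n (\<lambda>i. \<phi> i / det ?G)"]
    by (simp add: adj(2))
  also have "\<dots> = vec ?n \<phi>"
    using d by (intro eq_vecI) (auto simp: scalar_prod_def if_distrib[of "\<lambda>x. x * _"] cong: if_cong)
  finally have *: "?G *\<^sub>v v = vec ?n \<phi>" .
  have "b (vs ! i) z = \<phi> i" if i: "i < ?n" for i
  proof -
    have "vec ?n (\<lambda>j. v $ j) = v" using v by (intro eq_vecI) auto
    then show ?thesis using gram_mult_vec[OF sub i, of "\<lambda>j. v $ j"] * i by (simp add: z_def)
  qed
  then show ?thesis using z that by blast
qed

text \<open>\<open>nondegenerate\<close> speaks of the left radical, whereas the asymmetry sits in
  the right argument of \<open>b\<close>. The nonzero Gram determinant connects the two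
  sides.\<close>

lemma nondegenerate_right:
  assumes nd: "nondegenerate V b" and z: "z \<in> V" "\<And>x. x \<in> V \<Longrightarrow> b x z = 0"
  shows "z = 0"
proof -
  obtain vs where vs: "ordered_basis s V vs" by (rule obtain_ordered_basis)
  have sub: "set vs \<subseteq> V" using ordered_basis_subset[OF vs] .
  obtain c where c: "z = (\<Sum>j<length vs. s (c j) (vs ! j))"
    using ordered_basis_coords[OF vs z(1)] .
  have "gram_matrix b vs *\<^sub>v vec (length vs) c = 0\<^sub>v (length vs)"
  proof (rule eq_vecI)
    fix i assume "i < dim_vec (0\<^sub>v (length vs) :: 'a vec)"
    then have i: "i < length vs" by simp
    then have "vs ! i \<in> V" using sub by auto
    then show "(gram_matrix b vs *\<^sub>v vec (length vs) c) $ i = 0\<^sub>v (length vs) $ i"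
      using gram_mult_vec[OF sub i, of c] z(2) i by (simp add: c)
  qed (simp add: gram_matrix_def)
  then have "c i = 0" if "i < length vs" for i
    using that mult_mat_vec_eq_0[OF gram_carrier nondegenerate_det[OF nd vs]] by blast
  then show ?thesis by (simp add: c)
qed

lemma nondegenerate_eqI:
  assumes "nondegenerate V b" "y \<in> V" "z \<in> V" "\<And>x. x \<in> V \<Longrightarrow> b x y = b x z"
  shows "y = z"
  using nondegenerate_right[OF assms(1), of "y - z"] assms(2-4) by (simp add: diff_right)

text \<open>For fixed \<open>x\<close> the functional \<open>b x\<close> is represented in the right
  argument by a vector, which is taken as \<open>a x\<close>. Linearity and uniqueness hold because
  the right radical is trivial; restriction to \<open>V\<close> supplies extensionality.\<close>

lemma asymmetry_unique:
  assumes nd: "nondegenerate V b"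
  shows "\<exists>!a. a \<in> extensional V \<and> linear_map s V s V a \<and> (\<forall>x\<in>V. \<forall>y\<in>V. b x y = b y (a x))"
proof -
  obtain vs where vs: "ordered_basis s V vs" by (rule obtain_ordered_basis)
  have "\<exists>z\<in>V. \<forall>y\<in>V. b x y = b y z" if x: "x \<in> V" for x
  proof -
    obtain z where z: "z \<in> V" "\<And>i. i < length vs \<Longrightarrow> b (vs ! i) z = b x (vs ! i)"
      using riesz[OF nd vs, of "\<lambda>i. b x (vs ! i)"] by metis
    have "b x y = b y z" if y: "y \<in> V" for y
    proof -
      obtain c where c: "y = (\<Sum>j<length vs. s (c j) (vs ! j))"
        using ordered_basis_coords[OF vs y] .
      show ?thesis unfolding c
        using comb_left[OF ordered_basis_subset[OF vs] z(1)]
          comb_right[OF ordered_basis_subset[OF vs] x] z(2) by simp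
    qed
    then show ?thesis using z(1) by blast
  qed
  then obtain a where a: "\<And>x. x \<in> V \<Longrightarrow> a x \<in> V" "\<And>x y. x \<in> V \<Longrightarrow> y \<in> V \<Longrightarrow> b x y = b y (a x)"
    by metis
  let ?a = "restrict a V"
  have "linear_map s V s V ?a"
    unfolding linear_map_def
  proof (intro conjI ballI allI)
    fix x y assume xy: "x \<in> V" "y \<in> V"
    show "?a (x + y) = ?a x + ?a y"
    proof (rule nondegenerate_eqI[OF nd])
      fix w assume "w \<in> V"
      then show "b w (?a (x + y)) = b w (?a x + ?a y)"
        using xy by (simp add: bilin a flip: a(2))
    qed (use xy a in auto)
  next
    fix c x assume x: "x \<in> V"
    show "?a (s c x) = s c (?a x)"
    proof (rule nondegenerate_eqI[OF nd])
      fix w assume "w \<in> V"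
      then show "b w (?a (s c x)) = b w (s c (?a x))"
        using x by (simp add: bilin a flip: a(2))
    qed (use x a in auto)
  qed (use a in auto)
  then show ?thesis
  proof (intro ex1I[of _ ?a] conjI ballI)
    fix a' assume a': "a' \<in> extensional V \<and> linear_map s V s V a' \<and> (\<forall>x\<in>V. \<forall>y\<in>V. b x y = b y (a' x))"
    show "a' = ?a"
    proof (rule extensionalityI[of _ V])
      fix x assume x: "x \<in> V"
      then have a'x: "a' x \<in> V" using a' by (auto simp: linear_map_def)
      have "b y (a' x) = b y (a x)" if "y \<in> V" for y using x that a' a(2) by metis
      then show "a' x = ?a x"
        using x a(1) a'x by (intro nondegenerate_eqI[OF nd]) auto
    qed (use a' in auto)
  qed (use a in auto)
qed

lemma asymmetry:
  assumes nd: "nondegenerate V b"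
  shows "x \<in> V \<Longrightarrow> asymmetry s V b x \<in> V"
    and "x \<in> V \<Longrightarrow> y \<in> V \<Longrightarrow> b x y = b y (asymmetry s V b x)"
    and "x \<in> V \<Longrightarrow> y \<in> V \<Longrightarrow> asymmetry s V b (x + y) = asymmetry s V b x + asymmetry s V b y"
    and "x \<in> V \<Longrightarrow> asymmetry s V b (s c x) = s c (asymmetry s V b x)"
  using theI'[OF asymmetry_unique[OF nd], folded asymmetry_def]
  by (auto simp: linear_map_def)

lemma asymmetry_eqI:
  assumes nd: "nondegenerate V b" and "x \<in> V" "z \<in> V" "\<And>y. y \<in> V \<Longrightarrow> b x y = b y z"
  shows "asymmetry s V b x = z"
  using assms asymmetry[OF nd] by (intro nondegenerate_eqI[OF nd]) auto

text \<open>The rows of \<open>C\<close> are the coordinates of the \<open>ws\<close> in the chosen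
  basis. The two Gram matrices are congruent through \<open>C\<close>, so their determinants differ
  by the square of \<open>det C\<close>.\<close>

lemma det_class_gram:
  assumes ws: "set ws \<subseteq> V" "length ws = dim V" and det: "det (gram_matrix b ws) \<noteq> 0"
  shows "det_class s V b = square_class (det (gram_matrix b ws))"
proof -
  define vs where "vs = (SOME vs. ordered_basis s V vs)"
  have vs: "ordered_basis s V vs"
    unfolding vs_def using obtain_ordered_basis by (metis someI_ex)
  have sub: "set vs \<subseteq> V" using ordered_basis_subset[OF vs] .
  let ?n = "length vs"
  have len: "length ws = ?n" using ordered_basis_length[OF vs] ws(2) by simp
  have wsin: "ws ! i \<in> V" if "i < ?n" for i using ws(1) len that by auto
  have "\<forall>i. \<exists>c. i < ?n \<longrightarrow> ws ! i = (\<Sum>j<?n. s (c j) (vs ! j))"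
    using ordered_basis_coords[OF vs wsin] by metis
  then obtain c where c: "\<And>i. i < ?n \<Longrightarrow> ws ! i = (\<Sum>j<?n. s (c i j) (vs ! j))" by metis
  define C where "C = mat ?n ?n (\<lambda>(i, j). c i j)"
  have C: "C \<in> carrier_mat ?n ?n" by (simp add: C_def)
  have "gram_matrix b ws = C * gram_matrix b vs * transpose_mat C"
  proof (rule eq_matI)
    fix i j assume "i < dim_row (C * gram_matrix b vs * transpose_mat C)"
      "j < dim_col (C * gram_matrix b vs * transpose_mat C)"
    then have ij: "i < ?n" "j < ?n" by (auto simp: C_def)
    have "gram_matrix b ws $$ (i, j) = b (ws ! i) (ws ! j)"
      using ij len by (simp add: gram_matrix_def)
    also have "\<dots> = (\<Sum>l<?n. c j l * b (ws ! i) (vs ! l))"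
      using comb_right[OF sub wsin[OF ij(1)]] by (simp add: c[OF ij(2)])
    also have "\<dots> = (\<Sum>l<?n. c j l * (\<Sum>k<?n. c i k * b (vs ! k) (vs ! l)))"
      using comb_left[OF sub, of "vs ! _" "c i"] sub by (simp add: c[OF ij(1)] subset_iff)
    also have "\<dots> = (C * gram_matrix b vs * transpose_mat C) $$ (i, j)"
      using ij by (auto simp: C_def gram_matrix_def scalar_prod_def lessThan_atLeast0 mult.commute
          intro!: sum.cong)
    finally show "gram_matrix b ws $$ (i, j) = (C * gram_matrix b vs * transpose_mat C) $$ (i, j)" .
  qed (auto simp: gram_matrix_def C_def len)
  then have "det (gram_matrix b ws) = det (C * gram_matrix b vs * transpose_mat C)" by simp
  also have "\<dots> = det C * det (gram_matrix b vs) * det (transpose_mat C)"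
    using C by (simp add: det_mult[of _ ?n])
  also have "\<dots> = det (gram_matrix b vs) * (det C)\<^sup>2"
    using det_transpose[OF C] by (simp add: power2_eq_square)
  finally have eq: "det (gram_matrix b ws) = det (gram_matrix b vs) * (det C)\<^sup>2" .
  then have dC: "det C \<noteq> 0" using det by auto
  have "square_class (det (gram_matrix b ws)) = square_class (det (gram_matrix b vs))"
    unfolding square_class_def eq
  proof (intro equalityI subsetI; clarify)
    fix u :: 'a assume "u \<noteq> 0"
    then show "\<exists>ua. det (gram_matrix b vs) * (det C)\<^sup>2 * u\<^sup>2 = det (gram_matrix b vs) * ua\<^sup>2 \<and> ua \<noteq> 0"
      using dC by (intro exI[of _ "det C * u"]) (simp add: power_mult_distrib)
  next
    fix u :: 'a assume "u \<noteq> 0"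
    then show "\<exists>ua. det (gram_matrix b vs) * u\<^sup>2 = det (gram_matrix b vs) * (det C)\<^sup>2 * ua\<^sup>2 \<and> ua \<noteq> 0"
      using dC by (intro exI[of _ "u / det C"]) (simp add: power_divide)
  qed
  then show ?thesis by (simp add: det_class_def vs_def)
qed

end

lemma square_class_eq_1_iff:
  fixes d :: "'a::field"
  assumes "d \<noteq> 0"
  shows "square_class d = square_class 1 \<longleftrightarrow> (\<exists>r. d = r\<^sup>2)"
proof
  assume "square_class d = square_class 1"
  moreover have "d \<in> square_class d" by (auto simp: square_class_def intro!: exI[of _ 1])
  ultimately show "\<exists>r. d = r\<^sup>2" by (auto simp: square_class_def)
next
  assume "\<exists>r. d = r\<^sup>2"
  then obtain r where r: "d = r\<^sup>2" "r \<noteq> 0" using assms by auto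
  show "square_class d = square_class 1"
    unfolding square_class_def
  proof (intro equalityI subsetI; clarify)
    fix u :: 'a assume "u \<noteq> 0"
    then show "\<exists>ua. d * u\<^sup>2 = 1 * ua\<^sup>2 \<and> ua \<noteq> 0"
      using r by (intro exI[of _ "r * u"]) (simp add: power_mult_distrib)
  next
    fix u :: 'a assume "u \<noteq> 0"
    then show "\<exists>ua. 1 * u\<^sup>2 = d * ua\<^sup>2 \<and> ua \<noteq> 0"
      using r by (intro exI[of _ "u / r"]) (simp add: power_divide)
  qed
qed

section \<open>Tensor products\<close>

lemma vector_space_fscale: "vector_space (fscale :: 'a::field \<Rightarrow> ('i \<Rightarrow> 'a) \<Rightarrow> 'i \<Rightarrow> 'a)"
  by unfold_locales (auto simp: fscale_def fun_eq_iff algebra_simps)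

interpretation fs: vector_space "fscale :: 'a::field \<Rightarrow> ('i \<Rightarrow> 'a) \<Rightarrow> 'i \<Rightarrow> 'a"
  by (rule vector_space_fscale)

lemma tensor_add_left: "tensor (x + y) z = tensor x z + tensor y (z :: _ \<Rightarrow> 'a::field)"
  and tensor_add_right: "tensor z (x + y) = tensor z x + tensor (z :: _ \<Rightarrow> 'a) y"
  and tensor_scale_left: "tensor (fscale c x) z = fscale c (tensor x (z :: _ \<Rightarrow> 'a))"
  and tensor_scale_right: "tensor z (fscale c x) = fscale c (tensor z (x :: _ \<Rightarrow> 'a))"
  by (auto simp: tensor_def fscale_def fun_eq_iff algebra_simps)

lemma tensor_zero_left [simp]: "tensor 0 z = (0 :: _ \<Rightarrow> 'a::field)"
  and tensor_zero_right [simp]: "tensor z 0 = (0 :: _ \<Rightarrow> 'a)"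
  by (auto simp: tensor_def fun_eq_iff)

lemma sum_fun_apply: "(\<Sum>p\<in>P. f p) i = (\<Sum>p\<in>P. f p i)" for f :: "'p \<Rightarrow> 'i \<Rightarrow> 'a::comm_monoid_add"
  by (induction P rule: infinite_finite_induct) auto

text \<open>This is the injectivity of the canonical map from the tensor product to functions on
  pairs. Evaluation at (i, j) with j fixed gives a relation among the elements of \<open>X\<close>;
  its coefficients vanish for every j, which is a relation among the elements of
  \<open>Y\<close>.\<close>

lemma tensor_independent:
  fixes X :: "('i \<Rightarrow> 'a::field) set" and Y :: "('j \<Rightarrow> 'a) set"
  assumes "finite X" "fs.independent X" "finite Y" "fs.independent Y"
    and sum0: "(\<Sum>p\<in>X \<times> Y. fscale (c p) (tensor (fst p) (snd p))) = 0"
    and x: "x \<in> X" and y: "y \<in> Y"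
  shows "c (x, y) = 0"
proof -
  have *: "(\<Sum>x\<in>X. \<Sum>y\<in>Y. c (x, y) * (x i * y j)) = 0" for i j
  proof -
    have "0 = (\<Sum>p\<in>X \<times> Y. fscale (c p) (tensor (fst p) (snd p))) (i, j)" by (simp add: sum0)
    also have "\<dots> = (\<Sum>p\<in>X \<times> Y. c p * (fst p i * snd p j))"
      by (simp add: sum_fun_apply fscale_def tensor_def)
    also have "\<dots> = (\<Sum>x\<in>X. \<Sum>y\<in>Y. c (x, y) * (x i * y j))"
      by (simp add: sum.cartesian_product case_prod_unfold)
    finally show ?thesis by simp
  qed
  have y0: "(\<Sum>y\<in>Y. c (x, y) * y j) = 0" for j
  proof (rule fs.independentD[OF assms(2,1) subset_refl _ x])
    show "(\<Sum>x\<in>X. fscale (\<Sum>y\<in>Y. c (x, y) * y j) x) = 0"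
    proof
      fix i
      have "(\<Sum>x\<in>X. fscale (\<Sum>y\<in>Y. c (x, y) * y j) x) i
          = (\<Sum>x\<in>X. \<Sum>y\<in>Y. c (x, y) * (x i * y j))"
        unfolding sum_fun_apply fscale_def sum_distrib_right by (simp add: mult_ac)
      then show "(\<Sum>x\<in>X. fscale (\<Sum>y\<in>Y. c (x, y) * y j) x) i = 0 i" using * by simp
    qed
  qed
  show ?thesis
  proof (rule fs.independentD[OF assms(4,3) subset_refl _ y])
    show "(\<Sum>y\<in>Y. fscale (c (x, y)) y) = 0"
      using y0 by (simp add: fun_eq_iff sum_fun_apply fscale_def)
  qed
qed

lemma tensor_in: "x \<in> V1 \<Longrightarrow> y \<in> V2 \<Longrightarrow> tensor x y \<in> tensor_space V1 V2"
  unfolding tensor_space_def by (rule fs.span_base) blast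

abbreviation tensor_list :: "('i \<Rightarrow> 'a::field) list \<Rightarrow> ('j \<Rightarrow> 'a) list \<Rightarrow> ('i \<times> 'j \<Rightarrow> 'a) list" where
  "tensor_list xs ys \<equiv> map (\<lambda>p. tensor (fst p) (snd p)) (List.product xs ys)"

text \<open>\<open>List.product\<close> runs lexicographically, so for planes the order is x0 y0, x0
  y1, x1 y0, x1 y1. The index patterns of \<open>det_gram_tensor\<close> and
  \<open>decomposableI\<close> rely on it.\<close>

lemma tensor_basis:
  fixes V1 :: "('i \<Rightarrow> 'a::field) set" and V2 :: "('j \<Rightarrow> 'a) set"
  assumes xs: "ordered_basis fscale V1 xs" and ys: "ordered_basis fscale V2 ys"
  shows "ordered_basis fscale (tensor_space V1 V2) (tensor_list xs ys)"
proof -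
  let ?P = "List.product xs ys" and ?L = "tensor_list xs ys"
  have xs': "distinct xs" "fs.independent (set xs)" "fs.span (set xs) = V1"
    and ys': "distinct ys" "fs.independent (set ys)" "fs.span (set ys) = V2"
    using xs ys by (auto simp: ordered_basis_def)
  have d: "distinct ?P" using xs' ys' by (simp add: distinct_product)
  define g where "g = the_inv_into {..<length ?P} ((!) ?P)"
  have inj: "inj_on ((!) ?P) {..<length ?P}"
    using bij_betw_nth[OF d] by (auto simp: bij_betw_def)
  have g: "g (?P ! j) = j" if "j < length ?P" for j
    using that the_inv_into_f_f[OF inj] by (auto simp: g_def)
  have "distinct ?L \<and> fs.independent (set ?L)"
  proof (rule fs.indep_listI)
    fix c i assume *: "(\<Sum>j<length ?L. fscale (c j) (?L ! j)) = 0" "i < length ?L"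
    have "(\<Sum>p\<in>set ?P. fscale (c (g p)) (tensor (fst p) (snd p)))
        = (\<Sum>j<length ?P. fscale (c (g (?P ! j))) (tensor (fst (?P ! j)) (snd (?P ! j))))"
      by (rule sum.reindex_bij_betw[OF bij_betw_nth[OF d], symmetric]) auto
    also have "\<dots> = (\<Sum>j<length ?L. fscale (c j) (?L ! j))"
      using g by (intro sum.cong) (auto simp del: length_product)
    finally have **: "(\<Sum>p\<in>set xs \<times> set ys. fscale (c (g p)) (tensor (fst p) (snd p))) = 0"
      using *(1) by simp
    have "?P ! i \<in> set xs \<times> set ys" using *(2) nth_mem[of i ?P] by simp
    then obtain x y where "x \<in> set xs" "y \<in> set ys" "?P ! i = (x, y)" by blast
    with tensor_independent[OF _ xs'(2) _ ys'(2) **] have "c (g (?P ! i)) = 0" by simp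
    then show "c i = 0" using g *(2) by simp
  qed
  moreover have "fs.span (set ?L) = tensor_space V1 V2"
  proof
    have "set xs \<subseteq> V1" "set ys \<subseteq> V2"
      using fs.ordered_basis_subset[OF xs] fs.ordered_basis_subset[OF ys] .
    then have "set ?L \<subseteq> {tensor x y |x y. x \<in> V1 \<and> y \<in> V2}" by fastforce
    then show "fs.span (set ?L) \<subseteq> tensor_space V1 V2"
      unfolding tensor_space_def by (rule fs.span_mono)
    \<comment> \<open>The span is exhausted in three rounds: basis vectors on both sides, then an
      arbitrary left factor, then an arbitrary right factor.\<close>
    have 1: "tensor x y \<in> fs.span (set ?L)" if "x \<in> set xs" "y \<in> set ys" for x y
      using that by (intro fs.span_base) force
    have 2: "tensor x y \<in> fs.span (set ?L)" if "x \<in> V1" "y \<in> set ys" for x y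
    proof -
      have "fs.span (set xs) \<subseteq> {x. tensor x y \<in> fs.span (set ?L)}"
        by (intro fs.span_minimal fs.subspaceI)
          (use 1 that in \<open>auto simp: tensor_add_left tensor_scale_left fs.span_zero
            intro: fs.span_add fs.span_scale simp del: set_map set_product\<close>)
      then show ?thesis using that xs' by auto
    qed
    have 3: "tensor x y \<in> fs.span (set ?L)" if "x \<in> V1" "y \<in> V2" for x y
    proof -
      have "fs.span (set ys) \<subseteq> {y. tensor x y \<in> fs.span (set ?L)}"
        by (intro fs.span_minimal fs.subspaceI)
          (use 2 that in \<open>auto simp: tensor_add_right tensor_scale_right fs.span_zero
            intro: fs.span_add fs.span_scale simp del: set_map set_product\<close>)
      then show ?thesis using that ys' by auto
    qed
    show "tensor_space V1 V2 \<subseteq> fs.span (set ?L)"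
      unfolding tensor_space_def using 3 by (intro fs.span_minimal) auto
  qed
  ultimately show ?thesis by (simp add: ordered_basis_def)
qed

lemma (in vector_space) linear_eq_on_span:
  assumes "x \<in> span X"
    and "\<And>x. x \<in> X \<Longrightarrow> F x = G x"
    and "\<And>x y. x \<in> span X \<Longrightarrow> y \<in> span X \<Longrightarrow> F (x + y) = F x + F y"
    and "\<And>x y. x \<in> span X \<Longrightarrow> y \<in> span X \<Longrightarrow> G (x + y) = G x + G y"
    and "\<And>c x. x \<in> span X \<Longrightarrow> F (scale c x) = c * F x"
    and "\<And>c x. x \<in> span X \<Longrightarrow> G (scale c x) = c * G x"
  shows "F x = (G x :: 'a)"
proof -
  have "x \<in> span X \<and> F x = G x" using assms(1)
  proof (induction rule: span_induct_alt)
    case base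
    show ?case using assms(5)[of 0 0] assms(6)[of 0 0] by (simp add: span_zero)
  next
    case (step c x y)
    then show ?case using assms(2-) span_base[of x X] by (simp add: span_add span_scale)
  qed
  then show ?thesis by simp
qed

text \<open>\<open>tensor_form\<close> is a chosen form, so both facts rest on exhibiting some
  bilinear form with the product formula. Coordinates in the basis of pure tensors define
  one.\<close>

lemma tensor_form:
  assumes b1: "bilinear_space fscale V1 b1" and b2: "bilinear_space fscale V2 b2"
  shows "bilinear_space fscale (tensor_space V1 V2) (tensor_form V1 b1 V2 b2)"
    and "x1 \<in> V1 \<Longrightarrow> y1 \<in> V1 \<Longrightarrow> x2 \<in> V2 \<Longrightarrow> y2 \<in> V2 \<Longrightarrow>
      tensor_form V1 b1 V2 b2 (tensor x1 x2) (tensor y1 y2) = b1 x1 y1 * b2 x2 y2"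
proof -
  interpret b1: bilinear_space fscale V1 b1 by fact
  interpret b2: bilinear_space fscale V2 b2 by fact
  obtain xs where xs: "ordered_basis fscale V1 xs" by (rule b1.obtain_ordered_basis)
  obtain ys where ys: "ordered_basis fscale V2 ys" by (rule b2.obtain_ordered_basis)
  let ?T = "tensor_space V1 V2" and ?L = "tensor_list xs ys" and ?P = "set xs \<times> set ys"
  let ?t = "\<lambda>p. tensor (fst p) (snd p)"
  have L: "ordered_basis fscale ?T ?L" using tensor_basis[OF xs ys] .
  have ind: "fs.independent (set ?L)" and sp: "fs.span (set ?L) = ?T"
    using L by (auto simp: ordered_basis_def)
  have X: "fs.span (set xs) = V1" and Y: "fs.span (set ys) = V2"
    using xs ys by (auto simp: ordered_basis_def)
  have inj: "inj_on ?t ?P"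
    using L by (auto simp: ordered_basis_def distinct_map)
  let ?r = "\<lambda>t p. fs.representation (set ?L) t (?t p)"
  define \<beta> where "\<beta> t u = (\<Sum>p\<in>?P. \<Sum>q\<in>?P. ?r t p * ?r u q * (b1 (fst p) (fst q) * b2 (snd p) (snd q)))" for t u
  have add: "?r (t + u) p = ?r t p + ?r u p" if "t \<in> ?T" "u \<in> ?T" for t u p
    using that sp fs.representation_add[OF ind] by simp
  have scale: "?r (fscale c t) p = c * ?r t p" if "t \<in> ?T" for t c p
    using that sp fs.representation_scale[OF ind] by simp
  have bas: "?r (?t p) q = (if q = p then 1 else 0)" if "p \<in> ?P" "q \<in> ?P" for p q
  proof -
    have "?t p \<in> set ?L" using that by auto
    moreover have "?t p = ?t q \<longleftrightarrow> p = q" using inj that by (auto dest: inj_onD)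
    ultimately show ?thesis using fs.representation_basis[OF ind, of "?t p"] by auto
  qed
  have bil: "bilinear_space fscale ?T \<beta>"
  proof unfold_locales
    show "fs.subspace ?T" unfolding tensor_space_def by simp
    show "\<exists>B. finite B \<and> fs.span B = ?T" using sp by blast
  next
    fix x y z assume "x \<in> ?T" "y \<in> ?T" "z \<in> ?T"
    then show "\<beta> (x + y) z = \<beta> x z + \<beta> y z" "\<beta> x (y + z) = \<beta> x y + \<beta> x z"
      by (simp_all add: \<beta>_def add distrib_right distrib_left sum.distrib del: set_map set_product)
  next
    fix x y c assume "x \<in> ?T" "y \<in> ?T"
    then show "\<beta> (fscale c x) y = c * \<beta> x y" "\<beta> x (fscale c y) = c * \<beta> x y"
      by (simp_all add: \<beta>_def scale sum_distrib_left mult_ac del: set_map set_product)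
  qed
  interpret \<beta>: bilinear_space fscale ?T \<beta> by (rule bil)
  have sub: "set xs \<subseteq> V1" "set ys \<subseteq> V2"
    using fs.ordered_basis_subset[OF xs] fs.ordered_basis_subset[OF ys] .
  have 0: "\<beta> (tensor x1 x2) (tensor y1 y2) = b1 x1 y1 * b2 x2 y2"
    if "x1 \<in> set xs" "x2 \<in> set ys" "y1 \<in> set xs" "y2 \<in> set ys" for x1 x2 y1 y2
  proof -
    have "\<beta> (?t (x1, x2)) (?t (y1, y2)) = (\<Sum>p\<in>?P. \<Sum>q\<in>?P. (if p = (x1, x2) then 1 else 0)
        * (if q = (y1, y2) then 1 else 0) * (b1 (fst p) (fst q) * b2 (snd p) (snd q)))"
      unfolding \<beta>_def by (intro sum.cong refl) (subst (1 2) bas, use that in auto)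
    also have "\<dots> = (\<Sum>p\<in>?P. if p = (x1, x2) then (\<Sum>q\<in>?P. if q = (y1, y2) then
        b1 (fst p) (fst q) * b2 (snd p) (snd q) else 0) else 0)"
      by (intro sum.cong refl) (simp add: if_distrib[of "\<lambda>z. z * _"] cong: if_cong)
    also have "\<dots> = b1 x1 y1 * b2 x2 y2" using that by (simp add: sum.delta)
    finally show ?thesis by simp
  qed
  note lin = tensor_in tensor_add_left tensor_add_right tensor_scale_left tensor_scale_right
    \<beta>.bilin b1.bilin b2.bilin algebra_simps
  \<comment> \<open>The formula is freed from basis vectors in one argument at a time, each time by
    linearity.\<close>
  have 1: "\<beta> (tensor x1 x2) (tensor y1 y2) = b1 x1 y1 * b2 x2 y2"
    if "x1 \<in> V1" "x2 \<in> set ys" "y1 \<in> set xs" "y2 \<in> set ys" for x1 x2 y1 y2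
    by (rule fs.linear_eq_on_span[of x1 "set xs" "\<lambda>x1. \<beta> (tensor x1 x2) (tensor y1 y2)"
          "\<lambda>x1. b1 x1 y1 * b2 x2 y2"]) (use that sub 0 in \<open>auto simp: X lin subset_iff\<close>)
  have 2: "\<beta> (tensor x1 x2) (tensor y1 y2) = b1 x1 y1 * b2 x2 y2"
    if "x1 \<in> V1" "x2 \<in> V2" "y1 \<in> set xs" "y2 \<in> set ys" for x1 x2 y1 y2
    by (rule fs.linear_eq_on_span[of x2 "set ys" "\<lambda>x2. \<beta> (tensor x1 x2) (tensor y1 y2)"
          "\<lambda>x2. b1 x1 y1 * b2 x2 y2"]) (use that sub 1 in \<open>auto simp: Y lin subset_iff\<close>)
  have 3: "\<beta> (tensor x1 x2) (tensor y1 y2) = b1 x1 y1 * b2 x2 y2"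
    if "x1 \<in> V1" "x2 \<in> V2" "y1 \<in> V1" "y2 \<in> set ys" for x1 x2 y1 y2
    by (rule fs.linear_eq_on_span[of y1 "set xs" "\<lambda>y1. \<beta> (tensor x1 x2) (tensor y1 y2)"
          "\<lambda>y1. b1 x1 y1 * b2 x2 y2"]) (use that sub 2 in \<open>auto simp: X lin subset_iff\<close>)
  have 4: "\<beta> (tensor x1 x2) (tensor y1 y2) = b1 x1 y1 * b2 x2 y2"
    if "x1 \<in> V1" "x2 \<in> V2" "y1 \<in> V1" "y2 \<in> V2" for x1 x2 y1 y2
    by (rule fs.linear_eq_on_span[of y2 "set ys" "\<lambda>y2. \<beta> (tensor x1 x2) (tensor y1 y2)"
          "\<lambda>y2. b1 x1 y1 * b2 x2 y2"]) (use that sub 3 in \<open>auto simp: Y lin subset_iff\<close>)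
  have "\<exists>b. bilinear_space fscale ?T b \<and> (\<forall>x1\<in>V1. \<forall>y1\<in>V1. \<forall>x2\<in>V2. \<forall>y2\<in>V2.
          b (tensor x1 x2) (tensor y1 y2) = b1 x1 y1 * b2 x2 y2)"
    using bil 4 by (intro exI[of _ \<beta>]) blast
  from someI_ex[OF this]
  show "bilinear_space fscale ?T (tensor_form V1 b1 V2 b2)"
    and "x1 \<in> V1 \<Longrightarrow> y1 \<in> V1 \<Longrightarrow> x2 \<in> V2 \<Longrightarrow> y2 \<in> V2 \<Longrightarrow>
      tensor_form V1 b1 V2 b2 (tensor x1 x2) (tensor y1 y2) = b1 x1 y1 * b2 x2 y2"
    unfolding tensor_form_def by blast+
qed

section \<open>Determinants of Gram matrices of size two and four\<close>

text \<open>Each minor is again presented as a \<open>mat\<close> of a function, so rewriting alone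
  unfolds a determinant of concrete size.\<close>

lemma det_mat_Suc:
  fixes f :: "nat \<times> nat \<Rightarrow> 'a::comm_ring_1"
  shows "det (mat (Suc n) (Suc n) f) = (\<Sum>j<Suc n. f (0, j) * ((-1) ^ j *
    det (mat n n (\<lambda>(i, k). f (Suc i, if k < j then k else Suc k)))))"
proof -
  have "det (mat (Suc n) (Suc n) f) =
    (\<Sum>j<Suc n. mat (Suc n) (Suc n) f $$ (0, j) * cofactor (mat (Suc n) (Suc n) f) 0 j)"
    by (rule laplace_expansion_row[of _ "Suc n"]) auto
  also have "\<dots> = (\<Sum>j<Suc n. f (0, j) * ((-1) ^ j *
    det (mat n n (\<lambda>(i, k). f (Suc i, if k < j then k else Suc k)))))"
  proof (intro sum.cong refl)
    fix j assume "j \<in> {..<Suc n}"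
    moreover have "mat_delete (mat (Suc n) (Suc n) f) 0 j
        = mat n n (\<lambda>(i, k). f (Suc i, if k < j then k else Suc k))"
      by (rule eq_matI) (auto simp: mat_delete_def)
    ultimately show "mat (Suc n) (Suc n) f $$ (0, j) * cofactor (mat (Suc n) (Suc n) f) 0 j
      = f (0, j) * ((-1) ^ j * det (mat n n (\<lambda>(i, k). f (Suc i, if k < j then k else Suc k))))"
      by (simp add: cofactor_def)
  qed
  finally show ?thesis .
qed

lemma det_gram_2:
  fixes b :: "'v \<Rightarrow> 'v \<Rightarrow> 'a::comm_ring_1"
  shows "det (gram_matrix b [x, y]) = b x x * b y y - b x y * b y x"
  by (simp add: gram_matrix_def numeral_2_eq_2 det_mat_Suc del: upt_Suc)

lemma det_gram_4:
  fixes b :: "'v \<Rightarrow> 'v \<Rightarrow> 'a::comm_ring_1"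
  shows "det (gram_matrix b [w0, w1, w2, w3]) =
    b w0 w0 * (b w1 w1 * (b w2 w2 * b w3 w3 - b w2 w3 * b w3 w2)
      - b w1 w2 * (b w2 w1 * b w3 w3 - b w2 w3 * b w3 w1)
      + b w1 w3 * (b w2 w1 * b w3 w2 - b w2 w2 * b w3 w1))
    - b w0 w1 * (b w1 w0 * (b w2 w2 * b w3 w3 - b w2 w3 * b w3 w2)
      - b w1 w2 * (b w2 w0 * b w3 w3 - b w2 w3 * b w3 w0)
      + b w1 w3 * (b w2 w0 * b w3 w2 - b w2 w2 * b w3 w0))
    + b w0 w2 * (b w1 w0 * (b w2 w1 * b w3 w3 - b w2 w3 * b w3 w1)
      - b w1 w1 * (b w2 w0 * b w3 w3 - b w2 w3 * b w3 w0)
      + b w1 w3 * (b w2 w0 * b w3 w1 - b w2 w1 * b w3 w0))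
    - b w0 w3 * (b w1 w0 * (b w2 w1 * b w3 w2 - b w2 w2 * b w3 w1)
      - b w1 w1 * (b w2 w0 * b w3 w2 - b w2 w2 * b w3 w0)
      + b w1 w2 * (b w2 w0 * b w3 w1 - b w2 w1 * b w3 w0))"
proof -
  have l: "length [w0, w1, w2, w3] = Suc (Suc (Suc (Suc 0)))" by simp
  show ?thesis
    unfolding gram_matrix_def l det_mat_Suc
    by (simp add: algebra_simps)
qed

text \<open>The hypotheses say that the Gram matrix is the Kronecker product P \<otimes> Q of two
  matrices of size two, and such a product has determinant (det P det Q)^2.\<close>

lemma det_gram_tensor:
  fixes b :: "'v \<Rightarrow> 'v \<Rightarrow> 'a::field"
  assumes "b w0 w0 = p00 * q00" "b w0 w1 = p00 * q01" "b w0 w2 = p01 * q00" "b w0 w3 = p01 * q01"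
    "b w1 w0 = p00 * q10" "b w1 w1 = p00 * q11" "b w1 w2 = p01 * q10" "b w1 w3 = p01 * q11"
    "b w2 w0 = p10 * q00" "b w2 w1 = p10 * q01" "b w2 w2 = p11 * q00" "b w2 w3 = p11 * q01"
    "b w3 w0 = p10 * q10" "b w3 w1 = p10 * q11" "b w3 w2 = p11 * q10" "b w3 w3 = p11 * q11"
  shows "det (gram_matrix b [w0, w1, w2, w3])
    = ((p00 * p11 - p01 * p10) * (q00 * q11 - q01 * q10))\<^sup>2"
  unfolding det_gram_4 assms by (simp add: power2_eq_square algebra_simps)

section \<open>Transport of bases and forms along isomorphisms\<close>

lemma linear_iso_inv:
  assumes "vector_space s" "module.subspace s V" and f: "linear_iso s V s' W f"
  shows "linear_iso s' W s V (inv_into V f)"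
proof -
  interpret vector_space s by fact
  have bij: "bij_betw f V W" and add: "\<And>x y. x \<in> V \<Longrightarrow> y \<in> V \<Longrightarrow> f (x + y) = f x + f y"
    and sc: "\<And>c x. x \<in> V \<Longrightarrow> f (s c x) = s' c (f x)"
    using f by (auto simp: linear_iso_def linear_map_def)
  have inv: "inv_into V f (f x) = x" if "x \<in> V" for x
    using bij that by (simp add: bij_betw_inv_into_left)
  have W: "W = f ` V" using bij by (simp add: bij_betw_def)
  have "linear_map s' W s V (inv_into V f)"
    unfolding linear_map_def W using assms(2)
    by (auto simp: inv subspace_add subspace_scale simp flip: add sc)
  then show ?thesis using bij by (simp add: linear_iso_def bij_betw_inv_into)
qed

lemma linear_iso_comp:
  assumes "linear_iso s V s' W f" "linear_iso s' W s'' U g"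
  shows "linear_iso s V s'' U (g \<circ> f)"
  using assms bij_betw_trans[of f V W g U] unfolding linear_iso_def linear_map_def
  by (simp add: Pi_iff)

lemma linear_iso_dim:
  assumes V: "bilinear_space s V b" and W: "vector_space s'" "module.subspace s' W"
    and f: "linear_iso s V s' W f"
  shows "vector_space.dim s' W = vector_space.dim s V"
proof -
  interpret bilinear_space s V b by fact
  obtain vs where vs: "ordered_basis s V vs" by (rule obtain_ordered_basis)
  have "length (map f vs) = vector_space.dim s' W"
    using vector_space.ordered_basis_length[OF W(1) linear_iso_bases[OF vector_space_axioms vs W f]] .
  then show ?thesis using ordered_basis_length[OF vs] by (simp only: length_map)
qed

lemma isometry_on_basis:
  assumes V: "bilinear_space s V b" and W: "bilinear_space s' W b'"
    and vs: "ordered_basis s V vs" and f: "linear_map s V s' W f"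
    and eq: "\<And>x y. x \<in> set vs \<Longrightarrow> y \<in> set vs \<Longrightarrow> b' (f x) (f y) = b x y"
    and "x \<in> V" "y \<in> V"
  shows "b' (f x) (f y) = b x y"
proof -
  interpret v: bilinear_space s V b by fact
  interpret w: bilinear_space s' W b' by fact
  have sp: "v.span (set vs) = V" using vs by (simp add: ordered_basis_def)
  have sub: "set vs \<subseteq> V" using v.ordered_basis_subset[OF vs] .
  have fl: "f x \<in> W" "f (x + y) = f x + f y" "f (s c x) = s' c (f x)"
    if "x \<in> V" "y \<in> V" for x y c
    using f that by (auto simp: linear_map_def)
  have 1: "b' (f x) (f y) = b x y" if "x \<in> V" "y \<in> set vs" for x y
    by (rule v.linear_eq_on_span[of x "set vs" "\<lambda>x. b' (f x) (f y)" "\<lambda>x. b x y"])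
      (use that sub eq fl in \<open>auto simp: sp v.bilin w.bilin subset_iff\<close>)
  show ?thesis
    by (rule v.linear_eq_on_span[of y "set vs" "\<lambda>y. b' (f x) (f y)" "\<lambda>y. b x y"])
      (use \<open>x \<in> V\<close> \<open>y \<in> V\<close> sub 1 fl in \<open>auto simp: sp v.bilin w.bilin subset_iff\<close>)
qed

section \<open>Forms on the coordinate plane and a criterion for decomposability\<close>

definition unit_fun :: "nat \<Rightarrow> nat \<Rightarrow> 'a::zero_neq_one" where
  "unit_fun i = (\<lambda>k. if k = i then 1 else 0)"

lemma coord_space_2_basis:
  "ordered_basis fscale (coord_space 2 :: (nat \<Rightarrow> 'a::field) set) [unit_fun 0, unit_fun 1]"
proof -
  have "distinct [unit_fun 0, unit_fun 1 :: nat \<Rightarrow> 'a] \<and> fs.independent (set [unit_fun 0, unit_fun 1 :: nat \<Rightarrow> 'a])"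
  proof (rule fs.indep_listI)
    fix c :: "nat \<Rightarrow> 'a" and i :: nat
    assume *: "(\<Sum>j<length [unit_fun 0, unit_fun 1 :: nat \<Rightarrow> 'a]. fscale (c j) ([unit_fun 0, unit_fun 1] ! j)) = 0"
      "i < length [unit_fun 0, unit_fun 1 :: nat \<Rightarrow> 'a]"
    then have "fscale (c 0) (unit_fun 0) + fscale (c 1) (unit_fun 1) = (0 :: nat \<Rightarrow> 'a)"
      by (simp add: lessThan_Suc add.commute)
    then have "(fscale (c 0) (unit_fun 0) + fscale (c 1) (unit_fun 1)) k = (0 :: nat \<Rightarrow> 'a) k" for k
      by simp
    from this[of 0] this[of 1] have "c 0 = 0" "c 1 = 0"
      by (simp_all add: fscale_def unit_fun_def)
    then show "c i = 0" using *(2) by (auto simp: less_Suc_eq numeral_2_eq_2)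
  qed
  moreover have "fs.span {unit_fun 0, unit_fun 1} = (coord_space 2 :: (nat \<Rightarrow> 'a) set)"
  proof
    show "fs.span {unit_fun 0, unit_fun 1} \<subseteq> (coord_space 2 :: (nat \<Rightarrow> 'a) set)"
      by (rule fs.span_minimal)
        (auto simp: coord_space_def unit_fun_def fscale_def intro!: fs.subspaceI)
    show "coord_space 2 \<subseteq> fs.span {unit_fun 0, unit_fun 1 :: nat \<Rightarrow> 'a}"
    proof
      fix x :: "nat \<Rightarrow> 'a" assume x: "x \<in> coord_space 2"
      have "x k = (fscale (x 0) (unit_fun 0) + fscale (x 1) (unit_fun 1)) k" for k
      proof -
        consider "k = 0" | "k = 1" | "k \<ge> 2" by linarith
        then show ?thesis using x by cases (auto simp: fscale_def unit_fun_def coord_space_def)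
      qed
      then have "x = fscale (x 0) (unit_fun 0) + fscale (x 1) (unit_fun 1)" by (rule ext)
      then show "x \<in> fs.span {unit_fun 0, unit_fun 1}"
        using fs.span_add[OF fs.span_scale fs.span_scale, of "unit_fun 0" "{unit_fun 0, unit_fun 1}" "unit_fun 1"]
        by (metis fs.span_base insertI1 insertI2)
    qed
  qed
  ultimately show ?thesis by (simp add: ordered_basis_def)
qed

lemma sum_lessThan_2: "(\<Sum>j<2::nat. f j) = f 0 + (f 1 :: 'c::comm_monoid_add)"
  by (simp add: eval_nat_numeral)

lemma matrix_form_2:
  assumes "M \<in> carrier_mat 2 2"
  shows "bilinear_space fscale (coord_space 2) (matrix_form (M :: 'a::field mat))"
    and "i < 2 \<Longrightarrow> j < 2 \<Longrightarrow> matrix_form M (unit_fun i) (unit_fun j) = M $$ (i, j)"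
proof -
  have sp: "fs.span {unit_fun 0, unit_fun 1} = (coord_space 2 :: (nat \<Rightarrow> 'a) set)"
    using coord_space_2_basis[where 'a='a] by (simp add: ordered_basis_def del: One_nat_def)
  show "bilinear_space fscale (coord_space 2) (matrix_form M)"
  proof unfold_locales
    show "fs.subspace (coord_space 2 :: (nat \<Rightarrow> 'a) set)" unfolding sp[symmetric] by (rule fs.subspace_span)
    show "\<exists>B. finite B \<and> fs.span B = (coord_space 2 :: (nat \<Rightarrow> 'a) set)"
      by (intro exI[of _ "{unit_fun 0, unit_fun 1}"] conjI sp) simp
  qed (use assms in \<open>auto simp: matrix_form_def sum_lessThan_2 fscale_def algebra_simps\<close>)
  assume "i < 2" "j < 2"
  then show "matrix_form M (unit_fun i) (unit_fun j) = M $$ (i, j)"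
    using assms by (auto simp: matrix_form_def sum_lessThan_2 unit_fun_def less_2_cases_iff)
qed

text \<open>The certificate behind every decomposition below is a Gram matrix P \<otimes> Q with P
  and Q invertible. Invertibility makes the four vectors a basis, and the isometry sends them to the
  pure tensors of unit vectors in the planes carrying P and Q.\<close>

lemma (in bilinear_space) decomposableI:
  assumes dim: "dim V = 4" and w: "w0 \<in> V" "w1 \<in> V" "w2 \<in> V" "w3 \<in> V"
    and p: "p00 * p11 - p01 * p10 \<noteq> 0" and q: "q00 * q11 - q01 * q10 \<noteq> 0"
    and gram: "b w0 w0 = p00 * q00" "b w0 w1 = p00 * q01" "b w0 w2 = p01 * q00" "b w0 w3 = p01 * q01"
    "b w1 w0 = p00 * q10" "b w1 w1 = p00 * q11" "b w1 w2 = p01 * q10" "b w1 w3 = p01 * q11"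
    "b w2 w0 = p10 * q00" "b w2 w1 = p10 * q01" "b w2 w2 = p11 * q00" "b w2 w3 = p11 * q01"
    "b w3 w0 = p10 * q10" "b w3 w1 = p10 * q11" "b w3 w2 = p11 * q10" "b w3 w3 = p11 * q11"
  shows "decomposable s V b"
proof -
  let ?ws = "[w0, w1, w2, w3]"
  have ws: "ordered_basis s V ?ws"
    by (rule gram_basis) (use w dim p q det_gram_tensor[of b, OF gram] in auto)
  define P where "P = mat_of_rows_list 2 [[p00, p01], [p10, p11]]"
  define Q where "Q = mat_of_rows_list 2 [[q00, q01], [q10, q11]]"
  have P: "P \<in> carrier_mat 2 2" and Q: "Q \<in> carrier_mat 2 2"
    by (auto simp: P_def Q_def mat_of_rows_list_def)
  have PQ: "P $$ (0, 0) = p00" "P $$ (0, 1) = p01" "P $$ (1, 0) = p10" "P $$ (1, 1) = p11"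
    "Q $$ (0, 0) = q00" "Q $$ (0, 1) = q01" "Q $$ (1, 0) = q10" "Q $$ (1, 1) = q11"
    by (auto simp: P_def Q_def mat_of_rows_list_def)
  let ?C = "coord_space 2 :: (nat \<Rightarrow> 'a) set"
  let ?u = "unit_fun :: nat \<Rightarrow> nat \<Rightarrow> 'a"
  note bP = matrix_form_2[OF P] and bQ = matrix_form_2[OF Q]
  note C = coord_space_2_basis[where 'a='a]
  have uC: "?u 0 \<in> ?C" "?u 1 \<in> ?C" using fs.ordered_basis_subset[OF C] by auto
  have d2: "fs.dim ?C = 2" using fs.ordered_basis_length[OF C] by simp
  note T = tensor_form[OF bP(1) bQ(1)]
  have TL: "tensor_list [?u 0, ?u 1] [?u 0, ?u 1]
      = [tensor (?u 0) (?u 0), tensor (?u 0) (?u 1), tensor (?u 1) (?u 0), tensor (?u 1) (?u 1)]"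
    by simp
  have Tb: "ordered_basis fscale (tensor_space ?C ?C) (tensor_list [?u 0, ?u 1] [?u 0, ?u 1])"
    by (rule tensor_basis[OF C C])
  obtain f where f: "linear_iso s V fscale (tensor_space ?C ?C) f"
    and fi: "\<And>i. i < length ?ws \<Longrightarrow> f (?ws ! i) = tensor_list [?u 0, ?u 1] [?u 0, ?u 1] ! i"
    using iso_of_ordered_bases[OF vector_space_axioms ws vector_space_fscale Tb] by auto
  have f4: "f w0 = tensor (?u 0) (?u 0)" "f w1 = tensor (?u 0) (?u 1)"
    "f w2 = tensor (?u 1) (?u 0)" "f w3 = tensor (?u 1) (?u 1)"
    using fi[of 0] fi[of 1] fi[of 2] fi[of 3] unfolding TL by simp_all
  have "tensor_form ?C (matrix_form P) ?C (matrix_form Q) (f x) (f y) = b x y"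
    if "x \<in> V" "y \<in> V" for x y
  proof (rule isometry_on_basis[OF bilinear_space_axioms T(1) ws _ _ that])
    show "linear_map s V fscale (tensor_space ?C ?C) f" using f by (simp add: linear_iso_def)
    fix x y assume "x \<in> set ?ws" "y \<in> set ?ws"
    then show "tensor_form ?C (matrix_form P) ?C (matrix_form Q) (f x) (f y) = b x y"
      using uC by (auto simp: f4 T(2) bP(2) bQ(2) PQ gram simp del: One_nat_def)
  qed
  then show ?thesis
    unfolding decomposable_def isometric_def
    using bP(1) bQ(1) d2 f
    by (intro exI[of _ ?C] exI[of _ "matrix_form P"] exI[of _ "matrix_form Q"] conjI exI[of _ f]) auto
qed

section \<open>Decomposable spaces and asymmetries\<close>

lemma length_2E:
  assumes "length xs = 2"
  obtains x y where "xs = [x, y]"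
  using assms by (auto simp: numeral_2_eq_2 length_Suc_conv)

context bilinear_space
begin

text \<open>The dimensions of the factors are at least 2 and multiply to 4. The isometry is inverted
  so that it starts at the tensor space, whose vectors can be named.\<close>

lemma decomposableE:
  assumes "dim V = 4" "decomposable s V b"
  obtains V1 V2 :: "(nat \<Rightarrow> 'a) set" and b1 b2 g
  where "bilinear_space fscale V1 b1" "bilinear_space fscale V2 b2"
    "fs.dim V1 = 2" "fs.dim V2 = 2" "linear_iso fscale (tensor_space V1 V2) s V g"
    "\<And>t u. t \<in> tensor_space V1 V2 \<Longrightarrow> u \<in> tensor_space V1 V2 \<Longrightarrow>
      b (g t) (g u) = tensor_form V1 b1 V2 b2 t u"
proof -
  obtain V1 V2 :: "(nat \<Rightarrow> 'a) set" and b1 b2 f where b1: "bilinear_space fscale V1 b1"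
    and b2: "bilinear_space fscale V2 b2" and dims: "fs.dim V1 \<ge> 2" "fs.dim V2 \<ge> 2"
    and f: "linear_iso s V fscale (tensor_space V1 V2) f"
    and iso: "\<And>x y. x \<in> V \<Longrightarrow> y \<in> V \<Longrightarrow> tensor_form V1 b1 V2 b2 (f x) (f y) = b x y"
    using assms(2) unfolding decomposable_def isometric_def by blast
  let ?T = "tensor_space V1 V2"
  interpret b1: bilinear_space fscale V1 b1 by fact
  interpret b2: bilinear_space fscale V2 b2 by fact
  interpret t: bilinear_space fscale ?T "tensor_form V1 b1 V2 b2" by (rule tensor_form(1)[OF b1 b2])
  obtain xs where xs: "ordered_basis fscale V1 xs" by (rule b1.obtain_ordered_basis)
  obtain ys where ys: "ordered_basis fscale V2 ys" by (rule b2.obtain_ordered_basis)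
  have "fs.dim ?T = 4"
    using linear_iso_dim[OF bilinear_space_axioms vector_space_fscale t.subspace_V f] assms(1) by simp
  then have "length (tensor_list xs ys) = 4"
    using fs.ordered_basis_length[OF tensor_basis[OF xs ys]] by simp
  then have prod: "fs.dim V1 * fs.dim V2 = 4"
    using fs.ordered_basis_length[OF xs] fs.ordered_basis_length[OF ys] by simp
  have "\<not> fs.dim V1 \<ge> 3" using prod dims mult_le_mono[of 3 "fs.dim V1" 2 "fs.dim V2"] by auto
  moreover have "\<not> fs.dim V2 \<ge> 3" using prod dims mult_le_mono[of 2 "fs.dim V1" 3 "fs.dim V2"] by auto
  ultimately have "fs.dim V1 = 2" "fs.dim V2 = 2" using dims by auto
  moreover have "linear_iso fscale ?T s V (inv_into V f)"
    by (rule linear_iso_inv[OF vector_space_axioms subspace_V f])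
  moreover have "b (inv_into V f t) (inv_into V f u) = tensor_form V1 b1 V2 b2 t u"
    if "t \<in> ?T" "u \<in> ?T" for t u
  proof -
    have im: "f ` V = ?T" using f by (simp add: linear_iso_def bij_betw_def)
    have "inv_into V f t \<in> V" "inv_into V f u \<in> V" "f (inv_into V f t) = t" "f (inv_into V f u) = u"
      using that unfolding im[symmetric] by (auto intro: inv_into_into f_inv_into_f)
    then show ?thesis using iso by metis
  qed
  ultimately show ?thesis using that b1 b2 by blast
qed

lemma decomposable_det_class:
  assumes nd: "nondegenerate V b" and dim: "dim V = 4" and "decomposable s V b"
  shows "det_class s V b = square_class 1"
proof (rule decomposableE[OF dim assms(3)])
  fix V1 V2 :: "(nat \<Rightarrow> 'a) set" and b1 b2 g
  assume b1: "bilinear_space fscale V1 b1" and b2: "bilinear_space fscale V2 b2"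
    and d: "fs.dim V1 = 2" "fs.dim V2 = 2" and g: "linear_iso fscale (tensor_space V1 V2) s V g"
    and gb: "\<And>t u. t \<in> tensor_space V1 V2 \<Longrightarrow> u \<in> tensor_space V1 V2 \<Longrightarrow>
      b (g t) (g u) = tensor_form V1 b1 V2 b2 t u"
  interpret b1: bilinear_space fscale V1 b1 by fact
  interpret b2: bilinear_space fscale V2 b2 by fact
  obtain xs where xs: "ordered_basis fscale V1 xs" by (rule b1.obtain_ordered_basis)
  obtain ys where ys: "ordered_basis fscale V2 ys" by (rule b2.obtain_ordered_basis)
  obtain x0 x1 where x: "xs = [x0, x1]"
    using fs.ordered_basis_length[OF xs] unfolding d(1) by (rule length_2E)
  obtain y0 y1 where y: "ys = [y0, y1]"
    using fs.ordered_basis_length[OF ys] unfolding d(2) by (rule length_2E)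
  have xin: "x0 \<in> V1" "x1 \<in> V1" using fs.ordered_basis_subset[OF xs] x by auto
  have yin: "y0 \<in> V2" "y1 \<in> V2" using fs.ordered_basis_subset[OF ys] y by auto
  let ?ws = "[g (tensor x0 y0), g (tensor x0 y1), g (tensor x1 y0), g (tensor x1 y1)]"
  have ws: "ordered_basis s V ?ws"
    using linear_iso_bases[OF vector_space_fscale tensor_basis[OF xs ys] vector_space_axioms subspace_V g]
    by (simp add: x y)
  note eqs = gb[OF tensor_in tensor_in] tensor_form(2)[OF b1 b2]
  have "det (gram_matrix b ?ws)
    = ((b1 x0 x0 * b1 x1 x1 - b1 x0 x1 * b1 x1 x0) * (b2 y0 y0 * b2 y1 y1 - b2 y0 y1 * b2 y1 y0))\<^sup>2"
    by (rule det_gram_tensor) (simp_all add: eqs xin yin)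
  then have "\<exists>r. det (gram_matrix b ?ws) = r\<^sup>2" by (rule exI)
  moreover have nz: "det (gram_matrix b ?ws) \<noteq> 0" by (rule nondegenerate_det[OF nd ws])
  moreover have "det_class s V b = square_class (det (gram_matrix b ?ws))"
    by (rule det_class_gram[OF ordered_basis_subset[OF ws] _ nz]) (simp add: dim)
  ultimately show ?thesis using square_class_eq_1_iff[OF nz] by (simp only:)
qed

section \<open>Asymmetries of planes\<close>

lemma asymmetry_eqI_basis:
  assumes nd: "nondegenerate V b" and vs: "ordered_basis s V vs" and x: "x \<in> V" and z: "z \<in> V"
    and eq: "\<And>v. v \<in> set vs \<Longrightarrow> b x v = b v z"
  shows "asymmetry s V b x = z"
proof (rule asymmetry_eqI[OF nd x z])
  fix y assume y: "y \<in> V"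
  have sp: "span (set vs) = V" using vs by (simp add: ordered_basis_def)
  have "y \<in> span (set vs)" using y sp by simp
  then show "b x y = b y z"
    by (rule linear_eq_on_span) (use x z eq in \<open>simp_all add: sp bilin\<close>)
qed

text \<open>Only \<open>b (a x) x\<close> is free in the Gram matrix of \<open>x\<close>,
  \<open>a x\<close>. The number \<open>1 + b (a x) x / b x x\<close> is the trace of
  \<open>a\<close>, and it equals 2 exactly when the Gram determinant vanishes. The recursion is
  verified by pairing with the basis.\<close>

lemma asymmetry_cyclic:
  fixes a :: "'v \<Rightarrow> 'v"
  assumes nd: "nondegenerate V b" and dim: "dim V = 2" and x: "x \<in> V"
  defines "a \<equiv> asymmetry s V b"
  assumes c0: "b x x \<noteq> 0" and d: "b (a x) x \<noteq> b x x"
  shows "ordered_basis s V [x, a x]" "1 + b (a x) x / b x x \<noteq> 2"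
    "a (a x) = s (1 + b (a x) x / b x x) (a x) - x"
proof -
  note A = asymmetry[OF nd, folded a_def]
  have ax: "a x \<in> V" using A x by simp
  have 1: "b x (a x) = b x x" using A(2)[OF x x] by simp
  have 2: "b (a x) (a x) = b x x" using A(2)[OF x ax] 1 by simp
  show bas: "ordered_basis s V [x, a x]"
  proof (rule gram_basis)
    show "det (gram_matrix b [x, a x]) \<noteq> 0" using d c0 by (simp add: det_gram_2 1 2)
  qed (use x ax dim in auto)
  show "1 + b (a x) x / b x x \<noteq> 2" using d c0 by (simp add: field_simps)
  show "a (a x) = s (1 + b (a x) x / b x x) (a x) - x"
    by (rule asymmetry_eqI_basis[OF nd bas, folded a_def])
      (use x ax c0 in \<open>auto simp: bilin 1 2 field_simps\<close>)
qed

text \<open>An alternating form has asymmetry -1. Otherwise an anisotropic \<open>x\<close> is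
  either cyclic or satisfies \<open>b (a x) x = b x x\<close>, and that equation forces an
  orthogonal basis, hence asymmetry 1.\<close>

lemma asymmetry_dim2:
  fixes a :: "'v \<Rightarrow> 'v"
  assumes two: "(2::'a) \<noteq> 0" and nd: "nondegenerate V b" and dim: "dim V = 2"
  defines "a \<equiv> asymmetry s V b"
  shows "(\<forall>x\<in>V. a x = x) \<or> (\<forall>x\<in>V. a x = - x) \<or>
    (\<exists>x\<in>V. \<exists>k. ordered_basis s V [x, a x] \<and> k \<noteq> 2 \<and> a (a x) = s k (a x) - x)"
proof (cases "\<forall>x\<in>V. b x x = 0")
  case True
  have skew: "b x y = - b y x" if "x \<in> V" "y \<in> V" for x y
  proof -
    have "b (x + y) (x + y) = 0" "b x x = 0" "b y y = 0" using True that by auto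
    then show ?thesis using that by (simp add: bilin eq_neg_iff_add_eq_0 add.commute)
  qed
  have "a x = - x" if x: "x \<in> V" for x
    unfolding a_def
  proof (rule asymmetry_eqI[OF nd x])
    fix y assume y: "y \<in> V"
    show "b x y = b y (- x)" using skew[OF x y] neg_right[OF y x] by simp
  qed (use x in simp)
  then show ?thesis by blast
next
  case False
  then obtain x where x: "x \<in> V" and c0: "b x x \<noteq> 0" by blast
  define c where "c = b x x"
  note A = asymmetry[OF nd, folded a_def]
  define d where "d = b (a x) x"
  show ?thesis
  proof (cases "d = c")
    case False
    then have "b (a x) x \<noteq> b x x" by (simp add: c_def d_def)
    note cyc = asymmetry_cyclic[OF nd dim x c0, folded a_def, OF this]
    show ?thesis
      by (intro disjI2 bexI[of _ x] exI[of _ "1 + b (a x) x / b x x"] conjI cyc x)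
  next
    case True
    obtain vs where vs: "ordered_basis s V vs" by (rule obtain_ordered_basis)
    obtain v0 v1 where v: "vs = [v0, v1]"
      using ordered_basis_length[OF vs] unfolding dim by (rule length_2E)
    have vin: "v0 \<in> V" "v1 \<in> V" using ordered_basis_subset[OF vs] v by auto
    \<comment> \<open>A vector right-orthogonal to \<open>x\<close>, with coefficients from
      cross-multiplying the values of \<open>b x\<close> on the basis.\<close>
    define w where "w = s (b x v1) v0 - s (b x v0) v1"
    have w: "w \<in> V" using vin by (simp add: w_def)
    have xw: "b x w = 0" using vin x by (simp add: w_def bilin)
    have "w \<noteq> 0"
    proof
      assume "w = 0"
      define k where "k j = (if j = 0 then b x v1 else - b x v0)" for j :: nat
      have "(\<Sum>j<length vs. s (k j) (vs ! j)) = 0"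
        using \<open>w = 0\<close> by (simp add: v k_def w_def lessThan_Suc)
      then have "k 0 = 0" "k 1 = 0" using ordered_basis_indep[OF vs] v by auto
      then have "b x v1 = 0" "b x v0 = 0" by (auto simp: k_def)
      moreover obtain e where e: "x = (\<Sum>j<length vs. s (e j) (vs ! j))"
        using ordered_basis_coords[OF vs x] by blast
      have "b x x = (\<Sum>j<length vs. e j * b x (vs ! j))"
        using comb_right[OF ordered_basis_subset[OF vs] x, of e] unfolding e[symmetric] .
      ultimately have "b x x = 0" by (simp add: v lessThan_Suc)
      then show False using c0 by simp
    qed
    have bas: "ordered_basis s V [x, w]"
    proof -
      obtain S where S: "finite S" "span S = V" using finite_dim by blast
      show ?thesis
      proof (rule ordered_basisI[OF S])
        fix e i assume *: "(\<Sum>j<length [x, w]. s (e j) ([x, w] ! j)) = 0" "i < length [x, w]"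
        then have 0: "s (e 0) x + s (e 1) w = 0" by (simp add: lessThan_Suc add.commute)
        then have "b x (s (e 0) x + s (e 1) w) = 0" using x by simp
        then have "e 0 = 0" using x w xw c0 by (simp add: bilin)
        then have "e 1 = 0" using 0 \<open>w \<noteq> 0\<close> by simp
        then show "e i = 0" using *(2) \<open>e 0 = 0\<close> by (auto simp: less_Suc_eq numeral_2_eq_2)
      qed (use x w dim in auto)
    qed
    define e f where "e = b w w" and "f = b w x"
    have e0: "e \<noteq> 0" using nondegenerate_det[OF nd bas] by (auto simp: det_gram_2 xw e_def)
    have "a x = x - s (f / e) w"
      unfolding a_def
      by (rule asymmetry_eqI_basis[OF nd bas])
        (use x w xw e0 in \<open>auto simp: bilin field_simps simp flip: e_def f_def\<close>)
    \<comment> \<open>Equality of \<open>d\<close> and \<open>c\<close> now forces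
      \<open>f = 0\<close>, so \<open>x\<close> and \<open>w\<close> are orthogonal on both sides
      and \<open>b\<close> is symmetric.\<close>
    then have "d = c - f / e * f" using x w by (simp add: d_def c_def f_def bilin)
    then have f0: "f = 0" using True e0 by simp
    have ax: "a x = x" unfolding a_def
      by (rule asymmetry_eqI_basis[OF nd bas]) (use x w xw f0 f_def in auto)
    have aw: "a w = w" unfolding a_def
      by (rule asymmetry_eqI_basis[OF nd bas]) (use x w xw f0 f_def in auto)
    have sp: "span {x, w} = V" using bas by (simp add: ordered_basis_def)
    have "a y = y" if "y \<in> V" for y
    proof -
      have "y \<in> span {x, w}" using that sp by simp
      then have "y \<in> V \<and> a y = y"
      proof (induction rule: span_induct_alt)
        case base
        show ?case using A(4)[of 0 0] by simp
      next
        case (step k u z)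
        then show ?case using A(3,4) x w ax aw by auto
      qed
      then show ?thesis by simp
    qed
    then show ?thesis by blast
  qed
qed

end

section \<open>Asymmetries of tensor products and their conjugacy\<close>

lemma nondegenerate_tensor_iff:
  assumes b1: "bilinear_space fscale V1 b1" and b2: "bilinear_space fscale V2 b2"
    and d: "fs.dim V1 = 2" "fs.dim V2 = 2"
  shows "nondegenerate (tensor_space V1 V2) (tensor_form V1 b1 V2 b2)
    \<longleftrightarrow> nondegenerate V1 b1 \<and> nondegenerate V2 b2"
proof -
  interpret b1: bilinear_space fscale V1 b1 by fact
  interpret b2: bilinear_space fscale V2 b2 by fact
  obtain xs where xs: "ordered_basis fscale V1 xs" by (rule b1.obtain_ordered_basis)
  obtain ys where ys: "ordered_basis fscale V2 ys" by (rule b2.obtain_ordered_basis)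
  obtain x0 x1 where x: "xs = [x0, x1]"
    using fs.ordered_basis_length[OF xs] unfolding d(1) by (rule length_2E)
  obtain y0 y1 where y: "ys = [y0, y1]"
    using fs.ordered_basis_length[OF ys] unfolding d(2) by (rule length_2E)
  have xin: "x0 \<in> V1" "x1 \<in> V1" using fs.ordered_basis_subset[OF xs] x by auto
  have yin: "y0 \<in> V2" "y1 \<in> V2" using fs.ordered_basis_subset[OF ys] y by auto
  interpret t: bilinear_space fscale "tensor_space V1 V2" "tensor_form V1 b1 V2 b2"
    by (rule tensor_form(1)[OF b1 b2])
  let ?L = "[tensor x0 y0, tensor x0 y1, tensor x1 y0, tensor x1 y1]"
  have L: "ordered_basis fscale (tensor_space V1 V2) ?L"
    using tensor_basis[OF xs ys] by (simp add: x y)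
  have "det (gram_matrix (tensor_form V1 b1 V2 b2) ?L)
    = ((b1 x0 x0 * b1 x1 x1 - b1 x0 x1 * b1 x1 x0) * (b2 y0 y0 * b2 y1 y1 - b2 y0 y1 * b2 y1 y0))\<^sup>2"
    by (rule det_gram_tensor) (simp_all add: tensor_form(2)[OF b1 b2] xin yin)
  also have "\<dots> = (det (gram_matrix b1 xs) * det (gram_matrix b2 ys))\<^sup>2"
    by (simp only: x y det_gram_2)
  finally have "det (gram_matrix (tensor_form V1 b1 V2 b2) ?L) \<noteq> 0
    \<longleftrightarrow> det (gram_matrix b1 xs) \<noteq> 0 \<and> det (gram_matrix b2 ys) \<noteq> 0"
    by (simp only: zero_eq_power2 mult_eq_0_iff de_Morgan_disj)
  then show ?thesis
    using t.nondegenerate_det[OF _ L] t.det_nondegenerate[OF L]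
      b1.nondegenerate_det[OF _ xs] b1.det_nondegenerate[OF xs]
      b2.nondegenerate_det[OF _ ys] b2.det_nondegenerate[OF ys] by blast
qed

text \<open>The product of the two defining relations is the one for the tensor form on pure
  tensors, which span; uniqueness of the asymmetry does the rest.\<close>

lemma asymmetry_tensor:
  assumes b1: "bilinear_space fscale V1 b1" and b2: "bilinear_space fscale V2 b2"
    and nd1: "nondegenerate V1 b1" and nd2: "nondegenerate V2 b2"
    and nd: "nondegenerate (tensor_space V1 V2) (tensor_form V1 b1 V2 b2)"
    and x: "x \<in> V1" and y: "y \<in> V2"
  shows "asymmetry fscale (tensor_space V1 V2) (tensor_form V1 b1 V2 b2) (tensor x y)
    = tensor (asymmetry fscale V1 b1 x) (asymmetry fscale V2 b2 y)"
proof -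
  interpret b1: bilinear_space fscale V1 b1 by fact
  interpret b2: bilinear_space fscale V2 b2 by fact
  let ?T = "tensor_space V1 V2" and ?b = "tensor_form V1 b1 V2 b2"
  interpret t: bilinear_space fscale ?T ?b by (rule tensor_form(1)[OF b1 b2])
  note a = b1.asymmetry[OF nd1] b2.asymmetry[OF nd2]
  show ?thesis
  proof (rule t.asymmetry_eqI[OF nd])
    fix u assume "u \<in> ?T"
    then have "u \<in> fs.span {tensor x y | x y. x \<in> V1 \<and> y \<in> V2}" by (simp add: tensor_space_def)
    note T = tensor_in[OF x y] tensor_in[OF a(1)[OF x] a(5)[OF y]]
    show "?b (tensor x y) u = ?b u (tensor (asymmetry fscale V1 b1 x) (asymmetry fscale V2 b2 y))"
      using \<open>u \<in> fs.span _\<close>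
    proof (rule fs.linear_eq_on_span; (unfold tensor_space_def[symmetric])?)
      fix u assume "u \<in> {tensor x y | x y. x \<in> V1 \<and> y \<in> V2}"
      then obtain x' y' where "u = tensor x' y'" "x' \<in> V1" "y' \<in> V2" by blast
      then show "?b (tensor x y) u = ?b u (tensor (asymmetry fscale V1 b1 x) (asymmetry fscale V2 b2 y))"
        using x y a(1,5) by (simp add: tensor_form(2)[OF b1 b2] flip: a(2) a(6))
    qed (auto simp only: t.add_left t.add_right t.scale_left t.scale_right T)
  qed (use x y a(1,5) in \<open>auto intro: tensor_in\<close>)
qed

text \<open>
  If \<open>\<alpha>\<^sup>2 = a1 \<cdot> \<alpha> - 1\<close> and \<open>\<beta>\<^sup>2 = a2 \<cdot> \<beta> - 1\<close>, this is the action of \<open>\<alpha> \<otimes> \<beta>\<close> on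
  \<open>x \<otimes> y\<close>, \<open>x \<otimes> \<beta> y\<close>, \<open>\<alpha> x \<otimes> y\<close>, \<open>\<alpha> x \<otimes> \<beta> y\<close>.
\<close>

definition tensor_action :: "('a::ring \<Rightarrow> 'v \<Rightarrow> 'v) \<Rightarrow> ('v \<Rightarrow> 'v) \<Rightarrow> 'a \<Rightarrow> 'a
    \<Rightarrow> 'v \<Rightarrow> 'v \<Rightarrow> 'v \<Rightarrow> 'v::ab_group_add \<Rightarrow> bool" where
  "tensor_action s A a1 a2 e0 e1 e2 e3 \<longleftrightarrow> A e0 = e3 \<and> A e1 = s a2 e3 - e2 \<and> A e2 = s a1 e3 - e1
    \<and> A e3 = e0 - s a1 e2 - s a2 e1 + s (a1 * a2) e3"

text \<open>Exchanging the tensor factors exchanges the two middle vectors. This reduces a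
  non-generic second trace to a non-generic first one.\<close>

lemma tensor_action_swap:
  "tensor_action s A a1 a2 e0 e1 e2 e3 \<Longrightarrow> tensor_action s A a2 a1 e0 e2 e1 (e3 :: 'v::ab_group_add)"
  for a1 :: "'a::comm_ring"
  by (simp add: tensor_action_def mult.commute diff_right_commute)

lemma tensor_diff_left: "tensor (x - y) z = tensor x z - tensor y (z :: _ \<Rightarrow> 'a::field)"
  and tensor_diff_right: "tensor z (x - y) = tensor z x - tensor (z :: _ \<Rightarrow> 'a) y"
  by (auto simp: tensor_def fun_eq_iff algebra_simps)

lemma tensor_action_tensor:
  assumes b1: "bilinear_space fscale V1 b1" and b2: "bilinear_space fscale V2 b2"
    and nd1: "nondegenerate V1 b1" and nd2: "nondegenerate V2 b2"
    and nd: "nondegenerate (tensor_space V1 V2) (tensor_form V1 b1 V2 b2)"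
  defines "\<alpha> \<equiv> asymmetry fscale V1 b1" and "\<beta> \<equiv> asymmetry fscale V2 b2"
  assumes x: "x \<in> V1" and xb: "\<alpha> (\<alpha> x) = fscale a1 (\<alpha> x) - x"
    and y: "y \<in> V2" and yb: "\<beta> (\<beta> y) = fscale a2 (\<beta> y) - y"
  shows "tensor_action fscale (asymmetry fscale (tensor_space V1 V2) (tensor_form V1 b1 V2 b2)) a1 a2
    (tensor x y) (tensor x (\<beta> y)) (tensor (\<alpha> x) y) (tensor (\<alpha> x) (\<beta> y))"
proof -
  interpret b1: bilinear_space fscale V1 b1 by fact
  interpret b2: bilinear_space fscale V2 b2 by fact
  note A = asymmetry_tensor[OF b1 b2 nd1 nd2 nd, folded \<alpha>_def \<beta>_def]
  have m: "\<alpha> x \<in> V1" "\<beta> y \<in> V2"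
    using b1.asymmetry(1)[OF nd1 x] b2.asymmetry(1)[OF nd2 y] by (simp_all add: \<alpha>_def \<beta>_def)
  show ?thesis
    unfolding tensor_action_def A[OF x y] A[OF x m(2)] A[OF m(1) y] A[OF m] xb yb
    by (auto simp: tensor_def fscale_def fun_eq_iff algebra_simps)
qed

lemma linear_map_eq_on_basis:
  assumes "vector_space s" "ordered_basis s V vs" "vector_space s'"
    and f: "linear_map s V s' W f" and g: "linear_map s V s' W g"
    and eq: "\<And>v. v \<in> set vs \<Longrightarrow> f v = g v" and x: "x \<in> V"
  shows "f x = g x"
proof -
  interpret v: vector_space s by fact
  interpret w: vector_space s' by fact
  have sp: "v.span (set vs) = V" using assms(2) by (simp add: ordered_basis_def)
  have fl: "f (x + y) = f x + f y" "f (s c x) = s' c (f x)"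
    "g (x + y) = g x + g y" "g (s c x) = s' c (g x)" if "x \<in> V" "y \<in> V" for x y c
    using f g that by (auto simp: linear_map_def)
  have "x \<in> v.span (set vs)" using x sp by simp
  then have "x \<in> V \<and> f x = g x"
  proof (induction rule: v.span_induct_alt)
    case base
    have "0 \<in> V" using sp v.span_zero by blast
    then show ?case using fl(2)[of 0 0 0] fl(4)[of 0 0 0] by simp
  next
    case (step c u z)
    have u: "u \<in> V" using step(1) sp v.span_base by blast
    then have cu: "s c u \<in> V" using sp v.span_scale by blast
    then have "s c u + z \<in> V" using sp v.span_add step(2) by blast
    moreover have "f (s c u + z) = g (s c u + z)"
      using fl(1)[OF cu, of z] fl(3)[OF cu, of z] fl(2)[OF u u, of c] fl(4)[OF u u, of c]
        eq[OF step(1)] step(2) by simp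
    ultimately show ?case by blast
  qed
  then show ?thesis by simp
qed

lemma (in bilinear_space) asymmetry_linear:
  "nondegenerate V b \<Longrightarrow> linear_map s V s V (asymmetry s V b)"
  unfolding linear_map_def using asymmetry(1,3,4) by (simp add: Pi_iff)

lemma linear_map_comp:
  "linear_map s V s' W f \<Longrightarrow> linear_map s' W s'' U g \<Longrightarrow> linear_map s V s'' U (\<lambda>x. g (f x))"
  unfolding linear_map_def by (simp add: Pi_iff)

text \<open>The action relations mention only the two traces, so the linear map matching the two
  bases intertwines the asymmetries. It is in general no isometry.\<close>

lemma conjugate_tensor_action:
  assumes V: "bilinear_space s V b" "nondegenerate V b" and W: "bilinear_space s' W c" "nondegenerate W c"
    and ts: "ordered_basis s V [t0, t1, t2, t3]" "tensor_action s (asymmetry s V b) a1 a2 t0 t1 t2 t3"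
    and es: "ordered_basis s' W [e0, e1, e2, e3]" "tensor_action s' (asymmetry s' W c) a1 a2 e0 e1 e2 e3"
  shows "conjugate_endo s V (asymmetry s V b) s' W (asymmetry s' W c)"
proof -
  interpret v: bilinear_space s V b by fact
  interpret w: bilinear_space s' W c by fact
  obtain f where f: "linear_iso s V s' W f"
    and fi: "\<And>i. i < length [t0, t1, t2, t3] \<Longrightarrow> f ([t0, t1, t2, t3] ! i) = [e0, e1, e2, e3] ! i"
    by (rule iso_of_ordered_bases[OF v.vector_space_axioms ts(1) w.vector_space_axioms es(1)]) auto
  have fe: "f t0 = e0" "f t1 = e1" "f t2 = e2" "f t3 = e3"
    using fi[of 0] fi[of 1] fi[of 2] fi[of 3] by simp_all
  have lf: "linear_map s V s' W f" using f by (simp add: linear_iso_def)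
  have t: "t0 \<in> V" "t1 \<in> V" "t2 \<in> V" "t3 \<in> V" using v.ordered_basis_subset[OF ts(1)] by auto
  have fl: "f (x + y) = f x + f y" "f (s c x) = s' c (f x)" if "x \<in> V" "y \<in> V" for x y c
    using lf that by (auto simp: linear_map_def)
  have fd: "f (x - y) = f x - f y" if "x \<in> V" "y \<in> V" for x y
    using fl(1)[of "x - y" y] that by (simp add: eq_diff_eq)
  have *: "asymmetry s' W c (f x) = f (asymmetry s V b x)" if "x \<in> V" for x
  proof (rule linear_map_eq_on_basis[OF v.vector_space_axioms ts(1) w.vector_space_axioms _ _ _ that])
    show "linear_map s V s' W (\<lambda>x. asymmetry s' W c (f x))"
      by (rule linear_map_comp[OF lf w.asymmetry_linear[OF W(2)]])
    show "linear_map s V s' W (\<lambda>x. f (asymmetry s V b x))"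
      by (rule linear_map_comp[OF v.asymmetry_linear[OF V(2)] lf])
    fix v assume "v \<in> set [t0, t1, t2, t3]"
    then consider "v = t0" | "v = t1" | "v = t2" | "v = t3" by auto
    then show "asymmetry s' W c (f v) = f (asymmetry s V b v)"
      using ts(2) es(2) unfolding tensor_action_def
      by cases (simp_all add: fe fl(1) fl(2)[OF _ t(1)] fd t)
  qed
  have bij: "bij_betw f V W" using f by (simp add: linear_iso_def)
  have "asymmetry s' W c y = f (asymmetry s V b (inv_into V f y))" if "y \<in> W" for y
  proof -
    have "f (inv_into V f y) = y" using bij that by (simp add: bij_betw_inv_into_right)
    moreover have "inv_into V f y \<in> V"
      using bij that by (metis bij_betw_def inv_into_into)
    ultimately show ?thesis using *[of "inv_into V f y"] by simp
  qed
  then show ?thesis unfolding conjugate_endo_def using f by blast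
qed

text \<open>The form is a model of a cyclic plane of trace \<open>a\<close>: with \<open>x\<close>
  the first unit vector, \<open>b_form a x x = 1\<close> and
  \<open>b_form a (\<alpha> x) x = a - 1\<close>.\<close>

lemma b_form_model:
  fixes a :: "'a::field"
  assumes a: "a \<noteq> 2"
  defines "\<alpha> \<equiv> asymmetry fscale (coord_space 2) (b_form a)" and "x \<equiv> unit_fun 0"
  shows "bilinear_space fscale (coord_space 2) (b_form a)"
    "nondegenerate (coord_space 2) (b_form a)" "fs.dim (coord_space 2 :: (nat \<Rightarrow> 'a) set) = 2"
    "x \<in> coord_space 2" "ordered_basis fscale (coord_space 2) [x, \<alpha> x]"
    "\<alpha> (\<alpha> x) = fscale a (\<alpha> x) - x"
proof -
  let ?C = "coord_space 2 :: (nat \<Rightarrow> 'a) set" and ?u = "unit_fun :: nat \<Rightarrow> nat \<Rightarrow> 'a"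
  define M where "M = mat_of_rows_list 2 [[1, 1], [0, 1 / (2 - a)]]"
  have M: "M \<in> carrier_mat 2 2" by (auto simp: M_def mat_of_rows_list_def)
  have bf: "b_form a = matrix_form M" by (simp add: b_form_def M_def)
  show bil: "bilinear_space fscale ?C (b_form a)" unfolding bf by (rule matrix_form_2(1)[OF M])
  then interpret b: bilinear_space fscale ?C "b_form a" .
  note C = coord_space_2_basis[where 'a='a]
  have g: "b_form a (?u 0) (?u 0) = 1" "b_form a (?u 0) (?u 1) = 1" "b_form a (?u 1) (?u 0) = 0"
    "b_form a (?u 1) (?u 1) = 1 / (2 - a)"
    unfolding bf by (simp_all only: matrix_form_2(2)[OF M]) (simp_all add: M_def mat_of_rows_list_def)
  have u: "?u 0 \<in> ?C" "?u 1 \<in> ?C" using fs.ordered_basis_subset[OF C] by auto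
  show nd: "nondegenerate ?C (b_form a)"
    by (rule b.det_nondegenerate[OF C]) (use a in \<open>simp add: det_gram_2 g del: One_nat_def\<close>)
  show dim: "fs.dim ?C = 2" using fs.ordered_basis_length[OF C] by simp
  show x: "x \<in> ?C" using u by (simp add: x_def)
  \<comment> \<open>The coefficients solve the equations from pairing with the unit vectors: their
    sum is 1, and the second one divided by \<open>2 - a\<close> is 1.\<close>
  have ax: "\<alpha> x = fscale (a - 1) (?u 0) + fscale (2 - a) (?u 1)"
    unfolding \<alpha>_def x_def
  proof (rule b.asymmetry_eqI_basis[OF nd C u(1)])
    show "fscale (a - 1) (?u 0) + fscale (2 - a) (?u 1) \<in> ?C" using u by (intro b.V_closed)
    fix v assume "v \<in> set [?u 0, ?u 1]"
    then consider "v = ?u 0" | "v = ?u 1" by auto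
    then show "b_form a (?u 0) v = b_form a v (fscale (a - 1) (?u 0) + fscale (2 - a) (?u 1))"
      by cases (simp_all only: b.add_right b.scale_right b.V_closed u g,
          use a in \<open>simp_all add: field_simps\<close>)
  qed
  have d: "b_form a (\<alpha> x) x = a - 1"
    unfolding ax unfolding x_def by (simp only: b.add_left b.scale_left b.V_closed u g) simp
  have c: "b_form a x x = 1" by (simp add: x_def g)
  have ne: "b_form a (\<alpha> x) x \<noteq> b_form a x x" using a by (simp add: c d)
  have c0: "b_form a x x \<noteq> 0" by (simp add: c)
  note cyc = b.asymmetry_cyclic[OF nd dim x c0, folded \<alpha>_def, OF ne]
  show "ordered_basis fscale ?C [x, \<alpha> x]" by (rule cyc(1))
  show "\<alpha> (\<alpha> x) = fscale a (\<alpha> x) - x" using cyc(3) by (simp add: c d)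
qed

text \<open>The hypothesis supplies an isometry with a tensor product and, separately, a conjugation
  to the asymmetry of \<open>b\<close>. Their composite \<open>h\<close> intertwines the asymmetries
  but carries no information on \<open>b\<close>, which must later be recovered from its
  asymmetry.\<close>

lemma decomposable_asymmetryE:
  assumes V: "bilinear_space s V b" and nd: "nondegenerate V b" and dim: "vector_space.dim s V = 4"
    and "has_decomposable_asymmetry s V b"
  obtains V1 V2 :: "(nat \<Rightarrow> 'a::field) set" and b1 b2 h
  where "bilinear_space fscale V1 b1" "bilinear_space fscale V2 b2"
    "fs.dim V1 = 2" "fs.dim V2 = 2"
    "nondegenerate (tensor_space V1 V2) (tensor_form V1 b1 V2 b2)"
    "linear_iso fscale (tensor_space V1 V2) s V h"
    "\<And>t. t \<in> tensor_space V1 V2 \<Longrightarrow> asymmetry s V b (h t)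
      = h (asymmetry fscale (tensor_space V1 V2) (tensor_form V1 b1 V2 b2) t)"
proof -
  interpret v: bilinear_space s V b by fact
  obtain V0 :: "(nat \<Rightarrow> 'a) set" and b0 f where V0: "bilinear_space fscale V0 b0"
    and nd0: "nondegenerate V0 b0" and dec: "decomposable fscale V0 b0"
    and f: "linear_iso fscale V0 s V f"
    and conj: "\<And>y. y \<in> V \<Longrightarrow> asymmetry s V b y = f (asymmetry fscale V0 b0 (inv_into V0 f y))"
    using assms(4) unfolding has_decomposable_asymmetry_def conjugate_endo_def by blast
  interpret v0: bilinear_space fscale V0 b0 by fact
  have "fs.dim V0 = 4"
    using linear_iso_dim[OF V0 v.vector_space_axioms v.subspace_V f] dim by simp
  then show ?thesis
  proof (rule v0.decomposableE[OF _ dec])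
    fix V1 V2 :: "(nat \<Rightarrow> 'a) set" and b1 b2 g
    assume b1: "bilinear_space fscale V1 b1" and b2: "bilinear_space fscale V2 b2"
      and d: "fs.dim V1 = 2" "fs.dim V2 = 2" and g: "linear_iso fscale (tensor_space V1 V2) fscale V0 g"
      and gb: "\<And>t u. t \<in> tensor_space V1 V2 \<Longrightarrow> u \<in> tensor_space V1 V2 \<Longrightarrow>
        b0 (g t) (g u) = tensor_form V1 b1 V2 b2 t u"
    let ?T = "tensor_space V1 V2" and ?b = "tensor_form V1 b1 V2 b2"
    interpret t: bilinear_space fscale ?T ?b by (rule tensor_form(1)[OF b1 b2])
    have im: "g ` ?T = V0" and inj: "inj_on g ?T" using g by (auto simp: linear_iso_def bij_betw_def)
    have gin: "g t \<in> V0" if "t \<in> ?T" for t using im that by blast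
    have ndT: "nondegenerate ?T ?b"
      unfolding nondegenerate_def
    proof (intro ballI impI)
      fix t assume t: "t \<in> ?T" "\<forall>u\<in>?T. ?b t u = 0"
      have "b0 (g t) y = 0" if "y \<in> V0" for y
      proof -
        obtain u where "u \<in> ?T" "y = g u" using \<open>y \<in> V0\<close> unfolding im[symmetric] by blast
        then show ?thesis using t gb by simp
      qed
      then have "g t = 0" using nd0 gin[OF t(1)] by (simp add: nondegenerate_def)
      moreover have "g (fscale 0 0) = fscale 0 (g 0)"
        using g t.V_closed(1) unfolding linear_iso_def linear_map_def by blast
      ultimately have "g t = g 0" by simp
      then show "t = 0" using inj_onD[OF inj _ t(1) t.V_closed(1)] by simp
    qed
    have ag: "asymmetry fscale V0 b0 (g t) = g (asymmetry fscale ?T ?b t)" if t: "t \<in> ?T" for t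
    proof (rule v0.asymmetry_eqI[OF nd0 gin[OF t] gin[OF t.asymmetry(1)[OF ndT t]]])
      fix y assume "y \<in> V0"
      then obtain u where u: "u \<in> ?T" "y = g u" unfolding im[symmetric] by blast
      show "b0 (g t) y = b0 y (g (asymmetry fscale ?T ?b t))"
        unfolding u(2) gb[OF t u(1)] gb[OF u(1) t.asymmetry(1)[OF ndT t]]
        by (rule t.asymmetry(2)[OF ndT t u(1)])
    qed
    have h: "asymmetry s V b (f (g t)) = f (g (asymmetry fscale ?T ?b t))" if t: "t \<in> ?T" for t
    proof -
      have bij: "bij_betw f V0 V" using f by (simp add: linear_iso_def)
      then have "f (g t) \<in> V" using gin[OF t] by (auto simp: bij_betw_def)
      then show ?thesis
        using conj[of "f (g t)"] bij_betw_inv_into_left[OF bij gin[OF t]] ag[OF t] by simp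
    qed
    show thesis
      by (rule that[OF b1 b2 d ndT linear_iso_comp[OF g f]]) (simp add: h)
  qed
qed

section \<open>Genericity and the shapes of a decomposable asymmetry\<close>

text \<open>\<open>a\<^sup>2 - 4\<close> is the discriminant of X^2 - a X + 1; in characteristic
  other than two the condition says that this polynomial is irreducible.\<close>

definition generic_trace :: "'a::field \<Rightarrow> bool" where
  "generic_trace a \<longleftrightarrow> a \<notin> {-2, 2} \<and> \<not> (\<exists>u. u \<noteq> 0 \<and> a\<^sup>2 - 4 = u\<^sup>2)"

lemma generic_decomposable_asymmetryI:
  assumes V: "bilinear_space s V b" and nd: "nondegenerate V b"
    and gen: "generic_trace (a1 :: 'a::field)" "generic_trace a2"
    and es: "ordered_basis s V [e0, e1, e2, e3]" "tensor_action s (asymmetry s V b) a1 a2 e0 e1 e2 e3"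
  shows "has_generic_decomposable_asymmetry s V b"
proof -
  let ?C = "coord_space 2 :: (nat \<Rightarrow> 'a) set"
  have a: "a1 \<noteq> 2" "a2 \<noteq> 2" using gen by (auto simp: generic_trace_def)
  note m1 = b_form_model[OF a(1)] and m2 = b_form_model[OF a(2)]
  let ?T = "tensor_space ?C ?C" and ?b = "tensor_form ?C (b_form a1) ?C (b_form a2)"
  have ndT: "nondegenerate ?T ?b"
    using nondegenerate_tensor_iff[OF m1(1) m2(1) m1(3) m2(3)] m1(2) m2(2) by simp
  have "conjugate_endo fscale ?T (asymmetry fscale ?T ?b) s V (asymmetry s V b)"
  proof (rule conjugate_tensor_action[OF tensor_form(1)[OF m1(1) m2(1)] ndT V nd _ _ es])
    show "tensor_action fscale (asymmetry fscale ?T ?b) a1 a2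
      (tensor (unit_fun 0) (unit_fun 0))
      (tensor (unit_fun 0) (asymmetry fscale ?C (b_form a2) (unit_fun 0)))
      (tensor (asymmetry fscale ?C (b_form a1) (unit_fun 0)) (unit_fun 0))
      (tensor (asymmetry fscale ?C (b_form a1) (unit_fun 0)) (asymmetry fscale ?C (b_form a2) (unit_fun 0)))"
      by (rule tensor_action_tensor[OF m1(1) m2(1) m1(2) m2(2) ndT m1(4) m1(6) m2(4) m2(6)])
    show "ordered_basis fscale ?T [tensor (unit_fun 0) (unit_fun 0),
      tensor (unit_fun 0) (asymmetry fscale ?C (b_form a2) (unit_fun 0)),
      tensor (asymmetry fscale ?C (b_form a1) (unit_fun 0)) (unit_fun 0),
      tensor (asymmetry fscale ?C (b_form a1) (unit_fun 0)) (asymmetry fscale ?C (b_form a2) (unit_fun 0))]"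
      using tensor_basis[OF m1(5) m2(5)] by simp
  qed
  then show ?thesis
    unfolding has_generic_decomposable_asymmetry_def Let_def
    using gen unfolding generic_trace_def by blast
qed

text \<open>
  The action of \<open>\<epsilon> \<otimes> \<beta>\<close> on \<open>x \<otimes> y\<close> and \<open>x \<otimes> \<beta> y\<close>, where \<open>\<beta>\<^sup>2 = a \<cdot> \<beta> - 1\<close> and \<open>\<epsilon> = \<plusminus>1\<close>.
\<close>

definition scalar_action :: "('a::ring_1 \<Rightarrow> 'v \<Rightarrow> 'v) \<Rightarrow> ('v \<Rightarrow> 'v) \<Rightarrow> 'a \<Rightarrow> 'a \<Rightarrow> 'v \<Rightarrow> 'v::ab_group_add \<Rightarrow> bool" where
  "scalar_action s A \<epsilon> a e f \<longleftrightarrow> A e = s \<epsilon> f \<and> A f = s \<epsilon> (s a f - e)"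

text \<open>Each plane is scalar or cyclic. Two scalars give a scalar; both mixed cases give two
  cyclic pairs with the same recursion and are merged; two cyclic planes give a tensor action, and
  there the failure of genericity enters.\<close>

lemma decomposable_asymmetry_cases:
  fixes s :: "'a::field \<Rightarrow> 'v::ab_group_add \<Rightarrow> 'v"
  assumes V: "bilinear_space s V b" and nd: "nondegenerate V b" and dim: "vector_space.dim s V = 4"
    and two: "(2::'a) \<noteq> 0"
    and "has_decomposable_asymmetry s V b" and ng: "\<not> has_generic_decomposable_asymmetry s V b"
  defines "A \<equiv> asymmetry s V b"
  obtains (scalar) \<epsilon> where "\<epsilon> = 1 \<or> \<epsilon> = -1" "\<And>x. x \<in> V \<Longrightarrow> A x = s \<epsilon> x"
  | (half_scalar) \<epsilon> a e f e' f' where "\<epsilon> = 1 \<or> \<epsilon> = -1" "a \<noteq> 2" "ordered_basis s V [e, f, e', f']"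
    "scalar_action s A \<epsilon> a e f" "scalar_action s A \<epsilon> a e' f'"
  | (cyclic) a1 a2 e0 e1 e2 e3 where "a1 \<noteq> 2" "a2 \<noteq> 2" "ordered_basis s V [e0, e1, e2, e3]"
    "tensor_action s A a1 a2 e0 e1 e2 e3" "\<not> generic_trace a1 \<or> \<not> generic_trace a2"
proof (rule decomposable_asymmetryE[OF V nd dim assms(5)])
  fix V1 V2 :: "(nat \<Rightarrow> 'a) set" and b1 b2 h
  let ?T = "tensor_space V1 V2" and ?b = "tensor_form V1 b1 V2 b2"
  assume b1: "bilinear_space fscale V1 b1" and b2: "bilinear_space fscale V2 b2"
    and d: "fs.dim V1 = 2" "fs.dim V2 = 2" and ndT: "nondegenerate ?T ?b"
    and h: "linear_iso fscale ?T s V h"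
    and hA: "\<And>t. t \<in> ?T \<Longrightarrow> asymmetry s V b (h t) = h (asymmetry fscale ?T ?b t)"
  interpret v: bilinear_space s V b by fact
  interpret b1: bilinear_space fscale V1 b1 by fact
  interpret b2: bilinear_space fscale V2 b2 by fact
  interpret t: bilinear_space fscale ?T ?b by (rule tensor_form(1)[OF b1 b2])
  have nd1: "nondegenerate V1 b1" and nd2: "nondegenerate V2 b2"
    using nondegenerate_tensor_iff[OF b1 b2 d] ndT by auto
  define \<alpha> \<beta> where "\<alpha> = asymmetry fscale V1 b1" and "\<beta> = asymmetry fscale V2 b2"
  have lh: "linear_map fscale ?T s V h" using h by (simp add: linear_iso_def)
  have hl: "h (t + u) = h t + h u" "h (fscale c t) = s c (h t)" "h t \<in> V"
    if "t \<in> ?T" "u \<in> ?T" for t u c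
    using lh that by (auto simp: linear_map_def)
  have hd: "h (t - u) = h t - h u" if "t \<in> ?T" "u \<in> ?T" for t u
    using hl(1)[of "t - u" u] that by (simp add: eq_diff_eq)
  have At: "A (h (tensor x y)) = h (tensor (\<alpha> x) (\<beta> y))" if "x \<in> V1" "y \<in> V2" for x y
    using hA[OF tensor_in[OF that]] asymmetry_tensor[OF b1 b2 nd1 nd2 ndT that]
    by (simp only: A_def \<alpha>_def \<beta>_def)
  have basis: "ordered_basis s V (map h (tensor_list xs ys))"
    if "ordered_basis fscale V1 xs" "ordered_basis fscale V2 ys" for xs ys
    by (rule linear_iso_bases[OF vector_space_fscale tensor_basis[OF that] v.vector_space_axioms v.subspace_V h])
  obtain xs where xs: "ordered_basis fscale V1 xs" by (rule b1.obtain_ordered_basis)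
  obtain ys where ys: "ordered_basis fscale V2 ys" by (rule b2.obtain_ordered_basis)
  obtain x0 x1 where x: "xs = [x0, x1]"
    using fs.ordered_basis_length[OF xs] unfolding d(1) by (rule length_2E)
  obtain y0 y1 where y: "ys = [y0, y1]"
    using fs.ordered_basis_length[OF ys] unfolding d(2) by (rule length_2E)
  have xin: "x0 \<in> V1" "x1 \<in> V1" using fs.ordered_basis_subset[OF xs] x by auto
  have yin: "y0 \<in> V2" "y1 \<in> V2" using fs.ordered_basis_subset[OF ys] y by auto
  define scal1 where "scal1 \<epsilon> \<longleftrightarrow> (\<epsilon> = 1 \<or> \<epsilon> = -1) \<and> (\<forall>x\<in>V1. \<alpha> x = fscale \<epsilon> x)" for \<epsilon>
  define scal2 where "scal2 \<epsilon> \<longleftrightarrow> (\<epsilon> = 1 \<or> \<epsilon> = -1) \<and> (\<forall>x\<in>V2. \<beta> x = fscale \<epsilon> x)" for \<epsilon>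
  define cyc1 where "cyc1 x k \<longleftrightarrow> x \<in> V1 \<and> ordered_basis fscale V1 [x, \<alpha> x] \<and> k \<noteq> 2 \<and> \<alpha> (\<alpha> x) = fscale k (\<alpha> x) - x" for x k
  define cyc2 where "cyc2 x k \<longleftrightarrow> x \<in> V2 \<and> ordered_basis fscale V2 [x, \<beta> x] \<and> k \<noteq> 2 \<and> \<beta> (\<beta> x) = fscale k (\<beta> x) - x" for x k
  have neg: "fscale (-1) x = - x" for x :: "nat \<Rightarrow> 'a" by (simp add: fscale_def fun_eq_iff)
  have c1: "(\<exists>\<epsilon>. scal1 \<epsilon>) \<or> (\<exists>x k. cyc1 x k)"
    using b1.asymmetry_dim2[OF two nd1 d(1)] fs.scale_one neg unfolding scal1_def cyc1_def \<alpha>_def by metis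
  have c2: "(\<exists>\<epsilon>. scal2 \<epsilon>) \<or> (\<exists>x k. cyc2 x k)"
    using b2.asymmetry_dim2[OF two nd2 d(2)] fs.scale_one neg unfolding scal2_def cyc2_def \<beta>_def by metis
  have ss: thesis if s1: "scal1 \<epsilon>" and s2: "scal2 \<delta>" for \<epsilon> \<delta>
  proof (rule scalar[of "\<epsilon> * \<delta>"])
    show "\<epsilon> * \<delta> = 1 \<or> \<epsilon> * \<delta> = -1" using s1 s2 by (auto simp: scal1_def scal2_def)
    fix x assume "x \<in> V"
    have lA: "linear_map s V s V A" unfolding A_def by (rule v.asymmetry_linear[OF nd])
    have ls: "linear_map s V s V (\<lambda>x. s (\<epsilon> * \<delta>) x)"
      by (auto simp: linear_map_def v.scale_right_distrib mult_ac)
    show "A x = s (\<epsilon> * \<delta>) x"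
    proof (rule linear_map_eq_on_basis[OF v.vector_space_axioms basis[OF xs ys] v.vector_space_axioms lA ls _ \<open>x \<in> V\<close>])
      fix v assume "v \<in> set (map h (tensor_list xs ys))"
      then obtain x' y' where v: "v = h (tensor x' y')" "x' \<in> set xs" "y' \<in> set ys" by auto
      have m: "x' \<in> V1" "y' \<in> V2"
        using v fs.ordered_basis_subset[OF xs] fs.ordered_basis_subset[OF ys] by auto
      have t: "tensor x' y' \<in> ?T" by (rule tensor_in[OF m])
      have "A v = h (tensor (fscale \<epsilon> x') (fscale \<delta> y'))"
        using At[OF m] s1 s2 m by (simp add: v(1) scal1_def scal2_def)
      also have "tensor (fscale \<epsilon> x') (fscale \<delta> y') = fscale (\<epsilon> * \<delta>) (tensor x' y')"
        by (simp add: tensor_scale_left tensor_scale_right)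
      finally show "A v = s (\<epsilon> * \<delta>) v" using hl(2)[OF t t] by (simp add: v(1))
    qed
  qed
  have sc: thesis if s1: "scal1 \<epsilon>" and s2: "cyc2 y k" for \<epsilon> y k
  proof (rule half_scalar[of \<epsilon> k "h (tensor x0 y)" "h (tensor x0 (\<beta> y))" "h (tensor x1 y)" "h (tensor x1 (\<beta> y))"])
    have y: "y \<in> V2" and yb: "ordered_basis fscale V2 [y, \<beta> y]" and yy: "\<beta> (\<beta> y) = fscale k (\<beta> y) - y"
      using s2 by (auto simp: cyc2_def)
    have ty: "\<beta> y \<in> V2" using b2.asymmetry(1)[OF nd2 y] by (simp add: \<beta>_def)
    show "\<epsilon> = 1 \<or> \<epsilon> = -1" "k \<noteq> 2" using s1 s2 by (auto simp: scal1_def cyc2_def)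
    show "ordered_basis s V [h (tensor x0 y), h (tensor x0 (\<beta> y)), h (tensor x1 y), h (tensor x1 (\<beta> y))]"
      using basis[OF xs yb] by (simp add: x)
    have *: "scalar_action s A \<epsilon> k (h (tensor x y)) (h (tensor x (\<beta> y)))" if xV: "x \<in> V1" for x
    proof -
      note t = tensor_in[OF xV y] tensor_in[OF xV ty]
      have ax: "\<alpha> x = fscale \<epsilon> x" using s1 xV by (simp add: scal1_def)
      have 1: "A (h (tensor x y)) = s \<epsilon> (h (tensor x (\<beta> y)))"
        using At[OF xV y] hl(2)[OF t(2) t(2)] by (simp add: ax tensor_scale_left)
      have "tensor (fscale \<epsilon> x) (fscale k (\<beta> y) - y)
          = fscale \<epsilon> (fscale k (tensor x (\<beta> y)) - tensor x y)"
        by (simp add: tensor_scale_left tensor_diff_right tensor_scale_right fs.scale_right_diff_distrib mult_ac)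
      then have "A (h (tensor x (\<beta> y))) = h (fscale \<epsilon> (fscale k (tensor x (\<beta> y)) - tensor x y))"
        using At[OF xV ty] by (simp only: ax yy)
      also have "\<dots> = s \<epsilon> (s k (h (tensor x (\<beta> y))) - h (tensor x y))"
        by (simp only: hl(2)[OF _ t(1)] hd t t.V_closed)
      finally show ?thesis using 1 by (simp add: scalar_action_def)
    qed
    show "scalar_action s A \<epsilon> k (h (tensor x0 y)) (h (tensor x0 (\<beta> y)))"
      "scalar_action s A \<epsilon> k (h (tensor x1 y)) (h (tensor x1 (\<beta> y)))"
      using *[OF xin(1)] *[OF xin(2)] .
  qed
  have cs: thesis if s1: "cyc1 x k" and s2: "scal2 \<epsilon>" for \<epsilon> x k
  proof (rule half_scalar[of \<epsilon> k "h (tensor x y0)" "h (tensor (\<alpha> x) y0)" "h (tensor x y1)" "h (tensor (\<alpha> x) y1)"])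
    have x: "x \<in> V1" and xb: "ordered_basis fscale V1 [x, \<alpha> x]" and xx: "\<alpha> (\<alpha> x) = fscale k (\<alpha> x) - x"
      using s1 by (auto simp: cyc1_def)
    have ax: "\<alpha> x \<in> V1" using b1.asymmetry(1)[OF nd1 x] by (simp add: \<alpha>_def)
    show "\<epsilon> = 1 \<or> \<epsilon> = -1" "k \<noteq> 2" using s1 s2 by (auto simp: scal2_def cyc1_def)
    have "ordered_basis s V [h (tensor x y0), h (tensor x y1), h (tensor (\<alpha> x) y0), h (tensor (\<alpha> x) y1)]"
      using basis[OF xb ys] by (simp add: y)
    \<comment> \<open>The two middle vectors are interchanged so that each cyclic pair is
      adjacent.\<close>
    then show "ordered_basis s V [h (tensor x y0), h (tensor (\<alpha> x) y0), h (tensor x y1), h (tensor (\<alpha> x) y1)]"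
      unfolding ordered_basis_def by (auto simp: insert_commute)
    have *: "scalar_action s A \<epsilon> k (h (tensor x y)) (h (tensor (\<alpha> x) y))" if yV: "y \<in> V2" for y
    proof -
      note t = tensor_in[OF x yV] tensor_in[OF ax yV]
      have ay: "\<beta> y = fscale \<epsilon> y" using s2 yV by (simp add: scal2_def)
      have 1: "A (h (tensor x y)) = s \<epsilon> (h (tensor (\<alpha> x) y))"
        using At[OF x yV] hl(2)[OF t(2) t(2)] by (simp add: ay tensor_scale_right)
      have "tensor (fscale k (\<alpha> x) - x) (fscale \<epsilon> y)
          = fscale \<epsilon> (fscale k (tensor (\<alpha> x) y) - tensor x y)"
        by (simp add: tensor_scale_left tensor_diff_left tensor_scale_right fs.scale_right_diff_distrib mult_ac)
      then have "A (h (tensor (\<alpha> x) y)) = h (fscale \<epsilon> (fscale k (tensor (\<alpha> x) y) - tensor x y))"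
        using At[OF ax yV] by (simp only: ay xx)
      also have "\<dots> = s \<epsilon> (s k (h (tensor (\<alpha> x) y)) - h (tensor x y))"
        by (simp only: hl(2)[OF _ t(1)] hd t t.V_closed)
      finally show ?thesis using 1 by (simp add: scalar_action_def)
    qed
    show "scalar_action s A \<epsilon> k (h (tensor x y0)) (h (tensor (\<alpha> x) y0))"
      "scalar_action s A \<epsilon> k (h (tensor x y1)) (h (tensor (\<alpha> x) y1))"
      using *[OF yin(1)] *[OF yin(2)] .
  qed
  have cc: thesis if s1: "cyc1 x k" and s2: "cyc2 y l" for x k y l
  proof -
    have x: "x \<in> V1" and xb: "ordered_basis fscale V1 [x, \<alpha> x]" and xx: "\<alpha> (\<alpha> x) = fscale k (\<alpha> x) - x"
      using s1 by (auto simp: cyc1_def)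
    have y: "y \<in> V2" and yb: "ordered_basis fscale V2 [y, \<beta> y]" and yy: "\<beta> (\<beta> y) = fscale l (\<beta> y) - y"
      using s2 by (auto simp: cyc2_def)
    have ax: "\<alpha> x \<in> V1" using b1.asymmetry(1)[OF nd1 x] by (simp add: \<alpha>_def)
    have ty: "\<beta> y \<in> V2" using b2.asymmetry(1)[OF nd2 y] by (simp add: \<beta>_def)
    let ?t = "[tensor x y, tensor x (\<beta> y), tensor (\<alpha> x) y, tensor (\<alpha> x) (\<beta> y)]"
    note t = tensor_in[OF x y] tensor_in[OF x ty] tensor_in[OF ax y] tensor_in[OF ax ty]
    have es: "ordered_basis s V [h (tensor x y), h (tensor x (\<beta> y)), h (tensor (\<alpha> x) y), h (tensor (\<alpha> x) (\<beta> y))]"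
      using basis[OF xb yb] by simp
    have "tensor_action fscale (asymmetry fscale ?T ?b) k l
        (tensor x y) (tensor x (\<beta> y)) (tensor (\<alpha> x) y) (tensor (\<alpha> x) (\<beta> y))"
      using tensor_action_tensor[OF b1 b2 nd1 nd2 ndT x _ y, folded \<alpha>_def \<beta>_def, OF xx yy] .
    then have act: "tensor_action s A k l
        (h (tensor x y)) (h (tensor x (\<beta> y))) (h (tensor (\<alpha> x) y)) (h (tensor (\<alpha> x) (\<beta> y)))"
      unfolding tensor_action_def A_def hA[OF t(1)] hA[OF t(2)] hA[OF t(3)] hA[OF t(4)]
      by (simp only: hl(1) hl(2)[OF _ t(1)] hd t t.V_closed)
    \<comment> \<open>If both traces were generic, the tensor product of the model planes
      \<open>b_form k\<close> and \<open>b_form l\<close> would have a conjugate asymmetry.\<close>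
    have "\<not> generic_trace k \<or> \<not> generic_trace l"
      using generic_decomposable_asymmetryI[OF V nd _ _ es] act ng unfolding A_def by blast
    then show thesis
      using cyclic[OF _ _ es act] s1 s2 by (simp add: cyc1_def cyc2_def)
  qed
  show thesis using c1 c2 ss sc cs cc by metis
qed

section \<open>Decompositions for a prescribed asymmetry\<close>

locale asymmetric_space = bilinear_space s V b
  for s :: "'a::field \<Rightarrow> 'v::ab_group_add \<Rightarrow> 'v" and V b +
  fixes A :: "'v \<Rightarrow> 'v"
  assumes nd: "nondegenerate V b" and dim: "dim V = 4" and two: "(2::'a) \<noteq> 0"
    and A_def: "A = asymmetry s V b"
begin

lemma A_closed [simp]: "x \<in> V \<Longrightarrow> A x \<in> V"
  and A_add: "x \<in> V \<Longrightarrow> y \<in> V \<Longrightarrow> A (x + y) = A x + A y"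
  and A_scale: "x \<in> V \<Longrightarrow> A (s c x) = s c (A x)"
  using asymmetry[OF nd] by (simp_all add: A_def)

text \<open>Oriented so as to remove \<open>A\<close> from the right argument. Where explicit values
  of \<open>A\<close> are to be inserted there instead, the rule is disabled.\<close>

lemma b_A [simp]: "x \<in> V \<Longrightarrow> y \<in> V \<Longrightarrow> b x (A y) = b y x"
  using asymmetry(2)[OF nd, of y x] by (simp add: A_def)

lemma A_diff: "x \<in> V \<Longrightarrow> y \<in> V \<Longrightarrow> A (x - y) = A x - A y"
  using A_add[of "x - y" y] by (simp add: eq_diff_eq)

lemmas A_lin = A_add A_scale A_diff

lemma vec_eqI: "x \<in> V \<Longrightarrow> y \<in> V \<Longrightarrow> (\<And>z. z \<in> V \<Longrightarrow> b z x = b z y) \<Longrightarrow> x = y"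
  using nondegenerate_eqI[OF nd] .

section \<open>Orthogonality and bases in dimension four\<close>

text \<open>Fewer than four linear conditions on four coordinates have a nontrivial solution.
  Padding with zero rows makes the coefficient matrix square, so a vanishing determinant provides
  it.\<close>

lemma exists_orthogonal:
  assumes "set xs \<subseteq> V" "length xs < 4"
  obtains z where "z \<in> V" "z \<noteq> 0" "\<And>x. x \<in> set xs \<Longrightarrow> b x z = 0"
proof -
  obtain vs where vs: "ordered_basis s V vs" by (rule obtain_ordered_basis)
  have len: "length vs = 4" using ordered_basis_length[OF vs] dim by simp
  have sub: "set vs \<subseteq> V" using ordered_basis_subset[OF vs] .
  define M where "M = mat 4 4 (\<lambda>(i, j). if i < length xs then b (xs ! i) (vs ! j) else 0)"
  have M: "M \<in> carrier_mat 4 4" by (simp add: M_def)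
  \<comment> \<open>The last row, of index 3, is padding because \<open>length xs < 4\<close>; so
    this unit vector lies in the left kernel of \<open>M\<close>.\<close>
  have "transpose_mat M *\<^sub>v unit_vec 4 3 = 0\<^sub>v 4"
  proof (rule eq_vecI)
    fix i :: nat assume "i < dim_vec (0\<^sub>v 4 :: 'a vec)"
    then have "i < 4" by simp
    then show "(transpose_mat M *\<^sub>v unit_vec 4 3) $ i = (0\<^sub>v 4 :: 'a vec) $ i"
      using assms(2) by (simp add: M_def)
  qed (simp add: M_def)
  moreover have "unit_vec 4 3 \<noteq> (0\<^sub>v 4 :: 'a vec)"
  proof
    assume "unit_vec 4 3 = (0\<^sub>v 4 :: 'a vec)"
    then have "unit_vec 4 3 $ 3 = (0\<^sub>v 4 :: 'a vec) $ 3" by (rule arg_cong)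
    then show False by simp
  qed
  ultimately have "det (transpose_mat M) = 0"
    using det_0_iff_vec_prod_zero_field[of "transpose_mat M" 4] M unit_vec_carrier[of 4 3]
    by (metis transpose_carrier_mat)
  then have "det M = 0" using det_transpose[OF M] by simp
  then obtain v where v: "v \<in> carrier_vec 4" "v \<noteq> 0\<^sub>v 4" "M *\<^sub>v v = 0\<^sub>v 4"
    using det_0_iff_vec_prod_zero_field[OF M] by auto
  define z where "z = (\<Sum>j<length vs. s (v $ j) (vs ! j))"
  show ?thesis
  proof
    show "z \<in> V" unfolding z_def using sub by (rule comb_closed)
    show "z \<noteq> 0"
    proof
      assume "z = 0"
      then have "v $ i = 0" if "i < 4" for i
        using ordered_basis_indep[OF vs, of "\<lambda>j. v $ j" i] that by (simp add: z_def len)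
      then have "v = 0\<^sub>v 4" using v(1) by (intro eq_vecI) auto
      then show False using v(2) by simp
    qed
    fix x assume "x \<in> set xs"
    then obtain i where i: "i < length xs" "x = xs ! i" by (auto simp: in_set_conv_nth)
    then have xV: "x \<in> V" using assms(1) by auto
    have "b x z = (\<Sum>j<4. v $ j * b x (vs ! j))"
      unfolding z_def using comb_right[OF sub xV, of "\<lambda>j. v $ j"] by (simp add: len)
    also have "\<dots> = (M *\<^sub>v v) $ i"
      using i assms(2) v(1) by (auto simp: M_def scalar_prod_def lessThan_atLeast0 mult.commute intro!: sum.cong)
    finally show "b x z = 0" using v(3) i assms(2) by simp
  qed
qed

lemma det_square:
  assumes det: "det_class s V b = square_class 1"
    and w: "w0 \<in> V" "w1 \<in> V" "w2 \<in> V" "w3 \<in> V" and nz: "det (gram_matrix b [w0, w1, w2, w3]) \<noteq> 0"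
  obtains r where "r \<noteq> 0" "det (gram_matrix b [w0, w1, w2, w3]) = r\<^sup>2"
proof -
  have "det_class s V b = square_class (det (gram_matrix b [w0, w1, w2, w3]))"
    by (rule det_class_gram[OF _ _ nz]) (use w dim in auto)
  then obtain r where "det (gram_matrix b [w0, w1, w2, w3]) = r\<^sup>2"
    using det square_class_eq_1_iff[OF nz] by (simp only:) blast
  then show ?thesis using nz that[of r] by (cases "r = 0") (simp_all only:, simp_all)
qed

lemma basis4_coords:
  assumes "ordered_basis s V [w0, w1, w2, w3]" "x \<in> V"
  obtains c0 c1 c2 c3 where "x = s c0 w0 + s c1 w1 + s c2 w2 + s c3 w3"
proof -
  obtain c where "x = (\<Sum>j<length [w0, w1, w2, w3]. s (c j) ([w0, w1, w2, w3] ! j))"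
    by (rule ordered_basis_coords[OF assms])
  then have "x = s (c 0) w0 + s (c 1) w1 + s (c 2) w2 + s (c 3) w3"
    by (simp add: lessThan_Suc add_ac numeral_2_eq_2 numeral_3_eq_3)
  then show ?thesis by (rule that)
qed

lemma basis4_indep:
  assumes "ordered_basis s V [w0, w1, w2, w3]" "s c0 w0 + s c1 w1 + s c2 w2 + s c3 w3 = 0"
  shows "c0 = 0" "c1 = 0" "c2 = 0" "c3 = 0"
proof -
  let ?c = "\<lambda>j. [c0, c1, c2, c3] ! j"
  have "(\<Sum>j<length [w0, w1, w2, w3]. s (?c j) ([w0, w1, w2, w3] ! j)) = 0"
    using assms(2) by (simp add: lessThan_Suc add_ac)
  note ind = ordered_basis_indep[OF assms(1) this]
  show "c0 = 0" "c1 = 0" "c2 = 0" "c3 = 0" using ind[of 0] ind[of 1] ind[of 2] ind[of 3] by simp_all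
qed

lemma basis4_eqI:
  assumes bas: "ordered_basis s V [w0, w1, w2, w3]" and "x \<in> V" "y \<in> V"
    "b w0 x = b w0 y" "b w1 x = b w1 y" "b w2 x = b w2 y" "b w3 x = b w3 y"
  shows "x = y"
proof (rule vec_eqI[OF assms(2,3)])
  fix z assume "z \<in> V"
  then obtain c0 c1 c2 c3 where z: "z = s c0 w0 + s c1 w1 + s c2 w2 + s c3 w3"
    by (rule basis4_coords[OF bas])
  have "w0 \<in> V" "w1 \<in> V" "w2 \<in> V" "w3 \<in> V" using ordered_basis_subset[OF bas] by auto
  then show "b z x = b z y" using assms by (simp add: z bilin)
qed

lemma polarization:
  assumes "\<And>x. x \<in> W \<Longrightarrow> b x x = 0" "W \<subseteq> V" "x \<in> W" "y \<in> W" "x + y \<in> W"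
  shows "b x y = - b y x"
proof -
  have "b (x + y) (x + y) = b x x + b x y + b y x + b y y"
    using assms(2-4) by (simp add: bilin subset_iff)
  then show ?thesis using assms by (simp add: eq_neg_iff_add_eq_0)
qed

section \<open>Scalar asymmetries\<close>

text \<open>If all vectors orthogonal to \<open>xs\<close> were isotropic, symmetry and 2 \<noteq> 0
  would make them pairwise orthogonal. A nonzero one among them would then be orthogonal to that
  space and to \<open>xs\<close>, hence to all of \<open>V\<close>.\<close>

lemma orthogonal_extension:
  assumes sym: "\<And>x y. x \<in> V \<Longrightarrow> y \<in> V \<Longrightarrow> b x y = b y x"
    and xs: "set xs \<subseteq> V" "length xs < 4" "\<And>x. x \<in> set xs \<Longrightarrow> b x x \<noteq> 0"
      "\<And>x y. x \<in> set xs \<Longrightarrow> y \<in> set xs \<Longrightarrow> x \<noteq> y \<Longrightarrow> b x y = 0"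
  obtains z where "z \<in> V" "b z z \<noteq> 0" "\<And>x. x \<in> set xs \<Longrightarrow> b x z = 0"
proof (rule ccontr)
  assume no: "\<not> thesis"
  define K where "K = {z \<in> V. \<forall>x\<in>set xs. b x z = 0}"
  have KV: "K \<subseteq> V" by (auto simp: K_def)
  have alt: "b z z = 0" if "z \<in> K" for z using no that[unfolded K_def] \<open>\<And>z. \<lbrakk>z \<in> V; b z z \<noteq> 0; \<And>x. x \<in> set xs \<Longrightarrow> b x z = 0\<rbrakk> \<Longrightarrow> thesis\<close> by blast
  have orth: "b z y = 0" if "z \<in> K" "y \<in> K" for z y
  proof -
    have "z + y \<in> K" using that xs(1) by (auto simp: K_def bilin subset_iff)
    then have "b z y = - b y z" using polarization[OF alt KV that] by simp
    then have "2 * b z y = 0" using sym[of y z] that KV by (simp add: subset_iff)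
    then show ?thesis using two by simp
  qed
  obtain z where z: "z \<in> V" "z \<noteq> 0" "\<And>x. x \<in> set xs \<Longrightarrow> b x z = 0"
    using exists_orthogonal[OF xs(1,2)] by blast
  have "b z y = 0" if y: "y \<in> V" for y
  proof -
    \<comment> \<open>The orthogonal projection of \<open>y\<close> to the span of
      \<open>xs\<close>, available because the \<open>xs\<close> are anisotropic and mutually
      orthogonal.\<close>
    let ?p = "\<Sum>x\<in>set xs. s (b x y / b x x) x"
    have p: "?p \<in> V" using xs(1) by (intro sum_closed V_closed) auto
    have "b x ?p = b x y" if x: "x \<in> set xs" for x
    proof -
      have "b x ?p = (\<Sum>x'\<in>set xs. b x (s (b x' y / b x' x') x'))"
        using xs(1) x by (intro sum_right) auto
      also have "\<dots> = (\<Sum>x'\<in>set xs. if x' = x then b x y else 0)"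
        using xs x by (intro sum.cong) (auto simp: scale_right subset_iff)
      finally show ?thesis using x by simp
    qed
    then have "y - ?p \<in> K" using y p xs(1) by (auto simp: K_def bilin subset_iff)
    then have "b z (y - ?p) = 0" using z by (intro orth) (auto simp: K_def)
    moreover have "b z ?p = 0"
    proof -
      have "b z ?p = (\<Sum>x\<in>set xs. b z (s (b x y / b x x) x))"
        using xs(1) z(1) by (intro sum_right) auto
      also have "\<dots> = 0" using xs(1) z sym[OF z(1)] by (intro sum.neutral) (auto simp: scale_right subset_iff)
      finally show ?thesis .
    qed
    ultimately show ?thesis using z(1) y p by (simp add: diff_right)
  qed
  then show False using nd z by (auto simp: nondegenerate_def)
qed

text \<open>In an orthogonal basis with values d1, d2, d3, d4 the pattern diag(1, d3/d1) \<otimes>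
  diag(d1, d2) reproduces the first three and wants d2 d3/d1 as the fourth. This differs from d4 by
  a square, because d1 d2 d3 d4 is one.\<close>

lemma decomposable_symmetric:
  assumes A1: "\<And>x. x \<in> V \<Longrightarrow> A x = x" and det: "det_class s V b = square_class 1"
  shows "decomposable s V b"
proof -
  have sym: "b x y = b y x" if "x \<in> V" "y \<in> V" for x y
    using b_A[OF that] A1[OF that(2)] by simp
  obtain x1 where x1: "x1 \<in> V" "b x1 x1 \<noteq> 0"
    by (rule orthogonal_extension[OF sym, of "[]"]) auto
  obtain x2 where x2: "x2 \<in> V" "b x2 x2 \<noteq> 0" "b x1 x2 = 0"
    by (rule orthogonal_extension[OF sym, of "[x1]"]) (use x1 in auto)
  have s12: "b x2 x1 = 0" using x1 x2 sym[of x2 x1] by simp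
  obtain x3 where x3: "x3 \<in> V" "b x3 x3 \<noteq> 0" "b x1 x3 = 0" "b x2 x3 = 0"
    by (rule orthogonal_extension[OF sym, of "[x1, x2]"]) (use x1 x2 s12 in auto)
  have s13: "b x3 x1 = 0" "b x3 x2 = 0" using x1 x2 x3 sym[of x3 x1] sym[of x3 x2] by simp_all
  obtain x4 where x4: "x4 \<in> V" "b x4 x4 \<noteq> 0" "b x1 x4 = 0" "b x2 x4 = 0" "b x3 x4 = 0"
    by (rule orthogonal_extension[OF sym, of "[x1, x2, x3]"]) (use x1 x2 x3 s12 s13 in auto)
  have s14: "b x4 x1 = 0" "b x4 x2 = 0" "b x4 x3 = 0"
    using x1 x2 x3 x4 sym[of x4 x1] sym[of x4 x2] sym[of x4 x3] by simp_all
  note orth = x2(3) x3(3,4) x4(3-5) s12 s13 s14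
  have gram: "det (gram_matrix b [x1, x2, x3, x4]) = b x1 x1 * b x2 x2 * b x3 x3 * b x4 x4"
    by (simp add: det_gram_4 orth)
  obtain r where r: "r \<noteq> 0" "b x1 x1 * b x2 x2 * b x3 x3 * b x4 x4 = r\<^sup>2"
    by (rule det_square[OF det x1(1) x2(1) x3(1) x4(1)]) (use gram x1 x2 x3 x4 in auto)
  \<comment> \<open>The factor by which \<open>x4\<close> must be scaled to take the required fourth
    value.\<close>
  let ?\<rho> = "b x2 x2 * b x3 x3 / r"
  have "?\<rho> * (?\<rho> * b x4 x4) * (b x1 x1 * r\<^sup>2)
      = b x2 x2 * b x3 x3 * (b x1 x1 * b x2 x2 * b x3 x3 * b x4 x4)"
    using r(1) by (simp add: field_simps power2_eq_square)
  then have \<rho>: "?\<rho> * (?\<rho> * b x4 x4) = b x3 x3 / b x1 x1 * b x2 x2"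
    using r x1(2) by (simp add: field_simps power2_eq_square)
  show ?thesis
    by (rule decomposableI[OF dim x1(1) x2(1) x3(1) V_closed(5)[OF x4(1), of ?\<rho>],
          where ?p00.0 = 1 and ?p01.0 = 0 and ?p10.0 = 0 and ?p11.0 = "b x3 x3 / b x1 x1"
            and ?q00.0 = "b x1 x1" and ?q01.0 = 0 and ?q10.0 = 0 and ?q11.0 = "b x2 x2"])
      (use x1(1,2) x2(1,2) x3(1,2) x4(1,2) \<rho> in \<open>simp_all add: bilin orth\<close>)
qed

text \<open>A symplectic basis with dual pairs \<open>x\<close>, \<open>y\<close> and
  \<open>z\<close>, \<open>w\<close>, listed as \<open>x\<close>, \<open>z\<close>,
  \<open>y\<close>, \<open>w\<close>, has Gram matrix ((0, 1), (-1, 0)) \<otimes> 1.\<close>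

lemma decomposable_alternating:
  assumes A1: "\<And>x. x \<in> V \<Longrightarrow> A x = - x"
  shows "decomposable s V b"
proof -
  have skew: "b y x = - b x y" if "x \<in> V" "y \<in> V" for x y
    using b_A[OF that] A1[OF that(2)] that by (simp add: neg_right)
  have alt: "b x x = 0" if "x \<in> V" for x
  proof -
    have "2 * b x x = 0" using skew[OF that that] by (simp add: eq_neg_iff_add_eq_0)
    then show ?thesis using two by simp
  qed
  obtain x where x: "x \<in> V" "x \<noteq> 0" by (rule exists_orthogonal[of "[]"]) auto
  then obtain y' where y': "y' \<in> V" "b x y' \<noteq> 0" using nd by (auto simp: nondegenerate_def)
  define y where "y = s (1 / b x y') y'"
  have y: "y \<in> V" "b x y = 1" using y' x by (auto simp: y_def scale_right)
  have yx: "b y x = -1" using skew[OF x(1) y(1)] y(2) by simp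
  obtain z where z: "z \<in> V" "z \<noteq> 0" "b x z = 0" "b y z = 0"
    by (rule exists_orthogonal[of "[x, y]"]) (use x y in auto)
  then obtain w' where w': "w' \<in> V" "b z w' \<noteq> 0" using nd by (auto simp: nondegenerate_def)
  define w'' where "w'' = s (1 / b z w') w'"
  have w'': "w'' \<in> V" "b z w'' = 1" using w' z by (auto simp: w''_def scale_right)
  \<comment> \<open>Removes the components of \<open>w''\<close> in the plane of \<open>x\<close>
    and \<open>y\<close>; the plus sign comes from \<open>b y x = -1\<close>.\<close>
  define w where "w = w'' - s (b x w'') y + s (b y w'') x"
  have zs: "b z x = 0" "b z y = 0" using skew[OF x(1) z(1)] skew[OF y(1) z(1)] z by simp_all
  have w: "w \<in> V" "b x w = 0" "b y w = 0" "b z w = 1"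
    using w'' x y z by (auto simp: w_def bilin zs yx alt)
  have ws: "b w x = 0" "b w y = 0" "b w z = -1"
    using skew[OF x(1) w(1)] skew[OF y(1) w(1)] skew[OF z(1) w(1)] w by simp_all
  show ?thesis
    by (rule decomposableI[OF dim x(1) z(1) y(1) w(1),
          where ?p00.0 = 0 and ?p01.0 = 1 and ?p10.0 = "-1" and ?p11.0 = 0
            and ?q00.0 = 1 and ?q01.0 = 0 and ?q10.0 = 0 and ?q11.0 = 1])
      (simp_all add: alt x(1) y yx z zs w ws) 
qed

text \<open>
  For \<open>d = b x x \<noteq> 0\<close> the plane spanned by \<open>x\<close> and \<open>A x\<close> has Gram matrix \<open>d\<close> times
  \<open>((1, 1), (c - 1, 1))\<close>, and a vector \<open>w\<close> with \<open>b w w \<noteq> 0\<close> in its orthogonal space \<open>W\<close> provides a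
  second such plane. If there is no such \<open>w\<close>, then \<open>A\<close> is \<open>-1\<close> on \<open>W\<close>, against the basis hypothesis.
\<close>

lemma decomposable_quadratic:
  assumes quad: "\<And>x. x \<in> V \<Longrightarrow> A (A x) = s c (A x) - x" and c2: "c \<noteq> 2"
    and bas: "ordered_basis s V [e, A e, e', A e']"
  shows "decomposable s V b"
proof -
  have e: "e \<in> V" "e' \<in> V" using ordered_basis_subset[OF bas] by auto
  have indep: "p = 0 \<and> q = 0" if "s p (e + A e) + s q (e' + A e') = 0" for p q
  proof -
    have "s p e + s p (A e) + s q e' + s q (A e') = 0"
      using that by (simp add: scale_right_distrib add_ac)
    from basis4_indep[OF bas this] show ?thesis by simp
  qed
  have red: "b (A x) y = c * b x y - b y x" if "x \<in> V" "y \<in> V" for x y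
  proof -
    have "b (A x) y = b y (A (A x))" using that b_A[of y "A x"] by simp
    also have "\<dots> = c * b x y - b y x" using that by (simp add: quad bilin)
    finally show ?thesis .
  qed
  have "\<exists>x\<in>V. b x x \<noteq> 0"
  proof (rule ccontr)
    assume "\<not> (\<exists>x\<in>V. b x x \<noteq> 0)"
    then have alt: "b x x = 0" if "x \<in> V" for x using that by blast
    have "A e = - e"
    proof (rule vec_eqI)
      fix z assume z: "z \<in> V"
      have "b e z = - b z e" using e z by (intro polarization[OF alt, of V]) auto
      then show "b z (A e) = b z (- e)" using e z by (simp add: neg_right)
    qed (use e in auto)
    then have "s 1 (e + A e) + s 0 (e' + A e') = 0" by simp
    from indep[OF this] show False by simp
  qed
  then obtain x where x: "x \<in> V" "b x x \<noteq> 0" by blast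
  define d where "d = b x x"
  have d0: "d \<noteq> 0" using x by (simp add: d_def)
  have dx: "b (A x) x = c * d - d" using red[OF x(1) x(1)] by (simp add: d_def)
  define W where "W = {w \<in> V. b x w = 0 \<and> b (A x) w = 0}"
  have WV: "W \<subseteq> V" by (auto simp: W_def)
  \<comment> \<open>Coordinates of the component of \<open>y\<close> in the plane of
    \<open>x\<close> and \<open>A x\<close>, solved from the values \<open>b x y\<close> and
    \<open>b (A x) y\<close>; the divisor is nonzero because \<open>c \<noteq> 2\<close>.\<close>
  define \<alpha> \<beta> where "\<alpha> y = (b (A x) y - b x y) / ((c - 2) * d)" and "\<beta> y = b x y / d - \<alpha> y" for y
  define pr where "pr y = y - s (\<alpha> y) x - s (\<beta> y) (A x)" for y
  have pr: "pr y \<in> W" if y: "y \<in> V" for y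
  proof -
    have **: "b x y = (\<alpha> y + \<beta> y) * d" using d0 by (simp add: \<beta>_def)
    have "b (A x) y - b x y = \<alpha> y * ((c - 2) * d)" using c2 d0 by (simp add: \<alpha>_def)
    then have *: "b (A x) y = \<alpha> y * ((c - 2) * d) + (\<alpha> y + \<beta> y) * d" using ** by (simp add: diff_eq_eq)
    have "b x (pr y) = b x y - \<alpha> y * d - \<beta> y * d" using x y by (simp add: pr_def bilin d_def)
    also have "\<dots> = 0" unfolding ** by (simp add: algebra_simps)
    finally have 1: "b x (pr y) = 0" .
    have "b (A x) (pr y) = b (A x) y - \<alpha> y * (c * d - d) - \<beta> y * d"
      using x y by (simp add: pr_def bilin dx d_def[symmetric])
    also have "\<dots> = 0" using * ** by (simp add: algebra_simps)
    finally show ?thesis using 1 x y by (simp add: W_def) (simp add: pr_def)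
  qed
  \<comment> \<open>\<open>W\<close> is defined by orthogonality on one side; the relation
    \<open>red\<close> yields the other side.\<close>
  have W: "b x w = 0" "b (A x) w = 0" "b w x = 0" "b w (A x) = 0" "b (A w) x = 0" "w \<in> V" if "w \<in> W" for w
  proof -
    have w: "w \<in> V" "b x w = 0" "b (A x) w = 0" using that by (auto simp: W_def)
    then show "b x w = 0" "b (A x) w = 0" "w \<in> V" by auto
    show wx: "b w x = 0" using red[OF x(1) w(1)] w by simp
    then show "b w (A x) = 0" using x w by simp
    show "b (A w) x = 0" using red[OF w(1) x(1)] w wx by simp
  qed
  show ?thesis
  proof (cases "\<exists>w\<in>W. b w w \<noteq> 0")
    case True
    then obtain w where w: "w \<in> W" "b w w \<noteq> 0" by blast
    note W' = W[OF w(1)]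
    show ?thesis
      by (rule decomposableI[OF dim x(1) A_closed[OF x(1)] W'(6) A_closed[OF W'(6)],
            where ?p00.0 = d and ?p01.0 = 0 and ?p10.0 = 0 and ?p11.0 = "b w w"
              and ?q00.0 = 1 and ?q01.0 = 1 and ?q10.0 = "c - 1" and ?q11.0 = 1])
        (use x(1) W' d0 c2 w(2) in \<open>simp_all add: d_def[symmetric] red algebra_simps\<close>)
  next
    case False
    have AW: "A w = - w" if w: "w \<in> W" for w
    proof (rule vec_eqI)
      fix y assume y: "y \<in> V"
      have py: "pr y \<in> V" "y = s (\<alpha> y) x + s (\<beta> y) (A x) + pr y"
        using pr[OF y] WV by (auto simp: pr_def)
      have "w + pr y \<in> W" using w pr[OF y] x by (simp add: W_def bilin)
      then have "b w (pr y) = - b (pr y) w"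
        using False w pr[OF y] WV by (intro polarization[of W]) auto
      then have "b w y = - b y w" using W[OF w] py(1) x(1) by (subst (1 2) py(2)) (simp add: bilin)
      then show "b y (A w) = b y (- w)" using W(6)[OF w] y by (simp add: neg_right)
    qed (use W(6)[OF w] in auto)
    have Apr: "A y + y = s (\<alpha> y - \<beta> y) x + s (\<alpha> y + \<beta> y + \<beta> y * c) (A x)" if y: "y \<in> V" for y
    proof -
      have "pr y \<in> V" "y = s (\<alpha> y) x + s (\<beta> y) (A x) + pr y"
        using pr[OF y] WV by (auto simp: pr_def)
      then have "A y = s (\<alpha> y) (A x) + s (\<beta> y) (s c (A x) - x) + A (pr y)"
        using x(1) quad by (metis A_add A_closed A_scale V_closed(2) V_closed(5))
      then show ?thesis
        unfolding AW[OF pr[OF y]] by (simp add: pr_def algebra_simps)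
    qed
    \<comment> \<open>On \<open>W\<close> the quadratic relation and \<open>A w = - w\<close> give
      (c + 2) w = 0. So either \<open>W\<close> is zero and \<open>V\<close> is too small, or c = -2
      and by \<open>Apr\<close> the image of \<open>A + 1\<close> is at most a line, against
      \<open>indep\<close>.\<close>
    show ?thesis
    proof (cases "c = -2")
      case False
      have "V \<subseteq> span {x, A x}"
      proof
        fix y assume y: "y \<in> V"
        have p: "pr y \<in> V" using pr[OF y] WV by blast
        have "pr y = s c (- pr y) - pr y" using quad[OF p] p AW[OF pr[OF y]]
          by (metis A_diff AW A_scale V_closed(1) diff_0 minus_diff_eq pr y add.inverse_inverse)
        then have "s c (pr y) + pr y + pr y = 0" by (simp add: algebra_simps eq_neg_iff_add_eq_0)
        then have "s (c + 1 + 1) (pr y) = 0" by (simp only: scale_left_distrib scale_one)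
        moreover have "c + 1 + 1 \<noteq> 0" using False by (simp add: eq_neg_iff_add_eq_0 add.assoc)
        ultimately have "pr y = 0" by simp
        then have "y = s (\<alpha> y) x + s (\<beta> y) (A x)" by (simp add: pr_def diff_diff_eq)
        then show "y \<in> span {x, A x}" by (metis span_add span_scale span_base insertI1 insertI2)
      qed
      then have "dim V \<le> card {x, A x}" by (rule dim_le_card) simp
      also have "\<dots> \<le> 2" by (simp add: card_insert_if)
      finally show ?thesis using dim by simp
    next
      case True
      define n where "n = x + A x"
      have "A y + y = s (\<alpha> y - \<beta> y) n" if "y \<in> V" for y
        unfolding Apr[OF that] n_def True by (simp add: scale_right_distrib)
      then obtain p q where pq: "A e + e = s p n" "A e' + e' = s q n" using e by metis
      have "s q (e + A e) + s (- p) (e' + A e') = 0"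
        using pq by (simp add: add.commute mult.commute)
      from indep[OF this] have "p = 0" by simp
      then have "s 1 (e + A e) + s 0 (e' + A e') = 0" using pq by (simp add: add.commute)
      from indep[OF this] show ?thesis by simp
    qed
  qed
qed

text \<open>
  The image of \<open>A - 1\<close> is totally isotropic, and shifting \<open>x\<close> and \<open>y\<close> along it makes both isotropic
  and \<open>b x y\<close> arbitrary.
\<close>

lemma decomposable_unipotent:
  assumes quad: "\<And>x. x \<in> V \<Longrightarrow> A (A x) = s 2 (A x) - x"
    and bas: "ordered_basis s V [x, A x, y, A y]"
  shows "decomposable s V b"
proof -
  have x: "x \<in> V" and y: "y \<in> V" using ordered_basis_subset[OF bas] by auto
  have red: "b (A x) y = 2 * b x y - b y x" if "x \<in> V" "y \<in> V" for x y
  proof -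
    have "b (A x) y = b y (A (A x))" using that b_A[of y "A x"] by simp
    also have "\<dots> = 2 * b x y - b y x" using that by (simp add: quad bilin)
    finally show ?thesis .
  qed
  \<comment> \<open>\<delta> is \<open>b x (A y - y)\<close>, the pairing of \<open>x\<close> with
    an element of the image of \<open>A - 1\<close>.\<close>
  define \<delta> where "\<delta> = b y x - b x y"
  have yx: "b y x = b x y + \<delta>" by (simp add: \<delta>_def)
  have "\<delta> \<noteq> 0"
  proof
    assume "\<delta> = 0"
    then have "A x = x"
      by (intro basis4_eqI[OF bas]) (use x y yx in \<open>simp_all add: red\<close>)
    then have "s 1 x + s (-1) (A x) + s 0 y + s 0 (A y) = 0" by simp
    from basis4_indep(1)[OF bas this] show False by simp
  qed
  \<comment> \<open>\<open>t\<close> and \<open>v\<close> make the shifted vectors isotropic;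
    \<open>u\<close> gives their product the value \<open>- \<delta> / 2\<close> in one order and
    \<open>\<delta> / 2\<close> in the other.\<close>
  define t u v where "t = - b x x / (2 * \<delta>)" and "u = (b x y + \<delta> / 2) / \<delta>" and "v = b y y / (2 * \<delta>)"
  have tuv: "b x x = - (2 * \<delta> * t)" "b x y = \<delta> * u - \<delta> / 2" "b y y = 2 * \<delta> * v"
    using \<open>\<delta> \<noteq> 0\<close> two by (simp_all add: t_def u_def v_def)
  define h where "h = \<delta> / 2"
  have dh: "\<delta> = 2 * h" using two by (simp add: h_def)
  let ?x = "x + s t (A y - y) + s u (A x - x)" and ?y = "y + s v (A x - x)"
  have xy: "b x y = 2 * h * u - h" using tuv(2) two unfolding h_def[symmetric] dh by simp
  have xV: "?x \<in> V" and yV: "?y \<in> V" using x y by simp_all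
  have m: "A x - x \<in> V" "A y - y \<in> V" using x y by simp_all
  have four: "(4::'a) \<noteq> 0" using two by (metis mult_eq_0_iff mult_2 numeral_Bit0)
  note gr = bilin x y red tuv(1,3) yx xy dh
  \<comment> \<open>The first factor has asymmetry -1. The second is a multiple of the plane of
    trace -2, in a basis \<open>x\<close>, \<open>- (x + \<alpha> x)\<close> with \<alpha> its
    asymmetry.\<close>
  show ?thesis
    by (rule decomposableI[OF dim xV m(1) yV m(2),
          where ?p00.0 = 0 and ?p01.0 = 1 and ?p10.0 = "-1" and ?p11.0 = 0
            and ?q00.0 = "- h" and ?q01.0 = "2 * h" and ?q10.0 = "- (2 * h)" and ?q11.0 = 0])
      (use \<open>\<delta> \<noteq> 0\<close> dh four in \<open>simp_all add: gr algebra_simps\<close>)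
qed

text \<open>Both cyclic pairs satisfy the recursion with c = \<epsilon> a, so it holds on all of
  \<open>V\<close>, and \<open>f\<close>, \<open>f'\<close> can be replaced by the images of
  \<open>e\<close>, \<open>e'\<close>. The value c = 2, reached for \<epsilon> = -1 and a = -2, is
  the unipotent case.\<close>

lemma decomposable_half_scalar:
  assumes \<epsilon>: "\<epsilon> = 1 \<or> \<epsilon> = -1" and bas: "ordered_basis s V [e, f, e', f']"
    and act: "scalar_action s A \<epsilon> a e f" "scalar_action s A \<epsilon> a e' f'"
  shows "decomposable s V b"
proof -
  have in4: "e \<in> V" "f \<in> V" "e' \<in> V" "f' \<in> V" using ordered_basis_subset[OF bas] by auto
  have \<epsilon>2: "\<epsilon> * \<epsilon> = 1" using \<epsilon> by auto
  have A4: "A e = s \<epsilon> f" "A f = s \<epsilon> (s a f - e)" "A e' = s \<epsilon> f'" "A f' = s \<epsilon> (s a f' - e')"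
    using act by (auto simp: scalar_action_def)
  have lA: "linear_map s V s V A" using asymmetry_linear[OF nd] by (simp add: A_def)
  define c where "c = \<epsilon> * a"
  have quad: "A (A x) = s c (A x) - x" if "x \<in> V" for x
  proof (rule linear_map_eq_on_basis[OF vector_space_axioms bas vector_space_axioms _ _ _ that])
    show "linear_map s V s V (\<lambda>x. A (A x))" by (rule linear_map_comp[OF lA lA])
    show "linear_map s V s V (\<lambda>x. s c (A x) - x)"
      by (auto simp: linear_map_def A_lin algebra_simps)
    fix v assume "v \<in> set [e, f, e', f']"
    then consider "v = e" | "v = f" | "v = e'" | "v = f'" by auto
    then show "A (A v) = s c (A v) - v"
      by cases (use in4 \<epsilon> in \<open>auto simp: A4 A_lin c_def algebra_simps\<close>)
  qed
  obtain S where S: "finite S" "span S = V" using finite_dim by blast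
  have "ordered_basis s V [e, A e, e', A e']"
  proof (rule ordered_basisI[OF S])
    fix k i assume *: "(\<Sum>j<length [e, A e, e', A e']. s (k j) ([e, A e, e', A e'] ! j)) = 0"
      "i < length [e, A e, e', A e']"
    then have "s (k 0) e + s (k 1 * \<epsilon>) f + s (k 2) e' + s (k 3 * \<epsilon>) f' = 0"
      by (simp add: lessThan_Suc add_ac A4 numeral_2_eq_2 numeral_3_eq_3)
    from basis4_indep[OF bas this] show "k i = 0"
      using *(2) \<epsilon> by (auto simp: less_Suc_eq numeral_2_eq_2 numeral_3_eq_3)
  qed (use in4 dim in auto)
  then show ?thesis using decomposable_quadratic[OF quad] decomposable_unipotent quad by metis
qed

section \<open>Two cyclic factors, one of them of trace -2\<close>

lemma basis4I:
  assumes "w0 \<in> V" "w1 \<in> V" "w2 \<in> V" "w3 \<in> V"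
    and "\<And>c0 c1 c2 c3. s c0 w0 + s c1 w1 + s c2 w2 + s c3 w3 = 0 \<Longrightarrow> c0 = 0 \<and> c1 = 0 \<and> c2 = 0 \<and> c3 = 0"
  shows "ordered_basis s V [w0, w1, w2, w3]"
proof -
  obtain S where S: "finite S" "span S = V" using finite_dim by blast
  show ?thesis
  proof (rule ordered_basisI[OF S])
    fix k i assume *: "(\<Sum>j<length [w0, w1, w2, w3]. s (k j) ([w0, w1, w2, w3] ! j)) = 0"
      "i < length [w0, w1, w2, w3]"
    then have "s (k 0) w0 + s (k 1) w1 + s (k 2) w2 + s (k 3) w3 = 0"
      by (simp add: lessThan_Suc add_ac numeral_2_eq_2 numeral_3_eq_3)
    from assms(5)[OF this] show "k i = 0"
      using *(2) by (auto simp: less_Suc_eq numeral_2_eq_2 numeral_3_eq_3)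
  qed (use assms dim in auto)
qed

lemma basis4_orthogonal_0:
  assumes "ordered_basis s V [w0, w1, w2, w3]" "x \<in> V" "b w0 x = 0" "b w1 x = 0" "b w2 x = 0" "b w3 x = 0"
  shows "x = 0"
  using assms ordered_basis_subset[OF assms(1)] by (intro basis4_eqI[OF assms(1)]) auto

lemma basis4_nonzero:
  assumes "ordered_basis s V [w0, w1, w2, w3]"
  shows "w0 \<noteq> 0" "w1 \<noteq> 0" "w2 \<noteq> 0" "w3 \<noteq> 0"
  using basis4_indep[OF assms, of 1 0 0 0] basis4_indep[OF assms, of 0 1 0 0]
    basis4_indep[OF assms, of 0 0 1 0] basis4_indep[OF assms, of 0 0 0 1] by auto

text \<open>
  The asymmetry determines the Gram matrix up to \<open>\<xi>\<close>, a scaling, and \<open>\<omega>\<close>, which is adjusted by moving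
  the cyclic vector \<open>z0\<close> along \<open>z3\<close>.
\<close>

lemma decomposable_minus_2_cyclic:
  assumes bas: "ordered_basis s V [e0, e1, e2, e3]"
    and act: "tensor_action s A (-2) a e0 e1 e2 e3" and a: "a \<noteq> 2" "a \<noteq> -2"
  shows "decomposable s V b"
proof -
  have e: "e0 \<in> V" "e1 \<in> V" "e2 \<in> V" "e3 \<in> V" using ordered_basis_subset[OF bas] by auto
  \<comment> \<open>With \<open>e0\<close> read as x \<otimes> y, the vectors \<open>z2\<close> and
    \<open>z3\<close> are (\<alpha> + 1) x tensored with y and \<beta> y. Since (\<alpha> + 1)^2 =
    0, \<open>A\<close> acts on them as -\<beta> in the second factor.\<close>
  define z0 z1 z2 z3 where "z0 = e0" and "z1 = e1" and "z2 = e0 + e2" and "z3 = e1 + e3"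
  have z: "z0 \<in> V" "z1 \<in> V" "z2 \<in> V" "z3 \<in> V" using e by (simp_all add: z0_def z1_def z2_def z3_def)
  have zb: "ordered_basis s V [z0, z1, z2, z3]"
  proof (rule basis4I[OF z])
    fix c0 c1 c2 c3 assume "s c0 z0 + s c1 z1 + s c2 z2 + s c3 z3 = 0"
    then have "s (c0 + c2) e0 + s (c1 + c3) e1 + s c2 e2 + s c3 e3 = 0"
      by (simp add: z0_def z1_def z2_def z3_def algebra_simps)
    from basis4_indep[OF bas this] show "c0 = 0 \<and> c1 = 0 \<and> c2 = 0 \<and> c3 = 0" by simp
  qed
  have R: "b z0 u = b u z3 - b u z1" "b z1 u = b u z0 - a * b u z1 + a * b u z3 - b u z2"
    "b z2 u = - b u z3" "b z3 u = b u z2 - a * b u z3" if u: "u \<in> V" for u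
  proof -
    have A: "A e0 = e3" "A e1 = s a e3 - e2" "A e2 = s (-2) e3 - e1"
      "A e3 = e0 - s (-2) e2 - s a e1 + s (-2 * a) e3"
      using act by (simp_all add: tensor_action_def)
    have "b z0 u = b u (A z0)" "b z1 u = b u (A z1)" "b z2 u = b u (A z2)" "b z3 u = b u (A z3)"
      using u z by simp_all
    then show "b z0 u = b u z3 - b u z1" "b z1 u = b u z0 - a * b u z1 + a * b u z3 - b u z2"
      "b z2 u = - b u z3" "b z3 u = b u z2 - a * b u z3"
      using u e by (simp_all add: z0_def z1_def z2_def z3_def A A_add bilin del: b_A) (simp_all add: algebra_simps)
  qed
  define \<xi> \<omega> where "\<xi> = b z1 z3" and "\<omega> = b z1 z1"
  have 23: "b z2 z3 = - b z2 z2" "b z3 z3 = b z2 z2" "b z3 z2 = b z2 z2 * (1 + a)"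
    using R(3)[OF z(3)] R(3)[OF z(4)] R(4)[OF z(3)] by (simp_all add: algebra_simps)
  have 20: "b z2 z0 = - b z0 z3" "b z2 z1 = - \<xi>" "b z3 z0 = b z0 z2 - a * b z0 z3"
    "b z3 z1 = b z1 z2 - a * \<xi>"
    using R(3)[OF z(1)] R(3)[OF z(2)] R(4)[OF z(1)] R(4)[OF z(2)] by (simp_all add: \<xi>_def)
  \<comment> \<open>Eliminating \<open>b z0 z3\<close> between two relations leaves this; as
    \<open>a \<noteq> -2\<close>, the plane of \<open>z2\<close> and \<open>z3\<close> is totally
    isotropic.\<close>
  have "(a + 2) * b z2 z2 = 0"
    using R(1)[OF z(4)] R(2)[OF z(3)] unfolding 23 20 \<xi>_def by (simp add: algebra_simps)
  moreover have a2: "a + 2 \<noteq> 0" using a(2) by (simp add: eq_neg_iff_add_eq_0)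
  ultimately have g22: "b z2 z2 = 0" by simp
  have g02: "b z0 z2 = \<xi>" using R(1)[OF z(3)] by (simp add: 23 20 g22)
  have g03: "b z0 z3 = a * \<xi> - b z1 z2" using R(1)[OF z(4)] by (simp add: 23 20 g22)
  have g01: "b z0 z1 = \<xi> - \<omega>" using R(1)[OF z(2)] by (simp add: \<xi>_def \<omega>_def)
  have g00: "b z0 z0 = a * \<xi> - b z1 z2 - \<xi> + \<omega>" using R(1)[OF z(1)] by (simp add: g01 g03)
  have g10: "b z1 z0 = b z0 z0 - a * (\<xi> - \<omega>) + a * (a * \<xi> - b z1 z2) - \<xi>"
    using R(2)[OF z(1)] by (simp add: g01 g03 g02)
  have "\<omega> = b z1 z0 - a * \<omega> + a * \<xi> - b z1 z2"
    using R(2)[OF z(2)] unfolding \<omega>_def[symmetric] \<xi>_def[symmetric] .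
  then have "(a + 2) * ((a - 1) * \<xi> - b z1 z2) = 0"
    unfolding g10 g00 by (simp add: algebra_simps)
  then have g12: "b z1 z2 = (a - 1) * \<xi>" using a2 by simp
  have \<xi>0: "\<xi> \<noteq> 0"
  proof
    assume "\<xi> = 0"
    then have "z2 = 0"
      by (intro basis4_orthogonal_0[OF zb]) (simp_all add: z g02 g12 g22 23)
    then show False using basis4_nonzero[OF zb] by simp
  qed
  define c where "c = \<xi> / 2"
  have \<xi>c: "\<xi> = 2 * c" using two by (simp add: c_def)
  \<comment> \<open>Moving \<open>z0\<close> by \<open>t\<close> times \<open>z3\<close> adds 2 c (2
    - a) t to its value \<omega>; the target is \<open>c\<close>.\<close>
  define t where "t = (c - \<omega>) / (\<xi> * (2 - a))"
  have \<omega>t: "\<omega> = c - t * (2 * c * (2 - a))" using \<xi>0 a by (simp add: t_def \<xi>c)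
  have c0: "c \<noteq> 0" using \<xi>0 \<xi>c by simp
  have G: "b z0 z0 = \<omega>" "b z0 z1 = 2 * c - \<omega>" "b z0 z2 = 2 * c" "b z0 z3 = 2 * c"
    "b z1 z0 = (1 + a) * \<omega> - 2 * c" "b z1 z1 = \<omega>" "b z1 z2 = (a - 1) * (2 * c)" "b z1 z3 = 2 * c"
    "b z2 z0 = - (2 * c)" "b z2 z1 = - (2 * c)" "b z2 z2 = 0" "b z2 z3 = 0"
    "b z3 z0 = 2 * c - a * (2 * c)" "b z3 z1 = - (2 * c)" "b z3 z2 = 0" "b z3 z3 = 0"
    using \<xi>_def \<omega>_def g10 by (simp_all add: g00 g01 g02 g03 g12 g22 23 20 \<xi>c algebra_simps)
  \<comment> \<open>\<open>?w1\<close> is the image of \<open>?w0\<close> under 1 \<otimes> \<beta>,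
    which sends \<open>z0\<close> to \<open>z1\<close> and \<open>z3\<close> to a z3 - z2; hence the
    shift respects the Kronecker pattern.\<close>
  let ?w0 = "z0 + s t z3" and ?w1 = "z1 + s t (s a z3 - z2)"
  have w: "?w0 \<in> V" "?w1 \<in> V" using z by simp_all
  have four: "(4::'a) \<noteq> 0" using two by (metis mult_eq_0_iff mult_2 numeral_Bit0)
  have a': "2 - a \<noteq> 0" using a by simp
  \<comment> \<open>The first factor is \<open>c\<close> times the plane of trace -2 in a basis
    \<open>x\<close>, \<open>x + \<alpha> x\<close>; the second is the plane of trace
    \<open>a\<close> in its cyclic basis.\<close>
  show ?thesis
    by (rule decomposableI[OF dim w z(3,4),
          where ?p00.0 = c and ?p01.0 = "2 * c" and ?p10.0 = "- (2 * c)" and ?p11.0 = 0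
            and ?q00.0 = 1 and ?q01.0 = 1 and ?q10.0 = "a - 1" and ?q11.0 = 1])
      (use c0 four a' in \<open>simp_all add: bilin z G \<omega>t algebra_simps\<close>)
qed

text \<open>
  Here \<open>A\<close> has Jordan blocks of sizes 3 and 1, so \<open>b\<close> is an orthogonal sum of two forms, each unique
  up to scaling. The determinant hypothesis relates the two scalars up to a square, which is absorbed
  by rescaling the direction \<open>z1 - z2\<close> of the small block by \<open>\<rho>\<close>.
\<close>

lemma decomposable_minus_2_minus_2:
  assumes bas: "ordered_basis s V [e0, e1, e2, e3]"
    and act: "tensor_action s A (-2) (-2) e0 e1 e2 e3" and det: "det_class s V b = square_class 1"
  shows "decomposable s V b"
proof -
  have e: "e0 \<in> V" "e1 \<in> V" "e2 \<in> V" "e3 \<in> V" using ordered_basis_subset[OF bas] by auto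
  \<comment> \<open>With N = \<alpha> + 1 and M = \<beta> + 1, both of square zero, these are
    \<open>e0\<close> and its images under M, N and N M, while \<open>A\<close> is (1 - N) (1 -
    M).\<close>
  define z0 z1 z2 z3 where "z0 = e0" and "z1 = e0 + e1" and "z2 = e0 + e2" and "z3 = e0 + e1 + e2 + e3"
  have z: "z0 \<in> V" "z1 \<in> V" "z2 \<in> V" "z3 \<in> V" using e by (simp_all add: z0_def z1_def z2_def z3_def)
  have zb: "ordered_basis s V [z0, z1, z2, z3]"
  proof (rule basis4I[OF z])
    fix c0 c1 c2 c3 assume "s c0 z0 + s c1 z1 + s c2 z2 + s c3 z3 = 0"
    then have "s (c0 + c1 + c2 + c3) e0 + s (c1 + c3) e1 + s (c2 + c3) e2 + s c3 e3 = 0"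
      by (simp add: z0_def z1_def z2_def z3_def algebra_simps)
    from basis4_indep[OF bas this] show "c0 = 0 \<and> c1 = 0 \<and> c2 = 0 \<and> c3 = 0" by simp
  qed
  have R: "b z0 u = b u z0 - b u z1 - b u z2 + b u z3" "b z1 u = b u z1 - b u z3"
    "b z2 u = b u z2 - b u z3" "b z3 u = b u z3" if u: "u \<in> V" for u
  proof -
    have A: "A e0 = e3" "A e1 = s (-2) e3 - e2" "A e2 = s (-2) e3 - e1"
      "A e3 = e0 - s (-2) e2 - s (-2) e1 + s 4 e3"
      using act by (simp_all add: tensor_action_def)
    have "b z0 u = b u (A z0)" "b z1 u = b u (A z1)" "b z2 u = b u (A z2)" "b z3 u = b u (A z3)"
      using u z by simp_all
    then show "b z0 u = b u z0 - b u z1 - b u z2 + b u z3" "b z1 u = b u z1 - b u z3"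
      "b z2 u = b u z2 - b u z3" "b z3 u = b u z3"
      using u e by (simp_all add: z0_def z1_def z2_def z3_def A A_add bilin del: b_A)
  qed
  define m k p q where "m = b z0 z3" and "k = b z1 z2" and "p = b z0 z0" and "q = b z0 z1"
  have g33: "b z3 z3 = 0" using R(2)[OF z(4)] R(4)[OF z(2)] by simp
  have g13: "b z1 z3 = 0" "b z3 z1 = 0" using R(2)[OF z(2)] R(4)[OF z(2)] by simp_all
  have g23: "b z2 z3 = 0" "b z3 z2 = 0" using R(3)[OF z(3)] R(4)[OF z(3)] by simp_all
  have g21: "b z2 z1 = k" using R(2)[OF z(3)] by (simp add: k_def g23)
  have g30: "b z3 z0 = m" using R(4)[OF z(1)] by (simp add: m_def)
  have g10: "b z1 z0 = q - m" using R(2)[OF z(1)] by (simp add: m_def q_def)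
  have g02: "b z0 z2 = m - q" using R(1)[OF z(1)] by (simp add: m_def q_def algebra_simps)
  have g20: "b z2 z0 = - q" using R(3)[OF z(1)] g02 by (simp add: m_def)
  have "b z1 z1 + (m + k) = 0" using R(1)[OF z(2)] by (simp add: g10 g13 k_def q_def algebra_simps)
  then have "b z1 z1 = - (m + k)" by (simp only: eq_neg_iff_add_eq_0)
  then have g11: "b z1 z1 = - m - k" by simp
  have g22: "b z2 z2 = - m - k" using R(1)[OF z(3)] by (simp add: g20 g02 g21 g23)
  note G = p_def[symmetric] q_def[symmetric] g02 m_def[symmetric] g10 g11 k_def[symmetric] g13
    g20 g21 g22 g23 g30 g33
  have gram: "det (gram_matrix b [z0, z1, z2, z3]) = - (m * m * m * (m + 2 * k))"
    by (simp add: det_gram_4 G algebra_simps)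
  obtain r where r: "r \<noteq> 0" "- (m * m * m * (m + 2 * k)) = r\<^sup>2"
    using det_square[OF det z nondegenerate_det[OF nd zb]] unfolding gram by blast
  have m0: "m \<noteq> 0" using r by auto
  \<comment> \<open>A root of -m / (m + 2 k), which is a square by the determinant
    hypothesis.\<close>
  define \<rho> where "\<rho> = m * m / r"
  have X: "m * m * m * (m + 2 * k) = - (r * r)" using r(2) by (metis minus_minus power2_eq_square)
  have "r * r * (\<rho> * \<rho> * (m + 2 * k)) = m * (m * m * m * (m + 2 * k))"
    unfolding \<rho>_def using r(1) by (simp add: field_simps)
  also have "\<dots> = r * r * (- m)" unfolding X by simp
  finally have \<rho>: "\<rho> * \<rho> * (m + 2 * k) = - m"
    by (rule mult_left_cancel[THEN iffD1, rotated]) (use r(1) in simp)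
  have four: "(4::'a) \<noteq> 0" using two by (metis mult_eq_0_iff mult_2 numeral_Bit0)
  have "(8::'a) = 2 * 4" by simp
  then have eight: "(8::'a) \<noteq> 0" using two four by (metis mult_eq_0_iff)
  define \<mu> where "\<mu> = m / 4"
  have m\<mu>: "m = 4 * \<mu>" and \<mu>0: "\<mu> \<noteq> 0" using four m0 by (simp_all add: \<mu>_def)
  \<comment> \<open>\<rho> makes \<open>b f f\<close> opposite to \<open>b g g\<close>; so
    \<open>g + f\<close> and \<open>g - f\<close> are isotropic, as the target requires of the two
    middle vectors.\<close>
  define f g where "f = s \<rho> (z1 - z2)" and "g = z1 + z2"
  have fg: "f \<in> V" "g \<in> V" using z by (simp_all add: f_def g_def)
  define \<theta> where "\<theta> = \<rho> * (2 * q - m)"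
  have "b f f = - (2 * (\<rho> * \<rho> * (m + 2 * k)))" using z by (simp add: f_def bilin G algebra_simps)
  then have ff: "b f f = 8 * \<mu>" unfolding \<rho> by (simp add: m\<mu>)
  have H: "b z0 g = 4 * \<mu>" "b g z0 = - (4 * \<mu>)" "b z0 f = \<theta>" "b f z0 = \<theta>"
    "b z0 z3 = 4 * \<mu>" "b z3 z0 = 4 * \<mu>" "b g g = - (8 * \<mu>)" "b g f = 0" "b f g = 0"
    "b z3 f = 0" "b z3 g = 0" "b f z3 = 0" "b g z3 = 0"
    using z by (simp_all add: f_def g_def \<theta>_def bilin G algebra_simps flip: m\<mu>) (simp_all add: m\<mu>)
  \<comment> \<open>Adding \<sigma> times \<open>f\<close> makes \<open>z0\<close> orthogonal to
    \<open>f\<close>; \<open>u\<close> then adjusts its value to \<mu>.\<close>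
  define \<sigma> where "\<sigma> = - \<theta> / (8 * \<mu>)"
  have \<theta>: "\<theta> = - (8 * \<mu> * \<sigma>)" using eight \<mu>0 by (simp add: \<sigma>_def)
  define u where "u = (\<mu> + 8 * \<mu> * \<sigma> * \<sigma> - p) / (8 * \<mu>)"
  have p: "b z0 z0 = \<mu> + 8 * \<mu> * \<sigma> * \<sigma> - 8 * \<mu> * u" using eight \<mu>0 by (simp add: u_def p_def)
  let ?w0 = "z0 + s \<sigma> f + s u z3"
  have w: "?w0 \<in> V" "g + f \<in> V" "g - f \<in> V" "s 4 z3 \<in> V" using z fg by simp_all
  have sixteen: "(16::'a) \<noteq> 0" using four by (metis mult_eq_0_iff numeral_times_numeral semiring_norm(11,12,13))
  \<comment> \<open>Both factors are multiples of the plane of trace -2 in a basis \<open>x\<close>,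
    \<open>2 (x + \<alpha> x)\<close>.\<close>
  show ?thesis
    by (rule decomposableI[OF dim w,
          where ?p00.0 = \<mu> and ?p01.0 = "4 * \<mu>" and ?p10.0 = "- (4 * \<mu>)" and ?p11.0 = 0
            and ?q00.0 = 1 and ?q01.0 = 4 and ?q10.0 = "-4" and ?q11.0 = 0])
      (use \<mu>0 sixteen z fg in \<open>simp_all add: bilin H ff g33 p \<theta> algebra_simps\<close>)
qed

section \<open>A split first factor\<close>

text \<open>On the two pairs \<open>A\<close> is l times, respectively k times, the cyclic operator
  of X^2 - a X + 1. Two uses of the asymmetry relation collect the factor l k = 1, so this operator
  preserves the pairing, and two of its values determine the rest.\<close>

lemma cross_relations:
  assumes V: "u0 \<in> V" "u1 \<in> V" "w0 \<in> V" "w1 \<in> V" and lk: "l * k = 1"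
    and A: "A u0 = s l u1" "A u1 = s l (s a u1 - u0)" "A w0 = s k w1" "A w1 = s k (s a w1 - w0)"
  shows "b w0 u0 = k * b u0 w1" "b w0 u1 = k * b u1 w1"
    "b w1 u0 = k * (a * b u0 w1 - b u0 w0)" "b w1 u1 = k * (a * b u1 w1 - b u1 w0)"
    "b u0 w0 = b u1 w1" "b u0 w1 = a * b u1 w1 - b u1 w0"
proof -
  have R: "b u0 x = l * b x u1" "b u1 x = l * (a * b x u1 - b x u0)" "b w0 x = k * b x w1"
    "b w1 x = k * (a * b x w1 - b x w0)" if x: "x \<in> V" for x
  proof -
    have "b u0 x = b x (A u0)" "b u1 x = b x (A u1)" "b w0 x = b x (A w0)" "b w1 x = b x (A w1)"
      using x V by simp_all
    then show "b u0 x = l * b x u1" "b u1 x = l * (a * b x u1 - b x u0)" "b w0 x = k * b x w1"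
      "b w1 x = k * (a * b x w1 - b x w0)"
      using x V by (simp_all add: A bilin del: b_A)
  qed
  show 1: "b w0 u0 = k * b u0 w1" "b w0 u1 = k * b u1 w1"
    "b w1 u0 = k * (a * b u0 w1 - b u0 w0)" "b w1 u1 = k * (a * b u1 w1 - b u1 w0)"
    using R(3)[OF V(1)] R(3)[OF V(2)] R(4)[OF V(1)] R(4)[OF V(2)] .
  have "b u0 w0 = l * (k * b u1 w1)" "b u0 w1 = l * (k * (a * b u1 w1 - b u1 w0))"
    using R(1)[OF V(3)] R(1)[OF V(4)] 1 by simp_all
  then show "b u0 w0 = b u1 w1" "b u0 w1 = a * b u1 w1 - b u1 w0"
    using lk by (simp_all add: mult.assoc[symmetric])
qed

text \<open>Repeated use of the asymmetry relation expresses \<open>b u1 u1\<close> by itself. The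
  factor that arises vanishes only if l^2 = 1 or l is a root of X^2 - a X + 1.\<close>

lemma eigenpair_isotropic:
  assumes V: "u0 \<in> V" "u1 \<in> V" and A: "A u0 = s l u1" "A u1 = s l (s a u1 - u0)"
    and l: "l * l \<noteq> 1" "1 + l * l \<noteq> a * l"
  shows "b u0 u0 = 0" "b u0 u1 = 0" "b u1 u0 = 0" "b u1 u1 = 0"
proof -
  have R: "b u0 x = l * b x u1" "b u1 x = l * (a * b x u1 - b x u0)" if x: "x \<in> V" for x
  proof -
    have "b u0 x = b x (A u0)" "b u1 x = b x (A u1)" using x V by simp_all
    then show "b u0 x = l * b x u1" "b u1 x = l * (a * b x u1 - b x u0)"
      using x V by (simp_all add: A bilin del: b_A)
  qed
  have 1: "b u0 u1 = l * b u1 u1" using R(1)[OF V(2)] .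
  have 2: "b u0 u0 = l * (l * b u1 u1)" using R(1)[OF V(1)] 1 by simp
  have 3: "b u1 u0 = l * (a * (l * b u1 u1) - l * (l * b u1 u1))" using R(2)[OF V(1)] 1 2 by simp
  have "b u1 u1 = l * (a * b u1 u1 - l * (a * (l * b u1 u1) - l * (l * b u1 u1)))"
    using R(2)[OF V(2)] 3 by simp
  then have "(1 - l * l) * ((1 + l * l) - a * l) * b u1 u1 = 0" by (simp add: algebra_simps)
  then have "b u1 u1 = 0" using l by simp
  then show "b u0 u0 = 0" "b u0 u1 = 0" "b u1 u0 = 0" "b u1 u1 = 0" using 1 2 3 by simp_all
qed

text \<open>Since a \<noteq> l + k, neither l nor k is a root of X^2 - a X + 1. Both planes are
  therefore isotropic, and \<open>b\<close> is their pairing, normalised by changing the cyclic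
  vector of the second plane.\<close>

lemma decomposable_hyperbolic:
  assumes bas: "ordered_basis s V [u0, u1, w0, w1]" and lk: "l * k = 1" and l: "l * l \<noteq> 1" and a: "a \<noteq> 2"
    and ne: "a \<noteq> l + k"
    and A: "A u0 = s l u1" "A u1 = s l (s a u1 - u0)" "A w0 = s k w1" "A w1 = s k (s a w1 - w0)"
  shows "decomposable s V b"
proof -
  have V: "u0 \<in> V" "u1 \<in> V" "w0 \<in> V" "w1 \<in> V" using ordered_basis_subset[OF bas] by auto
  have k0: "k \<noteq> 0" and l0: "l \<noteq> 0" using lk by auto
  have k: "k * k \<noteq> 1"
  proof
    assume "k * k = 1"
    then have "l * k * (l * k) = l * l" by (simp add: mult_ac)
    then show False using lk l by simp
  qed
  have "1 + l * l \<noteq> a * l"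
  proof
    assume "1 + l * l = a * l"
    then have "(k + l) * l = a * l" using lk by (simp add: algebra_simps)
    then show False using l0 ne by (simp add: add.commute)
  qed
  note U = eigenpair_isotropic[OF V(1,2) A(1,2) l this]
  have "1 + k * k \<noteq> a * k"
  proof
    assume "1 + k * k = a * k"
    then have "(l + k) * k = a * k" using lk by (simp add: algebra_simps)
    then show False using k0 ne by simp
  qed
  note W = eigenpair_isotropic[OF V(3,4) A(3,4) k this]
  note X = cross_relations[OF V lk A]
  define \<mu> \<nu> where "\<mu> = b u1 w1" and "\<nu> = b u1 w0"
  have m: "b u0 w0 = \<mu>" "b u0 w1 = a * \<mu> - \<nu>" "b u1 w0 = \<nu>" "b u1 w1 = \<mu>"
    using X by (simp_all add: \<mu>_def \<nu>_def)
  \<comment> \<open>The determinant of the pairing of the two planes.\<close>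
  define \<Delta> where "\<Delta> = \<mu> * \<mu> - \<nu> * (a * \<mu> - \<nu>)"
  have "\<Delta> \<noteq> 0"
  proof
    assume D: "\<Delta> = 0"
    have "s \<mu> w0 - s \<nu> w1 = 0"
      by (rule basis4_orthogonal_0[OF bas]) (use D in \<open>simp_all add: V bilin W m \<Delta>_def\<close>)
    then have "s 0 u0 + s 0 u1 + s \<mu> w0 + s (- \<nu>) w1 = 0" by simp
    from basis4_indep[OF bas this] have "\<mu> = 0" "\<nu> = 0" by simp_all
    then have "w0 = 0"
      by (intro basis4_orthogonal_0[OF bas]) (simp_all add: V W m)
    then show False using basis4_nonzero[OF bas] by simp
  qed
  \<comment> \<open>Cramer's rule for \<open>b u0 v0 = 1\<close> and
    \<open>b u1 v0 = a - 1\<close>.\<close>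
  define \<alpha> \<beta> where "\<alpha> = (\<mu> - (a - 1) * (a * \<mu> - \<nu>)) / \<Delta>" and "\<beta> = ((a - 1) * \<mu> - \<nu>) / \<Delta>"
  have "\<Delta> * (\<alpha> * \<mu> + \<beta> * (a * \<mu> - \<nu>)) = (\<mu> - (a - 1) * (a * \<mu> - \<nu>)) * \<mu> + ((a - 1) * \<mu> - \<nu>) * (a * \<mu> - \<nu>)"
    using \<open>\<Delta> \<noteq> 0\<close> by (simp add: \<alpha>_def \<beta>_def distrib_left mult.assoc[symmetric])
  also have "\<dots> = \<Delta> * 1" by (simp add: \<Delta>_def algebra_simps)
  finally have 1: "\<alpha> * \<mu> + \<beta> * (a * \<mu> - \<nu>) = 1" using \<open>\<Delta> \<noteq> 0\<close> mult_left_cancel by blast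
  have "\<Delta> * (\<alpha> * \<nu> + \<beta> * \<mu>) = (\<mu> - (a - 1) * (a * \<mu> - \<nu>)) * \<nu> + ((a - 1) * \<mu> - \<nu>) * \<mu>"
    using \<open>\<Delta> \<noteq> 0\<close> by (simp add: \<alpha>_def \<beta>_def distrib_left mult.assoc[symmetric])
  also have "\<dots> = \<Delta> * (a - 1)" by (simp add: \<Delta>_def algebra_simps)
  finally have 2: "\<alpha> * \<nu> + \<beta> * \<mu> = a - 1" using \<open>\<Delta> \<noteq> 0\<close> mult_left_cancel by blast
  \<comment> \<open>\<open>v1\<close> is the image of \<open>v0\<close> under w0 \<mapsto> w1, w1
    \<mapsto> a w1 - w0, so \<open>cross_relations\<close> applies to the new pair and fixes its
    remaining values.\<close>
  define v0 v1 where "v0 = s \<alpha> w0 + s \<beta> w1" and "v1 = s \<alpha> w1 + s \<beta> (s a w1 - w0)"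
  have v: "v0 \<in> V" "v1 \<in> V" using V by (simp_all add: v0_def v1_def)
  have Av: "A v0 = s k v1" "A v1 = s k (s a v1 - v0)"
    using V by (simp_all add: v0_def v1_def A_lin A) (simp_all add: algebra_simps)
  have vv: "b v0 v0 = 0" "b v0 v1 = 0" "b v1 v0 = 0" "b v1 v1 = 0"
    using V by (simp_all add: v0_def v1_def bilin W)
  note Y = cross_relations[OF V(1,2) v lk A(1,2) Av]
  have u0v: "b u0 v0 = 1" using V 1 by (simp add: v0_def bilin m)
  have u1v: "b u1 v0 = a - 1" using V 2 by (simp add: v0_def bilin m)
  have u11: "b u1 v1 = 1" using Y(5) u0v by simp
  have u01: "b u0 v1 = 1" using Y(6) u11 u1v by simp
  have a': "1 - (a - 1) \<noteq> 0" using a by simp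
  show ?thesis
    by (rule decomposableI[OF dim V(1,2) v,
          where ?p00.0 = 0 and ?p01.0 = 1 and ?p10.0 = k and ?p11.0 = 0
            and ?q00.0 = 1 and ?q01.0 = 1 and ?q10.0 = "a - 1" and ?q11.0 = 1])
      (use a' k0 in \<open>simp_all add: U vv u0v u1v u11 u01 Y(1-4)\<close>)
qed

text \<open>
  The symmetric form on the 1-eigenspace spanned by \<open>z2\<close> and \<open>z3\<close> is a hyperbolic plane precisely
  because the determinant is a square; the rest of \<open>b\<close> is determined by \<open>A\<close>.
\<close>

lemma decomposable_eigenvectors:
  assumes bas: "ordered_basis s V [z1, z2, z3, z4]" and lk: "l * k = 1" and l: "l * l \<noteq> 1"
    and A: "A z1 = s (l * l) z1" "A z2 = z2" "A z3 = z3" "A z4 = s (k * k) z4"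
    and det: "det_class s V b = square_class 1"
  shows "decomposable s V b"
proof -
  have V: "z1 \<in> V" "z2 \<in> V" "z3 \<in> V" "z4 \<in> V" using ordered_basis_subset[OF bas] by auto
  have k0: "k \<noteq> 0" and l0: "l \<noteq> 0" using lk by auto
  have k: "k * k \<noteq> 1"
  proof
    assume "k * k = 1"
    then have "l * k * (l * k) = l * l" by (simp add: mult_ac)
    then show False using lk l by simp
  qed
  have R: "b z1 x = l * l * b x z1" "b z2 x = b x z2" "b z3 x = b x z3" "b z4 x = k * k * b x z4"
    if x: "x \<in> V" for x
  proof -
    have "b z1 x = b x (A z1)" "b z2 x = b x (A z2)" "b z3 x = b x (A z3)" "b z4 x = b x (A z4)"
      using x V by simp_all
    then show "b z1 x = l * l * b x z1" "b z2 x = b x z2" "b z3 x = b x z3" "b z4 x = k * k * b x z4"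
      using x V by (simp_all add: A bilin del: b_A)
  qed
  have fix0: "y = 0" if "y = c * y" "c \<noteq> 1" for c y :: 'a using that by (metis mult_cancel_right1)
  have g11: "b z1 z1 = 0" by (rule fix0[OF R(1)[OF V(1)] l])
  have g44: "b z4 z4 = 0" by (rule fix0[OF R(4)[OF V(4)] k])
  have g12: "b z1 z2 = 0" by (rule fix0[OF _ l]) (use R(1)[OF V(2)] R(2)[OF V(1)] in simp)
  have g13: "b z1 z3 = 0" by (rule fix0[OF _ l]) (use R(1)[OF V(3)] R(3)[OF V(1)] in simp)
  have g42: "b z4 z2 = 0" by (rule fix0[OF _ k]) (use R(4)[OF V(2)] R(2)[OF V(4)] in simp)
  have g43: "b z4 z3 = 0" by (rule fix0[OF _ k]) (use R(4)[OF V(3)] R(3)[OF V(4)] in simp)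
  have sym: "b z2 z1 = 0" "b z3 z1 = 0" "b z2 z4 = 0" "b z3 z4 = 0"
    using R(2)[OF V(1)] R(3)[OF V(1)] R(2)[OF V(4)] R(3)[OF V(4)] g12 g13 g42 g43 by simp_all
  define m p q r where "m = b z1 z4" and "p = b z2 z2" and "q = b z2 z3" and "r = b z3 z3"
  have g41: "b z4 z1 = k * k * m" using R(4)[OF V(1)] by (simp add: m_def)
  have g32: "b z3 z2 = q" using R(3)[OF V(2)] by (simp add: q_def)
  note G = g11 g44 g12 g13 g42 g43 sym g41 g32 m_def[symmetric] p_def[symmetric] q_def[symmetric] r_def[symmetric]
  \<comment> \<open>The outer pair contributes a square, so everything depends on q^2 - p r.\<close>
  have gram: "det (gram_matrix b [z1, z2, z3, z4]) = (k * m) * (k * m) * (q * q - p * r)"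
    by (simp add: det_gram_4 G algebra_simps)
  obtain d where d: "d \<noteq> 0" "(k * m) * (k * m) * (q * q - p * r) = d\<^sup>2"
    using det_square[OF det V nondegenerate_det[OF nd bas]] unfolding gram by blast
  have m0: "m \<noteq> 0" using d by auto
  define t where "t = d / (k * m)"
  have t0: "t \<noteq> 0" using d m0 k0 by (simp add: t_def)
  have "t * t = q * q - p * r" unfolding t_def using d(2) k0 m0 by (simp add: field_simps power2_eq_square)
  then have qq: "q * q = t * t + p * r" by simp
  have "\<exists>y1\<in>V. \<exists>y2\<in>V. b y1 y1 = 0 \<and> b y2 y2 = 0 \<and> b y1 y2 = 1 \<and> b y2 y1 = 1
    \<and> b z1 y1 = 0 \<and> b z1 y2 = 0 \<and> b z4 y1 = 0 \<and> b z4 y2 = 0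
    \<and> b y1 z1 = 0 \<and> b y2 z1 = 0 \<and> b y1 z4 = 0 \<and> b y2 z4 = 0"
  proof (cases "p = 0")
    case True
    then have q0: "q \<noteq> 0" using qq t0 by auto
    let ?y = "s (1 / q) (z3 - s (r / (2 * q)) z2)"
    show ?thesis
      by (rule bexI[of _ z2], rule bexI[of _ ?y])
        (use V two q0 True in \<open>simp_all add: bilin G field_simps\<close>)
  next
    case False
    \<comment> \<open>The two isotropic directions of the eigenplane, which exist over the field
      because \<open>t\<close> is a root of q^2 - p r.\<close>
    let ?y1 = "s (t - q) z2 + s p z3" and ?y = "s (- t - q) z2 + s p z3"
    define n where "n = - (2 * p * t * t)"
    have n0: "n \<noteq> 0" using False two t0 by (simp add: n_def)
    have y: "?y1 \<in> V" "?y \<in> V" using V by simp_all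
    have "p * (q * q) = p * (t * t + p * r)" by (simp only: qq)
    then have y0: "b ?y1 ?y1 = 0" "b ?y ?y = 0" "b ?y1 ?y = n" "b ?y ?y1 = n"
      using V by (simp_all add: bilin G n_def algebra_simps)
    have orth: "b z1 ?y1 = 0" "b z1 ?y = 0" "b z4 ?y1 = 0" "b z4 ?y = 0"
      "b ?y1 z1 = 0" "b ?y z1 = 0" "b ?y1 z4 = 0" "b ?y z4 = 0"
      using V by (simp_all add: bilin G)
    show ?thesis
      by (rule bexI[OF _ y(1)], rule bexI[of _ "s (1 / n) ?y"])
        (use y n0 V in \<open>simp_all only: y0 orth scale_left scale_right V_closed, simp_all\<close>)
  qed
  then obtain y1 y2 where y: "y1 \<in> V" "y2 \<in> V" "b y1 y1 = 0" "b y2 y2 = 0" "b y1 y2 = 1" "b y2 y1 = 1"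
    "b z1 y1 = 0" "b z1 y2 = 0" "b z4 y1 = 0" "b z4 y2 = 0"
    "b y1 z1 = 0" "b y2 z1 = 0" "b y1 z4 = 0" "b y2 z4 = 0" by blast
  \<comment> \<open>Both factors are the plane with Gram matrix ((0, 1), (k, 0)), whose asymmetry is
    diagonal with eigenvalues l and k.\<close>
  show ?thesis
    by (rule decomposableI[OF dim V(1) y(1) V_closed(5)[OF y(2), of k] V_closed(5)[OF V(4), of "1 / m"],
          where ?p00.0 = 0 and ?p01.0 = 1 and ?p10.0 = k and ?p11.0 = 0
            and ?q00.0 = 0 and ?q01.0 = 1 and ?q10.0 = k and ?q11.0 = 0])
      (use k0 m0 V y(1,2) in \<open>simp_all add: bilin G y(3-)\<close>)
qed

lemma decomposable_split:
  assumes bas: "ordered_basis s V [e0, e1, e2, e3]" and act: "tensor_action s A a1 a2 e0 e1 e2 e3"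
    and a1: "a1 = l + k" and lk: "l * k = 1" and l: "l * l \<noteq> 1" and a2: "a2 \<noteq> 2"
    and det: "det_class s V b = square_class 1"
  shows "decomposable s V b"
proof -
  have e: "e0 \<in> V" "e1 \<in> V" "e2 \<in> V" "e3 \<in> V" using ordered_basis_subset[OF bas] by auto
  have Ae: "A e0 = e3" "A e1 = s a2 e3 - e2" "A e2 = s (l + k) e3 - e1"
    "A e3 = e0 - s (l + k) e2 - s a2 e1 + s ((l + k) * a2) e3"
    using act by (simp_all add: tensor_action_def a1)
  have ne: "l \<noteq> k" using lk l by auto
  \<comment> \<open>Applying \<alpha> - k and \<alpha> - l in the first factor leaves eigenvectors
    of \<alpha> for l and k, so \<open>A\<close> becomes l times, respectively k times, the second
    factor.\<close>
  define u0 u1 w0 w1 where "u0 = e2 - s k e0" and "u1 = e3 - s k e1" and "w0 = e2 - s l e0" and "w1 = e3 - s l e1"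
  have V: "u0 \<in> V" "u1 \<in> V" "w0 \<in> V" "w1 \<in> V" using e by (simp_all add: u0_def u1_def w0_def w1_def)
  have kl: "k * l = 1" "l * (k * x) = x" "k * (l * x) = x" for x
    using lk by (simp_all add: mult.commute mult.left_commute mult.assoc[symmetric])
  have A: "A u0 = s l u1" "A u1 = s l (s a2 u1 - u0)" "A w0 = s k w1" "A w1 = s k (s a2 w1 - w0)"
    using e by (simp_all add: u0_def u1_def w0_def w1_def A_lin Ae) (simp_all add: algebra_simps lk kl)
  have bas': "ordered_basis s V [u0, u1, w0, w1]"
  proof (rule basis4I[OF V])
    fix c0 c1 c2 c3 assume "s c0 u0 + s c1 u1 + s c2 w0 + s c3 w1 = 0"
    then have "s (- (c0 * k + c2 * l)) e0 + s (- (c1 * k + c3 * l)) e1 + s (c0 + c2) e2 + s (c1 + c3) e3 = 0"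
      by (simp add: u0_def u1_def w0_def w1_def algebra_simps)
    from basis4_indep[OF bas this] have "- (c0 * k) = c2 * l" "- (c1 * k) = c3 * l" "c0 = - c2" "c1 = - c3"
      by (simp_all add: eq_neg_iff_add_eq_0)
    then have "c2 * (l - k) = 0" "c3 * (l - k) = 0" "c0 = - c2" "c1 = - c3" by (auto simp: algebra_simps)
    then show "c0 = 0 \<and> c1 = 0 \<and> c2 = 0 \<and> c3 = 0" using ne by simp
  qed
  show ?thesis
  proof (cases "a2 = l + k")
    case False
    then show ?thesis using decomposable_hyperbolic[OF bas' lk l a2 _ A] by simp
  next
    case True
    \<comment> \<open>The second factor splits in the same way, which yields eigenvectors of
      \<open>A\<close> for l^2, l k = 1, k l = 1 and k^2.\<close>
    define z1 z2 z3 z4 where "z1 = u1 - s k u0" and "z2 = u1 - s l u0" and "z3 = w1 - s k w0" and "z4 = w1 - s l w0"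
    have z: "z1 \<in> V" "z2 \<in> V" "z3 \<in> V" "z4 \<in> V" using V by (simp_all add: z1_def z2_def z3_def z4_def)
    have Az: "A z1 = s (l * l) z1" "A z2 = z2" "A z3 = z3" "A z4 = s (k * k) z4"
      using V by (simp_all add: z1_def z2_def z3_def z4_def A_lin A True) (simp_all add: algebra_simps lk kl)
    have "ordered_basis s V [z1, z2, z3, z4]"
    proof (rule basis4I[OF z])
      fix c0 c1 c2 c3 assume "s c0 z1 + s c1 z2 + s c2 z3 + s c3 z4 = 0"
      then have "s (- (c0 * k + c1 * l)) u0 + s (c0 + c1) u1 + s (- (c2 * k + c3 * l)) w0 + s (c2 + c3) w1 = 0"
        by (simp add: z1_def z2_def z3_def z4_def algebra_simps)
      from basis4_indep[OF bas' this] have "- (c0 * k) = c1 * l" "- (c2 * k) = c3 * l" "c0 = - c1" "c2 = - c3"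
        by (simp_all add: eq_neg_iff_add_eq_0)
      then have "c1 * (l - k) = 0" "c3 * (l - k) = 0" "c0 = - c1" "c2 = - c3" by (auto simp: algebra_simps)
      then show "c0 = 0 \<and> c1 = 0 \<and> c2 = 0 \<and> c3 = 0" using ne by simp
    qed
    from decomposable_eigenvectors[OF this lk l Az det] show ?thesis .
  qed
qed

lemma decomposable_not_generic:
  assumes bas: "ordered_basis s V [e0, e1, e2, e3]" and act: "tensor_action s A a1 a2 e0 e1 e2 e3"
    and a: "a1 \<noteq> 2" "a2 \<noteq> 2" and ng: "\<not> generic_trace a1" and det: "det_class s V b = square_class 1"
  shows "decomposable s V b"
proof (cases "a1 = -2")
  case True
  show ?thesis
  proof (cases "a2 = -2")
    case True
    show ?thesis
      by (rule decomposable_minus_2_minus_2[OF bas _ det]) (use act \<open>a1 = -2\<close> True in simp)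
  next
    case False
    show ?thesis
      by (rule decomposable_minus_2_cyclic[OF bas _ a(2) False]) (use act \<open>a1 = -2\<close> in simp)
  qed
next
  case False
  then obtain u where u: "u \<noteq> 0" "a1\<^sup>2 - 4 = u\<^sup>2" using ng a by (auto simp: generic_trace_def)
  \<comment> \<open>The roots of X^2 - a1 X + 1, distinct because
    \<open>u \<noteq> 0\<close>.\<close>
  define l k where "l = (a1 + u) / 2" and "k = (a1 - u) / 2"
  have four: "(4::'a) \<noteq> 0" using two by (metis mult_eq_0_iff mult_2 numeral_Bit0)
  have lk1: "a1 = l + k" and u2: "l - k = u" using two four by (simp_all add: l_def k_def field_simps)
  have "l * k = (a1\<^sup>2 - u\<^sup>2) / 4"
    using two four by (simp add: l_def k_def field_simps power2_eq_square)
  also have "a1\<^sup>2 - u\<^sup>2 = 4" by (simp flip: u(2))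
  also have "4 / 4 = (1::'a)" using four by simp
  finally have lk: "l * k = 1" .
  have "l * l \<noteq> 1"
  proof
    assume "l * l = 1"
    then have "l * (l - k) = 0" using lk by (simp add: right_diff_distrib)
    then show False using u(1) u2 lk by auto
  qed
  with decomposable_split[OF bas act lk1 lk _ a(2) det] show ?thesis .
qed

end

theorem proposition3p5:
  fixes s :: "'a::field \<Rightarrow> 'v::ab_group_add \<Rightarrow> 'v"
    and V :: "'v set" and b :: "'v \<Rightarrow> 'v \<Rightarrow> 'a"
  assumes "CHAR('a) \<noteq> 2"
    and "bilinear_space s V b"
    and "nondegenerate V b"
    and "vector_space.dim s V = 4"
    and "has_decomposable_asymmetry s V b"
    and "\<not> has_generic_decomposable_asymmetry s V b"
  shows "decomposable s V b \<longleftrightarrow> det_class s V b = square_class 1"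
proof
  interpret bilinear_space s V b by fact
  show "det_class s V b = square_class 1" if "decomposable s V b"
    by (rule decomposable_det_class[OF assms(3,4) that])
next
  assume det: "det_class s V b = square_class 1"
  have two: "(2::'a) \<noteq> 0"
  proof
    assume "(2::'a) = 0"
    then have "of_nat 2 = (0::'a)" by simp
    then have "CHAR('a) dvd 2" by (simp only: of_nat_eq_0_iff_char_dvd)
    moreover have "CHAR('a) \<noteq> 1" by simp
    ultimately show False using assms(1) two_is_prime_nat unfolding prime_nat_iff by blast
  qed
  interpret asymmetric_space s V b "asymmetry s V b"
    by (intro asymmetric_space.intro asymmetric_space_axioms.intro assms two refl)
  show "decomposable s V b"
  proof (rule decomposable_asymmetry_cases[OF assms(2-4) two assms(5,6)])
    fix \<epsilon> :: 'a
    assume \<epsilon>: "\<epsilon> = 1 \<or> \<epsilon> = -1" and A: "\<And>x. x \<in> V \<Longrightarrow> asymmetry s V b x = s \<epsilon> x"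
    from \<epsilon> show ?thesis
    proof
      assume "\<epsilon> = 1"
      then show ?thesis using A det by (intro decomposable_symmetric) simp_all
    next
      assume "\<epsilon> = -1"
      then show ?thesis using A by (intro decomposable_alternating) simp_all
    qed
  next
    fix a1 a2 e0 e1 e2 e3
    assume a: "a1 \<noteq> 2" "a2 \<noteq> 2" and bas: "ordered_basis s V [e0, e1, e2, e3]"
      and act: "tensor_action s (asymmetry s V b) a1 a2 e0 e1 e2 e3"
      and "\<not> generic_trace a1 \<or> \<not> generic_trace a2"
    then consider "\<not> generic_trace a1" | "\<not> generic_trace a2" by blast
    then show ?thesis
    proof cases
      case 1
      show ?thesis by (rule decomposable_not_generic[OF bas act a 1 det])
    next
      case 2
      have "ordered_basis s V [e0, e2, e1, e3]"
        using bas by (auto simp: ordered_basis_def insert_commute)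
      from decomposable_not_generic[OF this tensor_action_swap[OF act] a(2,1) 2 det] show ?thesis .
    qed
  qed (rule decomposable_half_scalar)
qed

end
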